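(* Let $G=\mathbb{Z}_2$, let $p \colon E \to B$ be a locally trivial fibration, where $E$ is an ENR and $B$ is a separable ANR, and let $k$ be a nonnegative integer. Then the following statements are equivalent: \begin{enumerate} \item $\mathrm{TC}^{M,\,\Sigma}[p \colon E\to B] \leq k$. \item $\mathrm{TC}^{FH,\,\Sigma}[p \colon E\to B] \leq k$. \item $\mathrm{TC}^{DM,\,\Sigma}[p \colon E\to B] \leq k$. \item $\mathrm{TC}^{\Sigma}[p \colon E\to B] \leq k$. \item The $G$-fibration $\Pi_k \colon J^k_{E \times_B E}(E^I_B) \to E \times_B E$ admits a global $G$-section. \item The $G$-fibration $\Pi_k \colon J^k_{E \times_B E}(E^I_B) \to E \times_B E$ admits a global $G$-section $\sigma$ satisfying $\sigma \circ \Delta_E = s_k$. \end{enumerate}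
   Context: Fibration means Hurewicz fibration, $I=[0,1]$, $G = \mathbb{Z}_2 = \langle g\rangle$. ENR is Euclidean neighborhood retract; ANR is absolute neighborhood retract for metrizable spaces. For a fibration $p \colon E \to B$: $E \times_B E = \{(e_1,e_2)\in E\times E \mid p(e_1)=p(e_2)\}$ with $g\cdot(e_1,e_2)=(e_2,e_1)$; $\Delta_E \colon E \to E\times_B E$, $e\mapsto(e,e)$, with image $\Delta E$; $E^I_B = \{\gamma \in E^I \mid p\circ\gamma \text{ is constant}\}$ (subspace of $E^I$ with compact-open topology) with $(g\cdot\gamma)(t)=\gamma(1-t)$; $\Pi \colon E^I_B \to E \times_B E$, $\Pi(\gamma)=(\gamma(0),\gamma(1))$, is a $G$-fibration; $\mathrm{c}_e$ is the constant path at $e$. A (local) $G$-section is a continuous $G$-equivariant section. Each invariant below is $\infty$ if no such integer exists. $\mathrm{TC}^{\Sigma}[p \colon E\to B] := \mathrm{secat}_G(\Pi)$, the least $k\ge 0$ such that $E\times_B E$ has a cover by $G$-invariant open sets $U_0,\dots,U_k$ with $G$-maps $s_i\colon U_i\to E^I_B$ such that $\Pi\circ s_i$ is $G$-homotopic to the inclusion $U_i\hookrightarrow E\times_B E$. $\mathrm{TC}^{M,\Sigma}[p \colon E\to B]$: the least $k\ge0$ such that $E \times_B E$ is covered by $G$-invariant open subsets $U_0,\dots,U_k$, each containing $\Delta E$ and admitting a local $G$-section $\sigma_i \colon U_i \to E^I_B$ of $\Pi$ with $\sigma_i(e,e) = \mathrm{c}_e$ for all $e \in E$. $\mathrm{TC}^{DM,\Sigma}[p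 \colon E\to B]$: the least $k\ge0$ such that $E \times_B E$ is covered by $G$-invariant open subsets $U_0,\dots,U_k$, each admitting a local $G$-section $\sigma_i$ of $\Pi$ with $\sigma_i(e,e) = \mathrm{c}_e$ for all $e \in E$ with $(e,e)\in U_i$. $\mathrm{TC}^{FH,\Sigma}[p \colon E\to B]$: the least $k\ge0$ such that $E \times_B E$ is covered by $G$-invariant open subsets $U_0,\dots,U_k$, each admitting a local $G$-section $\sigma_i$ of $\Pi$, such that $\Delta E\subseteq U_0$, $\sigma_0(e,e) = \mathrm{c}_e$ for all $e \in E$, and $\Delta E\cap U_i=\emptyset$ for all $i\ge1$. Fibred join: for a $G$-map $q \colon X \to Y$, $J^k_Y(X) = \{(x_0,t_0,\dots,x_k,t_k) \mid x_i \in X,\ t_i \in I,\ q(x_i)=q(x_j),\ \sum t_i = 1\}/\sim$, where $\sim$ is generated by $(x_0,t_0,\dots,x_i,0,\dots,x_k,t_k) \sim (x_0,t_0,\dots,x_i',0,\dots,x_k,t_k)$, with $G$-action $g\cdot[x_0,t_0,\dots,x_k,t_k]=[g x_0,t_0,\dots,g x_k,t_k]$; $q_k \colon J^k_Y(X) \to Y$ is $q_k([x_0,t_0,\dots,x_k,t_k]) = q(x_0)=\dots=q(x_k)$. $\Pi_k$ is this construction applied to $\Pi$. The map $s_k \colon E \to J^k_{E\times_B E}(E^I_B)$ is $s_k(e) = [\mathrm{c}_e,\frac1{k+1},\dots,\mathrm{c}_e,\frac1{k+1}]$. *)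

theory Defs
  imports "HOL-Analysis.Analysis" "HOL-Library.Extended_Nat"
begin

section \<open>Fibrations and absolute neighborhood retracts\<close>

abbreviation unit_interval :: "real topology"
  where "unit_interval \<equiv> top_of_set {0..1}"

text \<open>
  The homotopy lifting property is required for test spaces on the type
  \<^typ>\<open>'e \<times> (real \<Rightarrow> 'b)\<close>, since HOL cannot quantify over all types inside a definition.
  Nothing is lost: every lifting problem is a pullback of the universal one, whose test space
  \<open>{(e, \<beta>) \<in> E \<times> B^I. \<beta> 0 = p e}\<close> lives on this type.
\<close>

definition Hurewicz_fibration :: "'e topology \<Rightarrow> 'b topology \<Rightarrow> ('e \<Rightarrow> 'b) \<Rightarrow> bool"
  where "Hurewicz_fibration E B p \<longleftrightarrow>
    continuous_map E B p \<and>
    (\<forall>(X :: ('e \<times> (real \<Rightarrow> 'b)) topology) f H.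
       continuous_map X E f \<and> continuous_map (prod_topology X unit_interval) B H \<and>
       (\<forall>x\<in>topspace X. H (x, 0) = p (f x)) \<longrightarrow>
       (\<exists>H'. continuous_map (prod_topology X unit_interval) E H' \<and>
          (\<forall>x\<in>topspace X. H' (x, 0) = f x) \<and>
          (\<forall>x\<in>topspace X. \<forall>t\<in>{0..1}. p (H' (x, t)) = H (x, t))))"

text \<open>
  The local fibre \<open>F\<close> may depend on the point of the base. It is homeomorphic to the fibre
  over that point, so it may be taken on the type of the total space.
\<close>

definition locally_trivial :: "'e topology \<Rightarrow> 'b topology \<Rightarrow> ('e \<Rightarrow> 'b) \<Rightarrow> bool"
  where "locally_trivial E B p \<longleftrightarrow>
    continuous_map E B p \<and>
    (\<forall>b\<in>topspace B. \<exists>V (F :: 'e topology) h.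
       openin B V \<and> b \<in> V \<and>
       homeomorphic_map (subtopology E {e \<in> topspace E. p e \<in> V})
         (prod_topology (subtopology B V) F) h \<and>
       (\<forall>e\<in>topspace E. p e \<in> V \<longrightarrow> fst (h e) = p e))"

text \<open>
  Absolute neighborhood retracts for metrizable spaces; the constant \<^const>\<open>ANR\<close> of the
  library only concerns subsets of Euclidean spaces. The ambient metrizable spaces range over
  all topologies on \<^typ>\<open>'a \<Rightarrow> real\<close>. By Kuratowski and Wojdyslawski, \<open>X\<close> embeds as a closed
  subset of a convex subset of the Banach space of bounded continuous functions on \<open>X\<close>, which
  lives on this type, and by Dugundji's extension theorem being a neighborhood retract there
  already gives the property for all metrizable spaces, on any type.
\<close>

definition ANR_metrizable :: "'a topology \<Rightarrow> bool"
  where "ANR_metrizable X \<longleftrightarrow>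
    metrizable_space X \<and>
    (\<forall>(Y :: ('a \<Rightarrow> real) topology) h.
       metrizable_space Y \<and> embedding_map X Y h \<and> closedin Y (h ` topspace X) \<longrightarrow>
       (\<exists>W. openin Y W \<and> h ` topspace X \<subseteq> W \<and>
          (h ` topspace X) retract_of_space (subtopology Y W)))"


section \<open>Spaces with an action of the group of order two\<close>

text \<open>
  An action of \<open>\<int>\<^sub>2 = \<langle>g\<rangle>\<close> is represented by the involution \<open>x \<mapsto> g \<cdot> x\<close>. Below, \<open>a\<close> and \<open>b\<close>
  denote the involutions on \<open>X\<close> and \<open>Y\<close>.
\<close>

definition Z2_map :: "'x topology \<Rightarrow> ('x \<Rightarrow> 'x) \<Rightarrow> 'y topology \<Rightarrow> ('y \<Rightarrow> 'y) \<Rightarrow> ('x \<Rightarrow> 'y) \<Rightarrow> bool"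
  where "Z2_map X a Y b f \<longleftrightarrow>
    continuous_map X Y f \<and> (\<forall>x\<in>topspace X. f (a x) = b (f x))"

definition Z2_homotopic ::
    "'x topology \<Rightarrow> ('x \<Rightarrow> 'x) \<Rightarrow> 'y topology \<Rightarrow> ('y \<Rightarrow> 'y) \<Rightarrow> ('x \<Rightarrow> 'y) \<Rightarrow> ('x \<Rightarrow> 'y) \<Rightarrow> bool"
  where "Z2_homotopic X a Y b f f' \<longleftrightarrow>
    homotopic_with (\<lambda>h. \<forall>x\<in>topspace X. h (a x) = b (h x)) X Y f f'"

definition Z2_section_on ::
    "'x topology \<Rightarrow> ('x \<Rightarrow> 'x) \<Rightarrow> 'y topology \<Rightarrow> ('y \<Rightarrow> 'y) \<Rightarrow> ('x \<Rightarrow> 'y) \<Rightarrow>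
     'y set \<Rightarrow> ('y \<Rightarrow> 'x) \<Rightarrow> bool"
  where "Z2_section_on X a Y b q U s \<longleftrightarrow>
    Z2_map (subtopology Y U) b X a s \<and> (\<forall>y\<in>topspace Y \<inter> U. q (s y) = y)"

definition Z2_open_cover :: "'y topology \<Rightarrow> ('y \<Rightarrow> 'y) \<Rightarrow> nat \<Rightarrow> (nat \<Rightarrow> 'y set) \<Rightarrow> bool"
  where "Z2_open_cover Y b k U \<longleftrightarrow>
    (\<forall>i\<le>k. openin Y (U i) \<and> b ` U i \<subseteq> U i) \<and> topspace Y \<subseteq> (\<Union>i\<le>k. U i)"

definition secat_Z2 ::
    "'x topology \<Rightarrow> ('x \<Rightarrow> 'x) \<Rightarrow> 'y topology \<Rightarrow> ('y \<Rightarrow> 'y) \<Rightarrow> ('x \<Rightarrow> 'y) \<Rightarrow> enat"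
  where "secat_Z2 X a Y b q = Inf {enat k | k. \<exists>U. Z2_open_cover Y b k U \<and>
    (\<forall>i\<le>k. \<exists>s. Z2_map (subtopology Y (U i)) b X a s \<and>
       Z2_homotopic (subtopology Y (U i)) b Y b (q \<circ> s) id)}"


section \<open>The fibrewise path space\<close>

text \<open>Maps are represented extensionally, that is, as \<^const>\<open>undefined\<close> off their domain.\<close>

definition compact_open_topology :: "'a topology \<Rightarrow> 'b topology \<Rightarrow> ('a \<Rightarrow> 'b) topology"
  where "compact_open_topology X Y = topology_generated_by
    {{f \<in> extensional (topspace X). continuous_map X Y f \<and> f ` K \<subseteq> V} | K V.
       compactin X K \<and> openin Y V}"

definition fib_square :: "'e topology \<Rightarrow> ('e \<Rightarrow> 'b) \<Rightarrow> ('e \<times> 'e) topology"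
  where "fib_square E p = subtopology (prod_topology E E) {(e1, e2). p e1 = p e2}"

definition diag :: "'e topology \<Rightarrow> ('e \<times> 'e) set"
  where "diag E = (\<lambda>e. (e, e)) ` topspace E"

definition fib_paths :: "'e topology \<Rightarrow> ('e \<Rightarrow> 'b) \<Rightarrow> (real \<Rightarrow> 'e) topology"
  where "fib_paths E p = subtopology (compact_open_topology unit_interval E)
    {\<gamma>. \<exists>b. \<forall>t\<in>{0..1}. p (\<gamma> t) = b}"

definition rev_path :: "(real \<Rightarrow> 'e) \<Rightarrow> real \<Rightarrow> 'e"
  where "rev_path \<gamma> = (\<lambda>t\<in>{0..1}. \<gamma> (1 - t))"

definition const_path :: "'e \<Rightarrow> real \<Rightarrow> 'e"
  where "const_path e = (\<lambda>t\<in>{0..1}. e)"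

definition endpoints :: "(real \<Rightarrow> 'e) \<Rightarrow> 'e \<times> 'e"
  where "endpoints \<gamma> = (\<gamma> 0, \<gamma> 1)"

abbreviation endpoints_section ::
    "'e topology \<Rightarrow> ('e \<Rightarrow> 'b) \<Rightarrow> ('e \<times> 'e) set \<Rightarrow> ('e \<times> 'e \<Rightarrow> real \<Rightarrow> 'e) \<Rightarrow> bool"
  where "endpoints_section E p U \<sigma> \<equiv>
    Z2_section_on (fib_paths E p) rev_path (fib_square E p) prod.swap endpoints U \<sigma>"


section \<open>Symmetric parametrized topological complexities\<close>

definition TC_Sigma :: "'e topology \<Rightarrow> ('e \<Rightarrow> 'b) \<Rightarrow> enat"
  where "TC_Sigma E p =
    secat_Z2 (fib_paths E p) rev_path (fib_square E p) prod.swap endpoints"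

definition TC_M_Sigma :: "'e topology \<Rightarrow> ('e \<Rightarrow> 'b) \<Rightarrow> enat"
  where "TC_M_Sigma E p = Inf {enat k | k. \<exists>U. Z2_open_cover (fib_square E p) prod.swap k U \<and>
    (\<forall>i\<le>k. diag E \<subseteq> U i \<and>
       (\<exists>\<sigma>. endpoints_section E p (U i) \<sigma> \<and>
          (\<forall>e\<in>topspace E. \<sigma> (e, e) = const_path e)))}"

definition TC_DM_Sigma :: "'e topology \<Rightarrow> ('e \<Rightarrow> 'b) \<Rightarrow> enat"
  where "TC_DM_Sigma E p = Inf {enat k | k. \<exists>U. Z2_open_cover (fib_square E p) prod.swap k U \<and>
    (\<forall>i\<le>k. \<exists>\<sigma>. endpoints_section E p (U i) \<sigma> \<and>
       (\<forall>e\<in>topspace E. (e, e) \<in> U i \<longrightarrow> \<sigma> (e, e) = const_path e))}"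

definition TC_FH_Sigma :: "'e topology \<Rightarrow> ('e \<Rightarrow> 'b) \<Rightarrow> enat"
  where "TC_FH_Sigma E p = Inf {enat k | k. \<exists>U \<sigma>. Z2_open_cover (fib_square E p) prod.swap k U \<and>
    (\<forall>i\<le>k. endpoints_section E p (U i) (\<sigma> i)) \<and>
    diag E \<subseteq> U 0 \<and> (\<forall>e\<in>topspace E. \<sigma> 0 (e, e) = const_path e) \<and>
    (\<forall>i. 1 \<le> i \<and> i \<le> k \<longrightarrow> diag E \<inter> U i = {})}"


section \<open>The fibred join\<close>

definition quotient_topology :: "'a topology \<Rightarrow> ('a \<Rightarrow> 'c) \<Rightarrow> 'c topology"
  where "quotient_topology X f =
    topology (\<lambda>W. W \<subseteq> f ` topspace X \<and> openin X {x \<in> topspace X. f x \<in> W})"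

lemma openin_quotient_topology:
  "openin (quotient_topology X f) W \<longleftrightarrow>
     W \<subseteq> f ` topspace X \<and> openin X {x \<in> topspace X. f x \<in> W}"
proof -
  have "istopology (\<lambda>W. W \<subseteq> f ` topspace X \<and> openin X {x \<in> topspace X. f x \<in> W})"
    unfolding istopology_def
  proof (intro conjI allI impI)
    fix S T
    assume S: "S \<subseteq> f ` topspace X \<and> openin X {x \<in> topspace X. f x \<in> S}"
      and T: "T \<subseteq> f ` topspace X \<and> openin X {x \<in> topspace X. f x \<in> T}"
    show "S \<inter> T \<subseteq> f ` topspace X"
      using S by blast
    have "{x \<in> topspace X. f x \<in> S \<inter> T} = {x \<in> topspace X. f x \<in> S} \<inter> {x \<in> topspace X. f x \<in> T}"
      by blast
    then show "openin X {x \<in> topspace X. f x \<in> S \<inter> T}"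
      using S T by (simp only: openin_Int)
  next
    fix \<K>
    assume K: "\<forall>S\<in>\<K>. S \<subseteq> f ` topspace X \<and> openin X {x \<in> topspace X. f x \<in> S}"
    show "\<Union>\<K> \<subseteq> f ` topspace X"
      using K by blast
    have "{x \<in> topspace X. f x \<in> \<Union>\<K>} = (\<Union>S\<in>\<K>. {x \<in> topspace X. f x \<in> S})"
      by blast
    then show "openin X {x \<in> topspace X. f x \<in> \<Union>\<K>}"
      using K by (simp only:) (rule openin_Union, blast)
  qed
  then show ?thesis
    unfolding quotient_topology_def by (simp only: topology_inverse')
qed

text \<open>
  The tuple \<open>(x\<^sub>0, t\<^sub>0, \<dots>, x\<^sub>k, t\<^sub>k)\<close> is the function on \<open>{..k}\<close> sending \<open>i\<close> to \<open>(x\<^sub>i, t\<^sub>i)\<close>.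
\<close>

definition join_tuples :: "'x topology \<Rightarrow> ('x \<Rightarrow> 'y) \<Rightarrow> nat \<Rightarrow> (nat \<Rightarrow> 'x \<times> real) topology"
  where "join_tuples X q k =
    subtopology (product_topology (\<lambda>i. prod_topology X unit_interval) {..k})
      {z. (\<forall>i\<le>k. \<forall>j\<le>k. q (fst (z i)) = q (fst (z j))) \<and> (\<Sum>i\<le>k. snd (z i)) = 1}"

definition join_step ::
    "'x topology \<Rightarrow> ('x \<Rightarrow> 'y) \<Rightarrow> nat \<Rightarrow> (nat \<Rightarrow> 'x \<times> real) \<Rightarrow> (nat \<Rightarrow> 'x \<times> real) \<Rightarrow> bool"
  where "join_step X q k z w \<longleftrightarrow>
    z \<in> topspace (join_tuples X q k) \<and> w \<in> topspace (join_tuples X q k) \<and>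
    (\<exists>i\<le>k. snd (z i) = 0 \<and> snd (w i) = 0 \<and> (\<forall>j\<le>k. j \<noteq> i \<longrightarrow> z j = w j))"

definition join_class ::
    "'x topology \<Rightarrow> ('x \<Rightarrow> 'y) \<Rightarrow> nat \<Rightarrow> (nat \<Rightarrow> 'x \<times> real) \<Rightarrow> (nat \<Rightarrow> 'x \<times> real) set"
  where "join_class X q k z = {w. equivclp (join_step X q k) z w}"

definition fib_join :: "'x topology \<Rightarrow> ('x \<Rightarrow> 'y) \<Rightarrow> nat \<Rightarrow> (nat \<Rightarrow> 'x \<times> real) set topology"
  where "fib_join X q k = quotient_topology (join_tuples X q k) (join_class X q k)"

text \<open>
  The action and the projection are defined from representatives: the union below is over equal
  classes, and the image is a singleton.
\<close>

definition join_act ::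
    "'x topology \<Rightarrow> ('x \<Rightarrow> 'x) \<Rightarrow> ('x \<Rightarrow> 'y) \<Rightarrow> nat \<Rightarrow>
     (nat \<Rightarrow> 'x \<times> real) set \<Rightarrow> (nat \<Rightarrow> 'x \<times> real) set"
  where "join_act X a q k c =
    (\<Union>z\<in>c. join_class X q k (\<lambda>i\<in>{..k}. (a (fst (z i)), snd (z i))))"

definition join_proj :: "('x \<Rightarrow> 'y) \<Rightarrow> (nat \<Rightarrow> 'x \<times> real) set \<Rightarrow> 'y"
  where "join_proj q c = the_elem ((\<lambda>z. q (fst (z 0))) ` c)"

abbreviation endpoints_join_section ::
    "'e topology \<Rightarrow> ('e \<Rightarrow> 'b) \<Rightarrow> nat \<Rightarrow> ('e \<times> 'e \<Rightarrow> (nat \<Rightarrow> (real \<Rightarrow> 'e) \<times> real) set) \<Rightarrow> bool"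
  where "endpoints_join_section E p k \<sigma> \<equiv>
    Z2_section_on
      (fib_join (fib_paths E p) endpoints k) (join_act (fib_paths E p) rev_path endpoints k)
      (fib_square E p) prod.swap
      (join_proj endpoints) (topspace (fib_square E p)) \<sigma>"

definition barycentric_section ::
    "'e topology \<Rightarrow> ('e \<Rightarrow> 'b) \<Rightarrow> nat \<Rightarrow> 'e \<Rightarrow> (nat \<Rightarrow> (real \<Rightarrow> 'e) \<times> real) set"
  where "barycentric_section E p k e =
    join_class (fib_paths E p) endpoints k (\<lambda>i\<in>{..k}. (const_path e, 1 / real (k + 1)))"

end

theory Submission
  imports Defs
begin

text \<open>
  The base is locally equiconnected: it embeds isometrically in the space of bounded functions,
  and its image is closed in the union of the segments between its points, so a neighbourhood of
  the image there retracts onto it. Lifting the short paths so obtained slides a point of \<open>E\<close> to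
  a prescribed nearby fibre. Retracting the straight segment between two nearby points of one
  fibre from Euclidean space to \<open>E\<close> and sliding it back to that fibre gives a neighbourhood
  of the diagonal with an equivariant section that is constant on the diagonal.

  A section over the diagonal consists of paths \<open>\<gamma>\<close> with \<open>\<gamma> t = \<gamma> (1 - t)\<close>. Such a path
  contracts canonically by cutting out its middle part. Near the diagonal the cut is bridged
  by the local section above, so every section extends, after a modification near the diagonal, to
  one over a neighbourhood of the whole diagonal that is constant there. With this, the first four
  conditions are equivalent. A partition of unity turns sections over a cover into a section of the
  join, and the barycentric coordinates of the join recover a cover.
\<close>

section \<open>Path spaces\<close>

text \<open>Fibres, symmetry and the diagonal have to be controlled at the same time. Retracting a
  Euclidean segment to \<open>E\<close> respects the exchange of its ends but not the fibres;
  sliding repairs the fibres, and the target fibre is the same for both ends, so the symmetry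
  survives. The lift of a constant path need not be constant. Where an identity has to hold exactly,
  the lift is therefore read at time 0: the time is the distance in the base in
  \<open>fibration_slide\<close>, and the time already spent on the homotopy in
  \<open>motion_of_homotopy_section\<close>. The latter turns a section up to homotopy into a strict
  one; it stays equivariant because both components of a point of \<open>fib_square E p\<close> have
  the same image in \<open>B\<close>. A section can be altered near the diagonal only if its domain
  may shrink, so each cover is first refined by closed sets that the new domains still contain. All
  symmetry is gathered in \<open>sym_concat\<close>: its outer thirds mirror each other, and only
  the middle third has to be symmetric by itself.\<close>

lemma continuous_map_comp:
  assumes "continuous_map Y Z g" "continuous_map X Y f"
  shows "continuous_map X Z (\<lambda>x. g (f x))"
  using continuous_map_compose[OF assms(2,1)] by (simp add: o_def)

lemma continuous_map_snd_unit_interval: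
  "continuous_map (prod_topology Z unit_interval) euclideanreal snd"
  by (rule continuous_map_into_fulltopology[OF continuous_map_snd])

lemma continuous_map_prod_subtopology:
  assumes "continuous_map (prod_topology Z W) Y f"
  shows "continuous_map (prod_topology (subtopology Z U) W) Y f"
  using continuous_map_from_subtopology[OF assms] by (simp only: prod_topology_subtopology(1))

lemma continuous_map_prod_subtopology_mono:
  assumes "continuous_map (prod_topology (subtopology Z T) W) Y f" "U \<subseteq> T"
  shows "continuous_map (prod_topology (subtopology Z U) W) Y f"
  using continuous_map_prod_subtopology[OF assms(1), of U] assms(2)
  by (simp add: subtopology_subtopology Int_absorb1)

text \<open>Projection along a compact factor is a closed map, and the complement of the set in
  question is such a projection of a closed set. All neighbourhoods below that are cut out by a
  condition on a whole path come from here.\<close>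

lemma openin_tube:
  assumes F: "continuous_map (prod_topology Z W) Y F" and K: "compactin W K" and V: "openin Y V"
  shows "openin Z {z \<in> topspace Z. \<forall>t\<in>K. F (z, t) \<in> V}"
proof -
  have KW: "K \<subseteq> topspace W"
    using K compactin_subset_topspace by blast
  have cm: "closed_map (prod_topology Z (subtopology W K)) Z fst"
    using K by (intro closed_map_fst) (simp add: compact_space_subtopology)
  have F': "continuous_map (prod_topology Z (subtopology W K)) Y F"
    using F by (simp add: continuous_map_from_subtopology prod_topology_subtopology)
  have "closedin (prod_topology Z (subtopology W K))
      {x \<in> topspace (prod_topology Z (subtopology W K)). F x \<in> topspace Y - V}"
    using F' V by (intro closedin_continuous_map_preimage) auto
  then have "closedin Z (fst ` {x \<in> topspace (prod_topology Z (subtopology W K)). F x \<in> topspace Y - V})"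
    using cm unfolding closed_map_def by blast
  moreover have "fst ` {x \<in> topspace (prod_topology Z (subtopology W K)). F x \<in> topspace Y - V}
      = topspace Z - {z \<in> topspace Z. \<forall>t\<in>K. F (z, t) \<in> V}"
    using KW continuous_map_image_subset_topspace[OF F] by (force simp: image_iff)
  ultimately show ?thesis
    by (metis (no_types, lifting) closedin_def double_diff mem_Collect_eq order_refl subsetI)
qed

lemma openin_tube_unit_interval:
  assumes "continuous_map (prod_topology Z unit_interval) Y F" "openin Y V"
  shows "openin Z {z \<in> topspace Z. \<forall>t\<in>{0..1}. F (z, t) \<in> V}"
  by (rule openin_tube[OF assms(1) _ assms(2)]) (simp add: compactin_subtopology)

section \<open>The exponential law for the compact-open topology over the interval\<close>

lemma topspace_compact_open:
  "topspace (compact_open_topology X Y) = {f \<in> extensional (topspace X). continuous_map X Y f}"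
proof -
  \<comment> \<open>The subbasic set with \<open>K\<close> and \<open>V\<close> both empty is the
    whole function space.\<close>
  have "{f \<in> extensional (topspace X). continuous_map X Y f} \<in>
     {{f \<in> extensional (topspace X). continuous_map X Y f \<and> f ` K \<subseteq> V} | K V.
       compactin X K \<and> openin Y V}"
    by (rule CollectI, rule exI[of _ "{}"], rule exI[of _ "{}"]) auto
  then show ?thesis
    unfolding compact_open_topology_def topology_generated_by_topspace by blast
qed

text \<open>The preimage of a subbasic set is precisely a tube over \<open>K\<close>. This half of
  the exponential law holds for every \<open>X\<close>, since \<open>K\<close> itself is
  compact.\<close>

lemma continuous_map_curry_compact_open:
  assumes f: "continuous_map (prod_topology Z X) Y (\<lambda>(z, t). f z t)"
  shows "continuous_map Z (compact_open_topology X Y) (\<lambda>z. \<lambda>t\<in>topspace X. f z t)"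
proof -
  have cz: "continuous_map X Y (\<lambda>t\<in>topspace X. f z t)" if "z \<in> topspace Z" for z
  proof -
    have "continuous_map X Y (\<lambda>t. (\<lambda>(z, t). f z t) (z, t))"
      by (rule continuous_map_comp[OF f]) (use that in \<open>simp add: continuous_map_pairedI\<close>)
    then show ?thesis
      by (rule continuous_map_eq) auto
  qed
  show ?thesis
    unfolding compact_open_topology_def
  proof (rule continuous_on_generated_topo)
    fix U
    assume "U \<in> {{f \<in> extensional (topspace X). continuous_map X Y f \<and> f ` K \<subseteq> V} | K V.
       compactin X K \<and> openin Y V}"
    then obtain K V where U: "U = {f \<in> extensional (topspace X). continuous_map X Y f \<and> f ` K \<subseteq> V}"
      and K: "compactin X K" and V: "openin Y V" by blast
    have KX: "K \<subseteq> topspace X"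
      using K compactin_subset_topspace by blast
    have "(\<lambda>z. \<lambda>t\<in>topspace X. f z t) -` U \<inter> topspace Z
        = {z \<in> topspace Z. \<forall>t\<in>K. (\<lambda>(z, t). f z t) (z, t) \<in> V}"
      using cz KX by (auto simp: U)
    then show "openin Z ((\<lambda>z. \<lambda>t\<in>topspace X. f z t) -` U \<inter> topspace Z)"
      using openin_tube[OF f K V] by simp
  next
    show "(\<lambda>z. \<lambda>t\<in>topspace X. f z t) ` topspace Z \<subseteq> \<Union> {{f \<in> extensional (topspace X). continuous_map X Y f \<and> f ` K \<subseteq> V} | K V.
       compactin X K \<and> openin Y V}"
      using cz topspace_compact_open[of X Y, unfolded compact_open_topology_def topology_generated_by_topspace]
      by auto
  qed
qed

text \<open>Evaluation is continuous because the interval is locally compact: a compact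
  neighbourhood \<open>K\<close> of \<open>t\<close> that the path maps into \<open>V\<close> yields
  a subbasic neighbourhood of the path.\<close>

lemma continuous_map_eval_compact_open:
  "continuous_map (prod_topology (compact_open_topology unit_interval Y) unit_interval) Y (\<lambda>(\<gamma>, t). \<gamma> t)"
  (is "continuous_map (prod_topology ?C _) _ ?ev")
  unfolding continuous_map_def
proof (intro conjI allI impI)
  show "?ev \<in> topspace (prod_topology ?C unit_interval) \<rightarrow> topspace Y"
    by (auto simp: topspace_compact_open continuous_map_def)
  fix V assume V: "openin Y V"
  show "openin (prod_topology ?C unit_interval)
     {x \<in> topspace (prod_topology ?C unit_interval). ?ev x \<in> V}"
  proof (subst openin_prod_topology_alt, intro allI impI)
    fix \<gamma> :: "real \<Rightarrow> _" and t :: real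
    assume "(\<gamma>, t) \<in> {x \<in> topspace (prod_topology ?C unit_interval). ?ev x \<in> V}"
    then have g: "\<gamma> \<in> topspace ?C" "t \<in> {0..1}" "\<gamma> t \<in> V" by auto
    then have cg: "continuous_map unit_interval Y \<gamma>"
      by (auto simp: topspace_compact_open)
    then have "openin unit_interval {t \<in> {0..1}. \<gamma> t \<in> V}"
      using openin_continuous_map_preimage[OF cg V] by simp
    then obtain e where e: "e > 0" "\<And>u. u \<in> {0..1} \<Longrightarrow> dist u t < e \<Longrightarrow> \<gamma> u \<in> V"
      using g unfolding openin_euclidean_subtopology_iff by blast
    \<comment> \<open>With half the radius the closed ball still lies in the open ball of radius
      \<open>e\<close>, where \<gamma> stays in \<open>V\<close>.\<close>
    define K where "K = {0..1} \<inter> cball t (e / 2)"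
    have K: "compactin unit_interval K"
      by (auto simp: K_def compactin_subtopology compact_Int_closed)
    define N where "N = {f \<in> extensional (topspace unit_interval). continuous_map unit_interval Y f \<and> f ` K \<subseteq> V}"
    have N: "openin ?C N"
      unfolding N_def compact_open_topology_def
      by (rule topology_generated_by_Basis) (use K V in blast)
    moreover have "openin unit_interval ({0..1} \<inter> ball t (e / 2))"
      by (simp add: openin_open_Int)
    moreover have "\<gamma> \<in> N"
      using g e cg by (auto simp: N_def K_def topspace_compact_open dist_commute)
    moreover have "N \<times> ({0..1} \<inter> ball t (e / 2)) \<subseteq> {x \<in> topspace (prod_topology ?C unit_interval). ?ev x \<in> V}"
      using openin_subset[OF N] by (auto simp: N_def K_def)
    ultimately show "\<exists>U W. openin ?C U \<and> openin unit_interval W \<and> \<gamma> \<in> U \<and> t \<in> W \<and>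
       U \<times> W \<subseteq> {x \<in> topspace (prod_topology ?C unit_interval). ?ev x \<in> V}"
      using g e by (intro exI[of _ N] exI[of _ "{0..1} \<inter> ball t (e / 2)"]) auto
  qed
qed

lemma continuous_map_uncurry_compact_open:
  assumes "continuous_map Z (compact_open_topology unit_interval Y) s"
  shows "continuous_map (prod_topology Z unit_interval) Y (\<lambda>(z, t). s z t)"
proof -
  have "continuous_map (prod_topology Z unit_interval) Y (\<lambda>x. (\<lambda>(\<gamma>, t). \<gamma> t) (s (fst x), snd x))"
    by (intro continuous_map_comp[OF continuous_map_eval_compact_open] continuous_map_pairedI
        continuous_map_comp[OF assms] continuous_map_fst continuous_map_snd)
  then show ?thesis
    by (simp add: case_prod_unfold)
qed

section \<open>Lifting functions and local equiconnectedness\<close>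

lemma continuous_map_apply2:
  assumes "continuous_map (prod_topology Z W) Y (\<lambda>(z, t). f z t)"
    and "continuous_map X Z g" "continuous_map X W h"
  shows "continuous_map X Y (\<lambda>x. f (g x) (h x))"
  using continuous_map_comp[OF assms(1) continuous_map_pairedI[OF assms(2,3)]] by simp

lemma continuous_map_unit_interval_iff:
  "continuous_map X unit_interval f \<longleftrightarrow> continuous_map X euclideanreal f \<and> (\<forall>x\<in>topspace X. 0 \<le> f x \<and> f x \<le> 1)"
  by (auto simp: continuous_map_in_subtopology)

text \<open>A path-lifting function in the sense of Hurewicz, continuous jointly in starting point,
  path and time. Regularity, that is, constant lifts of constant paths, is not part of it.\<close>

definition lifting_function ::
    "'e topology \<Rightarrow> 'b topology \<Rightarrow> ('e \<Rightarrow> 'b) \<Rightarrow> ('e \<Rightarrow> (real \<Rightarrow> 'b) \<Rightarrow> real \<Rightarrow> 'e) \<Rightarrow> bool"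
  where "lifting_function E B p \<Gamma> \<longleftrightarrow>
    continuous_map
      (prod_topology (subtopology (prod_topology E (compact_open_topology unit_interval B)) {(e, \<beta>). \<beta> 0 = p e})
        unit_interval) E (\<lambda>((e, \<beta>), t). \<Gamma> e \<beta> t) \<and>
    (\<forall>e \<beta>. e \<in> topspace E \<and> \<beta> \<in> topspace (compact_open_topology unit_interval B) \<and> \<beta> 0 = p e \<longrightarrow>
       \<Gamma> e \<beta> 0 = e \<and> (\<forall>t\<in>{0..1}. p (\<Gamma> e \<beta> t) = \<beta> t))"

text \<open>Solves the universal lifting problem: the test space is the space of compatible pairs of
  a point and a path, the initial map is the first projection, and the homotopy is evaluation of the
  path.\<close>

lemma Hurewicz_fibration_lifting_function:
  assumes "Hurewicz_fibration E B p"
  obtains \<Gamma> where "lifting_function E B p \<Gamma>"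
proof -
  let ?X = "subtopology (prod_topology E (compact_open_topology unit_interval B)) {(e, \<beta>). \<beta> 0 = p e}"
  have HLP: "\<And>X f H. continuous_map (X :: ('a \<times> (real \<Rightarrow> 'b)) topology) E f \<Longrightarrow> continuous_map (prod_topology X unit_interval) B H \<Longrightarrow>
       (\<forall>x\<in>topspace X. H (x, 0) = p (f x)) \<Longrightarrow>
       (\<exists>H'. continuous_map (prod_topology X unit_interval) E H' \<and>
          (\<forall>x\<in>topspace X. H' (x, 0) = f x) \<and>
          (\<forall>x\<in>topspace X. \<forall>t\<in>{0..1}. p (H' (x, t)) = H (x, t)))"
    using assms unfolding Hurewicz_fibration_def by blast
  have 1: "continuous_map ?X E fst"
    by (intro continuous_map_from_subtopology continuous_map_fst)
  have "continuous_map ?X (compact_open_topology unit_interval B) snd"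
    by (intro continuous_map_from_subtopology continuous_map_snd)
  from continuous_map_uncurry_compact_open[OF this]
  have 2: "continuous_map (prod_topology ?X unit_interval) B (\<lambda>(z, t). snd z t)" .
  have "\<forall>x\<in>topspace ?X. (\<lambda>(z, t). snd z t) (x, 0) = p (fst x)"
    by auto
  then obtain H' where H': "continuous_map (prod_topology ?X unit_interval) E H'"
      "\<forall>x\<in>topspace ?X. H' (x, 0) = fst x"
      "\<forall>x\<in>topspace ?X. \<forall>t\<in>{0..1}. p (H' (x, t)) = (\<lambda>(z, t). snd z t) (x, t)"
    using HLP[OF 1 2] by blast
  have "lifting_function E B p (\<lambda>e \<beta> t. H' ((e, \<beta>), t))"
    unfolding lifting_function_def
  proof (intro conjI allI impI)
    show "continuous_map (prod_topology ?X unit_interval) E (\<lambda>((e, \<beta>), t). H' ((e, \<beta>), t))"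
      using H'(1) by (simp add: case_prod_unfold)
  qed (use H'(2,3) in auto)
  then show ?thesis using that by blast
qed

context
  fixes E :: "'e topology" and B :: "'b topology" and p :: "'e \<Rightarrow> 'b"
    and \<Gamma> :: "'e \<Rightarrow> (real \<Rightarrow> 'b) \<Rightarrow> real \<Rightarrow> 'e" and Z :: "'z topology" and f H
  assumes \<Gamma>: "lifting_function E B p \<Gamma>"
    and f: "continuous_map Z E f"
    and H: "continuous_map (prod_topology Z unit_interval) B (\<lambda>(z, t). H z t)"
    and H0: "\<And>z. z \<in> topspace Z \<Longrightarrow> H z 0 = p (f z)"
begin

text \<open>Pulling the universal solution back along the map from \<open>Z\<close> to pairs of a
  point and a path gives homotopy lifting for test spaces of every type, by a formula. The formula
  matters later, when equal input paths must have equal lifts.\<close>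

lemma lifting_function_continuous:
  "continuous_map (prod_topology Z unit_interval) E (\<lambda>(z, t). \<Gamma> (f z) (\<lambda>t\<in>{0..1}. H z t) t)"
proof -
  have "continuous_map Z (compact_open_topology unit_interval B) (\<lambda>z. \<lambda>t\<in>{0..1}. H z t)"
    using continuous_map_curry_compact_open[OF H] by simp
  then have "continuous_map Z (subtopology (prod_topology E (compact_open_topology unit_interval B)) {(e, \<beta>). \<beta> 0 = p e})
      (\<lambda>z. (f z, \<lambda>t\<in>{0..1}. H z t))"
    using H0 by (intro continuous_map_into_subtopology continuous_map_pairedI f) auto
  then have "continuous_map (prod_topology Z unit_interval)
     (prod_topology (subtopology (prod_topology E (compact_open_topology unit_interval B)) {(e, \<beta>). \<beta> 0 = p e}) unit_interval)
     (\<lambda>x. ((\<lambda>z. (f z, \<lambda>t\<in>{0..1}. H z t)) (fst x), snd x))"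
    by (intro continuous_map_pairedI continuous_map_snd continuous_map_comp[OF _ continuous_map_fst])
  from continuous_map_comp[OF conjunct1[OF \<Gamma>[unfolded lifting_function_def]] this]
  show ?thesis by (simp add: case_prod_unfold)
qed

lemma
  assumes z: "z \<in> topspace Z"
  shows lifting_function_start: "\<Gamma> (f z) (\<lambda>t\<in>{0..1}. H z t) 0 = f z"
    and lifting_function_lifts: "t \<in> {0..1} \<Longrightarrow> p (\<Gamma> (f z) (\<lambda>t\<in>{0..1}. H z t) t) = H z t"
proof -
  have "(\<lambda>t\<in>{0..1}. H z t) \<in> topspace (compact_open_topology unit_interval B)"
    using continuous_map_image_subset_topspace[OF continuous_map_curry_compact_open[OF H]] z by auto
  moreover have "f z \<in> topspace E"
    using f z by (auto simp: continuous_map_def)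
  ultimately show "\<Gamma> (f z) (\<lambda>t\<in>{0..1}. H z t) 0 = f z"
    "t \<in> {0..1} \<Longrightarrow> p (\<Gamma> (f z) (\<lambda>t\<in>{0..1}. H z t) t) = H z t"
    using \<Gamma> H0[OF z] by (auto simp: lifting_function_def)
qed

end

section \<open>Local equiconnectedness of a metrizable ANR\<close>

lemma metrizable_space_bounded_metric:
  assumes "metrizable_space X"
  obtains M d where "Metric_space M d" "X = Metric_space.mtopology M d" "\<And>x y. d x y \<le> (1::real)"
proof -
  obtain M d where Md: "Metric_space M d" "X = Metric_space.mtopology M d"
    using assms unfolding metrizable_space_def by blast
  interpret Metric_space M d by fact
  show ?thesis
    by (rule that[OF capped_dist[of 1]]) (simp_all add: mtopology_capped_metric Md(2), simp add: capped_dist_def)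
qed

lemma locally_equiconnected_if_metrizable_ANR:
  fixes B :: "'b topology"
  assumes "ANR_metrizable B"
  obtains U lam where "openin (prod_topology B B) U" "\<And>b. b \<in> topspace B \<Longrightarrow> (b, b) \<in> U"
    "continuous_map (prod_topology (subtopology (prod_topology B B) U) unit_interval) B (\<lambda>(z, t). lam z t)"
    "\<And>b c. (b, c) \<in> U \<Longrightarrow> lam (b, c) 0 = b" "\<And>b c. (b, c) \<in> U \<Longrightarrow> lam (b, c) 1 = c"
    "\<And>b t. b \<in> topspace B \<Longrightarrow> t \<in> {0..1} \<Longrightarrow> lam (b, b) t = b"
\<comment> \<open>The description of the supremum metric in \<open>dist_le\<close> is for functions
  on a nonempty set.\<close>
proof (cases "topspace B = {}")
  case True
  then show ?thesis
    using that[of "{}" "\<lambda>_ _. undefined"] by auto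
next
  case False
  have met: "metrizable_space B"
    using assms by (simp add: ANR_metrizable_def)
  \<comment> \<open>A metric bounded by 1 makes each function \<open>d b\<close> bounded, so that it
    lies in the function space as it stands. In \<open>fibration_slide\<close> the same bound lets a
    distance serve as a time in the unit interval.\<close>
  obtain M :: "'b set" and d where Md: "Metric_space M d" and BM: "B = Metric_space.mtopology M d"
    and d1: "\<And>x y. d x y \<le> (1::real)"
    using metrizable_space_bounded_metric[OF met] by metis
  interpret M: Metric_space M d by fact
  have Mne: "M \<noteq> {}" using False BM by auto
  interpret F: Metric_space "Met_TC.fspace M :: ('b \<Rightarrow> real) set" "Met_TC.fdist M"
    by (rule Met_TC.Metric_space_funspace)
  \<comment> \<open>The Kuratowski embedding sends \<open>b\<close> to the function
    \<open>d b\<close>; \<open>seg (b, c)\<close> is the straight segment between the images of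
    \<open>b\<close> and \<open>c\<close>.\<close>
  define seg where "seg = (\<lambda>(z :: 'b \<times> 'b) t. \<lambda>x\<in>M. (1 - t) * d (fst z) x + t * d (snd z) x)"
  have seg_in: "seg (b, c) t \<in> Met_TC.fspace M" if "b \<in> M" "c \<in> M" "t \<in> {0..1}" for b c t
  proof -
    have "(1 - t) * d b x + t * d c x \<le> 1" for x
    proof -
      have "(1 - t) * d b x + t * d c x \<le> (1 - t) * 1 + t * 1"
        using that d1 by (intro add_mono mult_left_mono) auto
      then show ?thesis by simp
    qed
    then have "seg (b, c) t ` M \<subseteq> {0..1}"
      using that by (auto simp: seg_def)
    then show ?thesis
      unfolding Met_TC.fspace_def by (auto simp: seg_def bounded_subset[OF bounded_closed_interval])
  qed
  define \<kappa> where "\<kappa> = (\<lambda>b. seg (b, b) 0)"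
  have seg_triv: "seg (b, b) t = \<kappa> b" "seg (b, c) 0 = \<kappa> b" "seg (b, c) 1 = \<kappa> c" for b c t
    by (auto simp: seg_def \<kappa>_def algebra_simps)
  have \<kappa>_in: "\<kappa> b \<in> Met_TC.fspace M" if "b \<in> M" for b
    using seg_in[of b b 0] that by (simp add: \<kappa>_def)
  have dist_le: "Met_TC.fdist M f g \<le> a \<longleftrightarrow> (\<forall>x\<in>M. \<bar>f x - g x\<bar> \<le> a)"
    if "f \<in> Met_TC.fspace M" "g \<in> Met_TC.fspace M" for f g :: "'b \<Rightarrow> real" and a
    using Met_TC.funspace_mdist_le[OF that Mne] by (simp add: dist_real_def)
  have tri: "\<bar>d b x - d b' x\<bar> \<le> d b b'" if "b \<in> M" "b' \<in> M" "x \<in> M" for b b' x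
    using M.triangle[of b b' x] M.triangle[of b' b x] M.commute[of b b'] that by auto
  have iso: "Met_TC.fdist M (\<kappa> b) (\<kappa> b') = d b b'" if "b \<in> M" "b' \<in> M" for b b'
  proof (rule antisym)
    show "Met_TC.fdist M (\<kappa> b) (\<kappa> b') \<le> d b b'"
      using tri that by (subst dist_le[OF \<kappa>_in \<kappa>_in]) (auto simp: \<kappa>_def seg_def)
    \<comment> \<open>Evaluation at \<open>b'\<close>, where \<open>d b' b' = 0\<close>, shows that
      the supremum reaches \<open>d b b'\<close>.\<close>
    have "\<forall>x\<in>M. \<bar>\<kappa> b x - \<kappa> b' x\<bar> \<le> Met_TC.fdist M (\<kappa> b) (\<kappa> b')"
      using dist_le[OF \<kappa>_in \<kappa>_in] that by blast
    then show "d b b' \<le> Met_TC.fdist M (\<kappa> b) (\<kappa> b')"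
      using that M.zero by (auto simp: \<kappa>_def seg_def dest!: bspec[where x=b'])
  qed
  have seg_cont: "continuous_map (prod_topology (prod_topology B B) unit_interval) F.mtopology (\<lambda>(z, t). seg z t)"
    unfolding F.continuous_map_to_metric
  proof (intro ballI allI impI)
    fix z and e :: real
    assume "z \<in> topspace (prod_topology (prod_topology B B) unit_interval)" "0 < e"
    then obtain b c t where z: "z = ((b, c), t)" and *: "0 \<le> t" "t \<le> 1" "0 < e" "b \<in> M" "c \<in> M"
      by (auto simp: BM)
    define U where "U = (M.mball b (e / 4) \<times> M.mball c (e / 4)) \<times> ({0..1} \<inter> ball t (e / 4))"
    have "seg (b', c') t' \<in> F.mball (seg (b, c) t) e"
      if "b' \<in> M.mball b (e/4)" "c' \<in> M.mball c (e/4)" "t' \<in> {0..1}" "\<bar>t - t'\<bar> < e/4" for b' c' t'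
    proof -
      have M': "b' \<in> M" "c' \<in> M" using that by auto
      have "\<bar>((1 - t) * d b x + t * d c x) - ((1 - t') * d b' x + t' * d c' x)\<bar> \<le> 3 * (e / 4)" if x: "x \<in> M" for x
      proof -
        \<comment> \<open>The change is split into moving the two ends and moving the time. Each
          part is at most \<open>e / 4\<close>, so the sum stays strictly below
          \<open>e\<close>.\<close>
        have e1: "((1 - t) * d b x + t * d c x) - ((1 - t') * d b' x + t' * d c' x)
          = (1 - t) * (d b x - d b' x) + t * (d c x - d c' x) + (t - t') * (d c' x - d b' x)"
          by (simp add: algebra_simps)
        have "\<bar>(1 - t) * (d b x - d b' x)\<bar> \<le> 1 * (e / 4)"
          unfolding abs_mult using * tri[of b b' x] M' x \<open>b' \<in> M.mball b (e/4)\<close> by (intro mult_mono) auto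
        moreover have "\<bar>t * (d c x - d c' x)\<bar> \<le> 1 * (e / 4)"
          unfolding abs_mult using * tri[of c c' x] M' x \<open>c' \<in> M.mball c (e/4)\<close> by (intro mult_mono) auto
        moreover have "\<bar>(t - t') * (d c' x - d b' x)\<bar> \<le> (e / 4) * 1"
          unfolding abs_mult using * \<open>\<bar>t - t'\<bar> < e/4\<close> d1[of c' x] d1[of b' x] M.nonneg[of c' x] M.nonneg[of b' x]
          by (intro mult_mono) (auto simp del: M.nonneg)
        ultimately show ?thesis unfolding e1 by linarith
      qed
      then have "Met_TC.fdist M (seg (b, c) t) (seg (b', c') t') \<le> 3 * (e / 4)"
        using * M' that by (subst dist_le[OF seg_in seg_in]) (auto simp: seg_def)
      then show ?thesis
        using * M' that seg_in by (simp add: F.in_mball)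
    qed
    then have "\<forall>y\<in>U. (\<lambda>(z, t). seg z t) y \<in> F.mball (seg (b, c) t) e"
      by (auto simp: U_def dist_real_def)
    moreover have "openin (prod_topology (prod_topology B B) unit_interval) U"
      unfolding U_def by (simp add: openin_prod_Times_iff openin_open_Int BM)
    moreover have "z \<in> U" using * by (auto simp: U_def z)
    ultimately show "\<exists>U. openin (prod_topology (prod_topology B B) unit_interval) U \<and>
        z \<in> U \<and> (\<forall>y\<in>U. (\<lambda>(z, t). seg z t) y \<in> F.mball ((\<lambda>(z, t). seg z t) z) e)"
      by (auto simp: z)
  qed
  \<comment> \<open>\<open>Y\<close> contains just the segments rather than a convex set. They are
    all that a local equiconnection has to retract, and for a point on a single segment the distance
    to the image of \<open>B\<close> is easily bounded from below.\<close>
  define C where "C = (\<lambda>(z, t). seg z t) ` ((M \<times> M) \<times> {0..1})"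
  define Y where "Y = subtopology F.mtopology C"
  have C_in: "C \<subseteq> Met_TC.fspace M" using seg_in by (auto simp: C_def)
  have metY: "metrizable_space Y"
    unfolding Y_def by (simp add: metrizable_space_subtopology F.metrizable_space_mtopology)
  have \<kappa>C: "\<kappa> b \<in> C" if "b \<in> M" for b
    using that by (force simp: C_def \<kappa>_def)
  have seg_contY: "continuous_map (prod_topology (prod_topology B B) unit_interval) Y (\<lambda>(z, t). seg z t)"
    unfolding Y_def by (intro continuous_map_into_subtopology seg_cont) (auto simp: C_def BM)
  have "embedding_map B F.mtopology \<kappa>"
    unfolding BM
    by (rule Metric_space12.isometry_imp_embedding_map)
      (auto simp: iso \<kappa>_in Metric_space12_def Md F.Metric_space_axioms)
  then have emb: "embedding_map B Y \<kappa>"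
    unfolding Y_def embedding_map_in_subtopology using \<kappa>C BM by auto
  have clo: "closedin Y (\<kappa> ` topspace B)"
  proof -
    have "openin Y (C - \<kappa> ` M)"
    proof (subst openin_subopen, intro ballI)
      fix y assume y: "y \<in> C - \<kappa> ` M"
      then obtain b c t where bct: "y = seg (b, c) t" "b \<in> M" "c \<in> M" "t \<in> {0..1}"
        by (auto simp: C_def)
      then have ne: "b \<noteq> c" "t \<noteq> 0" "t \<noteq> 1"
        using y seg_triv by blast+
      \<comment> \<open>The image of \<open>z\<close> under \<kappa> vanishes at \<open>z\<close>,
        while \<open>y z = (1 - t) * d b z + t * d c z\<close> is at least
        \<open>min t (1 - t) * d b c\<close> by the triangle inequality. Hence no point of the image
        is closer to \<open>y\<close> than \<open>r\<close>.\<close>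
      define r where "r = min t (1 - t) * d b c"
      have r: "r > 0" using ne bct by (auto simp: r_def)
      have "F.mball y r \<inter> \<kappa> ` M = {}"
      proof (rule ccontr)
        assume "F.mball y r \<inter> \<kappa> ` M \<noteq> {}"
        then obtain z where z: "z \<in> M" "Met_TC.fdist M y (\<kappa> z) < r" by auto
        have "\<bar>y z - \<kappa> z z\<bar> \<le> Met_TC.fdist M y (\<kappa> z)"
          using dist_le[of y "\<kappa> z"] y C_in \<kappa>_in z by blast
        then have "(1 - t) * d b z + t * d c z < r"
          using z by (auto simp: bct \<kappa>_def seg_def)
        moreover have "min t (1 - t) * d b z + min t (1 - t) * d c z \<le> (1 - t) * d b z + t * d c z"
          by (intro add_mono mult_right_mono) auto
        moreover have "min t (1 - t) * d b c \<le> min t (1 - t) * (d b z + d c z)"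
          using bct z M.triangle[of b z c] M.commute[of z c] by (intro mult_left_mono) auto
        ultimately show False by (simp add: r_def algebra_simps)
      qed
      then show "\<exists>T. openin Y T \<and> y \<in> T \<and> T \<subseteq> C - \<kappa> ` M"
        using r y C_in unfolding Y_def
        by (intro exI[of _ "C \<inter> F.mball y r"]) (auto intro!: openin_subtopology_Int2)
    qed
    moreover have "topspace Y = C" using C_in by (auto simp: Y_def)
    ultimately show ?thesis
      using \<kappa>C by (auto simp: closedin_def BM)
  qed
  obtain W where W: "openin Y W" "\<kappa> ` topspace B \<subseteq> W" "(\<kappa> ` topspace B) retract_of_space (subtopology Y W)"
    using assms metY emb clo unfolding ANR_metrizable_def by blast
  obtain r where r: "continuous_map (subtopology Y W) (subtopology Y (\<kappa> ` topspace B)) r"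
     "\<And>x. x \<in> \<kappa> ` topspace B \<Longrightarrow> r x = x"
    using W(2,3) unfolding retract_of_space_def
    by (metis subtopology_subtopology inf.absorb_iff2)
  obtain \<iota> where "homeomorphic_maps B (subtopology Y (\<kappa> ` topspace B)) \<kappa> \<iota>"
    using emb unfolding embedding_map_def homeomorphic_map_maps by blast
  then have i: "continuous_map (subtopology Y (\<kappa> ` topspace B)) B \<iota>" "\<And>b. b \<in> topspace B \<Longrightarrow> \<iota> (\<kappa> b) = b"
    by (auto simp: homeomorphic_maps_def)
  define U where "U = {z \<in> topspace (prod_topology B B). \<forall>t\<in>{0..1}. (\<lambda>(z, t). seg z t) (z, t) \<in> W}"
  show ?thesis
  proof (rule that[of U "\<lambda>z t. \<iota> (r (seg z t))"])
    show U: "openin (prod_topology B B) U"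
      unfolding U_def by (rule openin_tube_unit_interval[OF seg_contY W(1)])
    show "(b, b) \<in> U" if "b \<in> topspace B" for b
      using that W(2) by (auto simp: U_def seg_triv)
    have "continuous_map (prod_topology (subtopology (prod_topology B B) U) unit_interval) (subtopology Y W) (\<lambda>(z, t). seg z t)"
      by (intro continuous_map_into_subtopology)
        (use continuous_map_prod_subtopology[OF seg_contY] in \<open>auto simp: U_def\<close>)
    from continuous_map_comp[OF i(1) continuous_map_comp[OF r(1) this]]
    show "continuous_map (prod_topology (subtopology (prod_topology B B) U) unit_interval) B (\<lambda>(z, t). \<iota> (r (seg z t)))"
      by (simp add: case_prod_unfold)
  qed (auto simp: seg_triv r(2) i(2) U_def)
qed

text \<open>The path of \<open>z\<close> is run so fast that it ends at time
  \<open>\<delta> z\<close>; where \<open>\<delta> z = 0\<close>, division yields 0 and the value is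
  \<open>lam z 0\<close>. The quotient is badly behaved near such points, but there the path is
  constant, so nearby paths stay in \<open>V\<close> as a whole and the parameter does not matter.
  The preimage of \<open>V\<close> is thus the union of an open set over \<open>P\<close>, where
  \<delta> is positive, and the product of the tube base \<open>N\<close> with the interval.\<close>

lemma continuous_map_rescaled_homotopy:
  assumes lam: "continuous_map (prod_topology Z unit_interval) Y (\<lambda>(z, t). lam z t)"
    and \<delta>: "continuous_map Z euclideanreal \<delta>" "\<And>z. z \<in> topspace Z \<Longrightarrow> 0 \<le> \<delta> z"
    and const: "\<And>z t. z \<in> topspace Z \<Longrightarrow> \<delta> z = 0 \<Longrightarrow> t \<in> {0..1} \<Longrightarrow> lam z t = lam z 0"
  shows "continuous_map (prod_topology Z unit_interval) Y (\<lambda>(z, t). lam z (min 1 (t / \<delta> z)))"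
    (is "continuous_map ?ZI Y ?g")
  unfolding continuous_map_def
proof (intro conjI allI impI)
  have unit: "min 1 (t / \<delta> z) \<in> {0..1}" if "z \<in> topspace Z" "0 \<le> t" for z t
    using that \<delta>(2) by auto
  show "?g \<in> topspace ?ZI \<rightarrow> topspace Y"
    using continuous_map_image_subset_topspace[OF lam] unit by (auto simp: image_subset_iff)
  fix V assume V: "openin Y V"
  define P where "P = {z \<in> topspace Z. \<delta> z \<in> {0<..}}"
  define N where "N = {z \<in> topspace Z. \<forall>t\<in>{0..1}. (\<lambda>(z, t). lam z t) (z, t) \<in> V}"
  have P: "openin Z P"
    unfolding P_def by (intro openin_continuous_map_preimage[OF \<delta>(1)]) simp
  have N: "openin Z N"
    unfolding N_def by (rule openin_tube_unit_interval[OF lam V])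
  have "continuous_map (prod_topology (subtopology Z P) unit_interval) Y ?g"
  proof -
    have "continuous_map (prod_topology (subtopology Z P) unit_interval) Y
        (\<lambda>x. lam (fst x) (min 1 (snd x / \<delta> (fst x))))"
    proof (intro continuous_map_apply2[OF lam])
      show 1: "continuous_map (prod_topology (subtopology Z P) unit_interval) Z fst"
        by (intro continuous_map_prod_subtopology continuous_map_fst)
      have "continuous_map (prod_topology (subtopology Z P) unit_interval) euclideanreal (\<lambda>x. snd x / \<delta> (fst x))"
      proof (rule continuous_map_real_divide[OF continuous_map_snd_unit_interval continuous_map_comp[OF \<delta>(1) 1]])
        fix x assume "x \<in> topspace (prod_topology (subtopology Z P) unit_interval)"
        then have "fst x \<in> P" by (simp add: mem_Times_iff)
        then show "\<delta> (fst x) \<noteq> 0" by (simp add: P_def)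
      qed
      then have "continuous_map (prod_topology (subtopology Z P) unit_interval) euclideanreal (\<lambda>x. min 1 (snd x / \<delta> (fst x)))"
        by (intro continuous_map_real_min) auto
      moreover have "\<forall>x\<in>topspace (prod_topology (subtopology Z P) unit_interval).
          0 \<le> min 1 (snd x / \<delta> (fst x)) \<and> min 1 (snd x / \<delta> (fst x)) \<le> 1"
        using \<delta>(2) by auto
      ultimately show "continuous_map (prod_topology (subtopology Z P) unit_interval) unit_interval
          (\<lambda>x. min 1 (snd x / \<delta> (fst x)))"
        unfolding continuous_map_unit_interval_iff by blast
    qed
    then show ?thesis by (simp add: case_prod_unfold)
  qed
  then have "openin (prod_topology (subtopology Z P) unit_interval)
      {x \<in> topspace (prod_topology (subtopology Z P) unit_interval). ?g x \<in> V}"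
    using V by (rule openin_continuous_map_preimage)
  then have "openin (subtopology ?ZI (P \<times> topspace unit_interval)) {x \<in> topspace (prod_topology (subtopology Z P) unit_interval). ?g x \<in> V}"
    by (rule back_subst[OF _ prod_topology_subtopology(1), where P="\<lambda>X. openin X A" for A])
  moreover have "openin ?ZI (P \<times> topspace unit_interval)"
    using P by (simp add: openin_prod_Times_iff)
  ultimately have "openin ?ZI {x \<in> topspace (prod_topology (subtopology Z P) unit_interval). ?g x \<in> V}"
    by (rule openin_trans_full)
  moreover have "openin ?ZI (N \<times> {0..1})"
    using N by (simp add: openin_prod_Times_iff)
  moreover have "{x \<in> topspace ?ZI. ?g x \<in> V}
     = {x \<in> topspace (prod_topology (subtopology Z P) unit_interval). ?g x \<in> V} \<union> N \<times> {0..1}" (is "?L = ?R")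
  proof (intro equalityI subsetI)
    fix x assume x: "x \<in> ?L"
    then obtain z t where zt: "x = (z, t)" "z \<in> topspace Z" "t \<in> {0..1}" by auto
    show "x \<in> ?R"
    proof (cases "\<delta> z = 0")
      case True
      have "lam z u \<in> V" if "u \<in> {0..1}" for u
        using x zt const[OF zt(2) True that] True by simp
      then have "z \<in> N"
        using zt by (simp add: N_def)
      then show ?thesis using zt by simp
    next
      case False
      then show ?thesis using x zt \<delta>(2)[of z] by (auto simp: P_def)
    qed
  next
    fix x assume "x \<in> ?R"
    then show "x \<in> ?L" using unit by (auto simp: P_def N_def)
  qed
  ultimately show "openin ?ZI {x \<in> topspace ?ZI. ?g x \<in> V}"
    by (simp only: openin_Un)
qed

text \<open>The device behind regular lifting functions over a metric base: the path from
  \<open>p e\<close> to \<open>b\<close> arrives at time \<open>d (p e) b\<close>, and its lift is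
  read at that time. For \<open>b = p e\<close> this is time 0, which gives
  \<open>T e (p e) = e\<close> although the lift of a constant path may move.\<close>

lemma fibration_slide:
  fixes E :: "'e topology" and B :: "'b topology"
  assumes fib: "Hurewicz_fibration E B p" and B: "ANR_metrizable B"
  obtains U T where "openin (prod_topology B B) U" "\<And>b. b \<in> topspace B \<Longrightarrow> (b, b) \<in> U"
    "continuous_map (subtopology (prod_topology E B) {(e, b). (p e, b) \<in> U}) E (\<lambda>(e, b). T e b)"
    "\<And>e b. e \<in> topspace E \<Longrightarrow> (p e, b) \<in> U \<Longrightarrow> p (T e b) = b"
    "\<And>e. e \<in> topspace E \<Longrightarrow> T e (p e) = e"
proof -
  have p: "continuous_map E B p"
    using fib by (simp add: Hurewicz_fibration_def)
  obtain \<Gamma> where \<Gamma>: "lifting_function E B p \<Gamma>"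
    using Hurewicz_fibration_lifting_function[OF fib] .
  obtain U lam where U: "openin (prod_topology B B) U" "\<And>b. b \<in> topspace B \<Longrightarrow> (b, b) \<in> U"
    and lam: "continuous_map (prod_topology (subtopology (prod_topology B B) U) unit_interval) B (\<lambda>(z, t). lam z t)"
    and lam0: "\<And>b c. (b, c) \<in> U \<Longrightarrow> lam (b, c) 0 = b" and lam1: "\<And>b c. (b, c) \<in> U \<Longrightarrow> lam (b, c) 1 = c"
    and lamd: "\<And>b t. b \<in> topspace B \<Longrightarrow> t \<in> {0..1} \<Longrightarrow> lam (b, b) t = b"
    using locally_equiconnected_if_metrizable_ANR[OF B] by metis
  have met: "metrizable_space B"
    using B by (simp add: ANR_metrizable_def)
  obtain M :: "'b set" and d where Md: "Metric_space M d" and BM: "B = Metric_space.mtopology M d"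
    and d1: "\<And>x y. d x y \<le> (1::real)"
    using metrizable_space_bounded_metric[OF met] by metis
  interpret M: Metric_space M d by fact
  define Z where "Z = subtopology (prod_topology E B) {(e, b). (p e, b) \<in> U}"
  have pZ: "continuous_map Z (subtopology (prod_topology B B) U) (\<lambda>z. (p (fst z), snd z))"
    unfolding Z_def
    by (intro continuous_map_into_subtopology continuous_map_pairedI continuous_map_comp[OF p]
        continuous_map_from_subtopology continuous_map_fst continuous_map_snd) auto
  then have d: "continuous_map Z euclideanreal (\<lambda>z. d (p (fst z)) (snd z))"
    using continuous_map_mdist[where m="metric (M, d)"]
    unfolding M.mtopology_of M.mdist_metric BM[symmetric]
    by (auto simp: continuous_map_in_subtopology continuous_map_paired)
  \<comment> \<open>The path reaches \<open>b\<close> at time \<open>d (p e) b\<close> and then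
    waits there.\<close>
  define H where "H = (\<lambda>z t. lam (p (fst z), snd z) (min 1 (t / d (p (fst z)) (snd z))))"
  have Ztop: "(e, b) \<in> topspace Z \<longleftrightarrow> e \<in> topspace E \<and> b \<in> topspace B \<and> (p e, b) \<in> U" for e b
    by (auto simp: Z_def)
  have pe: "p e \<in> topspace B" if "e \<in> topspace E" for e
    using p that by (auto simp: continuous_map_def)
  have "continuous_map (prod_topology Z unit_interval) B (\<lambda>(z, t). lam (p (fst z), snd z) t)"
    using continuous_map_apply2[OF lam continuous_map_comp[OF pZ continuous_map_fst] continuous_map_snd]
    by (simp add: case_prod_unfold)
  then have H: "continuous_map (prod_topology Z unit_interval) B (\<lambda>(z, t). H z t)"
    unfolding H_def
  proof (rule continuous_map_rescaled_homotopy[OF _ d])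
    fix z t assume z: "z \<in> topspace Z" "d (p (fst z)) (snd z) = 0" "t \<in> {0..1::real}"
    then have "p (fst z) \<in> M" "snd z \<in> M" using Ztop[of "fst z" "snd z"] pe BM by auto
    then have "p (fst z) = snd z" "snd z \<in> topspace B" using z by (auto simp: BM)
    then show "lam (p (fst z), snd z) t = lam (p (fst z), snd z) 0"
      using lamd z by auto
  qed auto
  have fstZ: "continuous_map Z E fst"
    unfolding Z_def by (intro continuous_map_from_subtopology continuous_map_fst)
  have H0: "H z 0 = p (fst z)" if "z \<in> topspace Z" for z
    using that Ztop[of "fst z" "snd z"] lam0 by (simp add: H_def)
  note L = lifting_function_continuous[OF \<Gamma> fstZ H H0]
    lifting_function_start[OF \<Gamma> fstZ H H0] lifting_function_lifts[OF \<Gamma> fstZ H H0]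
  define T where "T = (\<lambda>e b. \<Gamma> e (\<lambda>t\<in>{0..1}. H (e, b) t) (d (p e) b))"
  show ?thesis
  proof (rule that[OF U])
    have "continuous_map Z E (\<lambda>z. \<Gamma> (fst z) (\<lambda>t\<in>{0..1}. H z t) (d (p (fst z)) (snd z)))"
    proof (rule continuous_map_apply2[OF L(1)])
      show "continuous_map Z Z (\<lambda>z. z)"
        using continuous_map_id[of Z] by (simp add: id_def)
      show "continuous_map Z unit_interval (\<lambda>z. d (p (fst z)) (snd z))"
        unfolding continuous_map_unit_interval_iff using d d1 by simp
    qed
    then show "continuous_map (subtopology (prod_topology E B) {(e, b). (p e, b) \<in> U}) E (\<lambda>(e, b). T e b)"
      unfolding T_def Z_def by (simp add: case_prod_unfold)
    show "p (T e b) = b" if eb: "e \<in> topspace E" "(p e, b) \<in> U" for e b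
    proof -
      have b: "b \<in> topspace B" using eb openin_subset[OF U(1)] by auto
      have "p (T e b) = H (e, b) (d (p e) b)"
        using L(3)[of "(e, b)" "d (p e) b"] Ztop[of e b] eb b d1 by (simp add: T_def)
      also have "\<dots> = b"
      proof (cases "d (p e) b = 0")
        case True
        then have "p e = b" using pe[OF eb(1)] b BM by auto
        then show ?thesis using eb lam0 True by (simp add: H_def)
      qed (use lam1 eb in \<open>simp add: H_def\<close>)
      finally show ?thesis .
    qed
    show "T e (p e) = e" if "e \<in> topspace E" for e
    proof -
      have "d (p e) (p e) = 0" using pe[OF that] BM by auto
      then show ?thesis
        using L(2)[of "(e, p e)"] Ztop pe that U(2) by (simp add: T_def)
    qed
  qed
qed

section \<open>Equivariant motions\<close>

text \<open>An uncurried equivariant section over \<open>U\<close> of the endpoint map.\<close>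

definition motion :: "'e topology \<Rightarrow> ('e \<Rightarrow> 'b) \<Rightarrow> ('e \<times> 'e) set \<Rightarrow> ('e \<times> 'e \<Rightarrow> real \<Rightarrow> 'e) \<Rightarrow> bool"
  where "motion E p U m \<longleftrightarrow>
    continuous_map (prod_topology (subtopology (fib_square E p) U) unit_interval) E (\<lambda>(x, t). m x t) \<and>
    (\<forall>x\<in>topspace (fib_square E p) \<inter> U. m x 0 = fst x \<and> m x 1 = snd x \<and>
      (\<forall>t\<in>{0..1}. p (m x t) = p (fst x) \<and> m (prod.swap x) t = m x (1 - t)))"

section \<open>A symmetric motion near the diagonal\<close>

lemma topspace_fib_square:
  "topspace (fib_square E p) = {(e, e'). e \<in> topspace E \<and> e' \<in> topspace E \<and> p e = p e'}"
  by (auto simp: fib_square_def)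

lemma continuous_map_fst_fib_square: "continuous_map (fib_square E p) E fst"
  and continuous_map_snd_fib_square: "continuous_map (fib_square E p) E snd"
  unfolding fib_square_def
  by (intro continuous_map_from_subtopology continuous_map_fst continuous_map_snd)+

lemma continuous_map_swap_fib_square: "continuous_map (fib_square E p) (fib_square E p) prod.swap"
proof -
  have "continuous_map (fib_square E p) (prod_topology E E) (\<lambda>x. (snd x, fst x))"
    by (intro continuous_map_pairedI continuous_map_fst_fib_square continuous_map_snd_fib_square)
  then have "continuous_map (fib_square E p) (subtopology (prod_topology E E) {(e1, e2). p e1 = p e2}) (\<lambda>x. (snd x, fst x))"
    by (rule continuous_map_into_subtopology) (auto simp: topspace_fib_square)
  then show ?thesis
    by (simp add: fib_square_def[symmetric] prod.swap_def[abs_def])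
qed

text \<open>Exchanging the ends of a Euclidean segment reverses its time, and the retraction
  \<open>r\<close> is applied pointwise, so \<open>f\<close> inherits this symmetry. The slide aims
  at \<open>p (fst x) = p (snd x)\<close>, the same point for \<open>x\<close> and for the swapped
  pair. It fixes the ends and everything over the diagonal, because these already lie in the target
  fibre.\<close>

lemma symmetric_equiconnection_fib_square:
  fixes E :: "'e topology" and B :: "'b topology" and S :: "'n::euclidean_space set"
  assumes fib: "Hurewicz_fibration E B p" and B: "ANR_metrizable B"
    and S: "ENR S" "E homeomorphic_space top_of_set S"
  obtains N lam where "openin (fib_square E p) N" "diag E \<subseteq> N" "prod.swap ` N \<subseteq> N"
    "motion E p N lam" "\<And>e t. e \<in> topspace E \<Longrightarrow> t \<in> {0..1} \<Longrightarrow> lam (e, e) t = e"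
proof -
  have p: "continuous_map E B p"
    using fib by (simp add: Hurewicz_fibration_def)
  obtain U T where U: "openin (prod_topology B B) U" "\<And>b. b \<in> topspace B \<Longrightarrow> (b, b) \<in> U"
    and T: "continuous_map (subtopology (prod_topology E B) {(e, b). (p e, b) \<in> U}) E (\<lambda>(e, b). T e b)"
      "\<And>e b. e \<in> topspace E \<Longrightarrow> (p e, b) \<in> U \<Longrightarrow> p (T e b) = b"
      "\<And>e. e \<in> topspace E \<Longrightarrow> T e (p e) = e"
    by (rule fibration_slide[OF fib B], rule that)
  obtain W r where W: "open W" "S \<subseteq> W" and r: "continuous_on W r" "\<And>x. x \<in> W \<Longrightarrow> r x \<in> S" "\<And>x. x \<in> S \<Longrightarrow> r x = x"
    using S(1) unfolding ENR_def retract_of_def retraction_def by (auto simp: Pi_iff)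
  obtain h g where hg: "homeomorphic_maps E (top_of_set S) h g"
    using S(2) unfolding homeomorphic_space_def by blast
  then have h: "continuous_map E euclidean h" "\<And>e. e \<in> topspace E \<Longrightarrow> h e \<in> S"
    and g: "continuous_map (top_of_set S) E g" "\<And>e. e \<in> topspace E \<Longrightarrow> g (h e) = e"
    by (auto simp: homeomorphic_maps_def continuous_map_in_subtopology)
  let ?X = "fib_square E p"
  define s where "s = (\<lambda>(x :: 'e \<times> 'e) t. (1 - t) *\<^sub>R h (fst x) + t *\<^sub>R h (snd x))"
  have sc: "continuous_map (prod_topology ?X unit_interval) euclidean (\<lambda>(x, t). s x t)"
  proof -
    have "continuous_map (prod_topology ?X unit_interval) euclidean (\<lambda>x. h (fst (fst x)))"
      "continuous_map (prod_topology ?X unit_interval) euclidean (\<lambda>x. h (snd (fst x)))"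
      by (rule continuous_map_comp[OF h(1)],
          rule continuous_map_comp[OF continuous_map_fst_fib_square[of E p]]
            continuous_map_comp[OF continuous_map_snd_fib_square[of E p]],
          rule continuous_map_fst)+
    note c = continuous_map_pairedI[OF continuous_map_snd_unit_interval continuous_map_pairedI[OF this]]
    have "continuous_map euclidean euclidean (\<lambda>(t :: real, x :: 'n, y). (1 - t) *\<^sub>R x + t *\<^sub>R y)"
      by (simp add: case_prod_unfold continuous_intros)
    then have "continuous_map (prod_topology euclidean (prod_topology euclidean euclidean)) euclidean (\<lambda>(t :: real, x :: 'n, y). (1 - t) *\<^sub>R x + t *\<^sub>R y)"
      by simp
    from continuous_map_comp[OF this c] show ?thesis
      by (simp add: s_def case_prod_unfold)
  qed
  define N1 where "N1 = {x \<in> topspace ?X. \<forall>t\<in>{0..1}. (\<lambda>(x, t). s x t) (x, t) \<in> W}"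
  have N1: "openin ?X N1"
    unfolding N1_def by (rule openin_tube_unit_interval[OF sc]) (simp add: W)
  let ?X1 = "subtopology ?X N1"
  define f where "f = (\<lambda>x t. g (r (s x t)))"
  have fc: "continuous_map (prod_topology ?X1 unit_interval) E (\<lambda>(x, t). f x t)"
  proof -
    have 1: "continuous_map (prod_topology ?X1 unit_interval) (top_of_set W) (\<lambda>(x, t). s x t)"
      by (intro continuous_map_into_subtopology continuous_map_prod_subtopology[OF sc]) (auto simp: N1_def)
    have 2: "continuous_map (top_of_set W) (top_of_set S) r"
      using r by auto
    show ?thesis
      using continuous_map_comp[OF g(1) continuous_map_comp[OF 2 1]] by (simp add: f_def case_prod_unfold)
  qed
  have bc: "continuous_map (prod_topology ?X1 unit_interval) B (\<lambda>x. p (fst (fst x)))"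
    by (intro continuous_map_comp[OF p] continuous_map_comp[OF continuous_map_fst_fib_square[of E p]]
        continuous_map_prod_subtopology continuous_map_fst)
  have pfc: "continuous_map (prod_topology ?X1 unit_interval) (prod_topology B B) (\<lambda>(x, t). (p (f x t), p (fst x)))"
    using continuous_map_pairedI[OF continuous_map_comp[OF p fc] bc] by (simp add: case_prod_unfold)
  \<comment> \<open>Here the retracted segment strays so little in the base that each of its points
    can be slid back to the fibre of \<open>x\<close>.\<close>
  define N where "N = {x \<in> topspace ?X1. \<forall>t\<in>{0..1}. (\<lambda>(x, t). (p (f x t), p (fst x))) (x, t) \<in> U}"
  have "openin ?X1 N"
    unfolding N_def by (rule openin_tube_unit_interval[OF pfc U(1)])
  then have N: "openin ?X N"
    using N1 openin_trans_full by blast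
  have Nsub: "N \<subseteq> N1" "N \<subseteq> topspace ?X" by (auto simp: N_def)
  have fE: "f x t \<in> topspace E" if "x \<in> N1" "t \<in> {0..1}" for x t
    using continuous_map_image_subset_topspace[OF fc] that by (force simp: N1_def)
  have s_swap: "s (prod.swap x) t = s x (1 - t)" for x t
    by (simp add: s_def)
  have s_diag: "s (e, e) t = h e" for e t
    by (simp add: s_def scaleR_left_diff_distrib)
  have f_diag: "f (e, e) t = e" if "e \<in> topspace E" for e t
    using that h r g by (simp add: f_def s_diag)
  define lam where "lam = (\<lambda>x t. T (f x t) (p (fst x)))"
  have x_top: "fst x \<in> topspace E \<and> snd x \<in> topspace E \<and> p (fst x) = p (snd x)" if "x \<in> topspace ?X" for x
    using that by (auto simp: topspace_fib_square)
  have pe: "p e \<in> topspace B" if "e \<in> topspace E" for e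
    using p that by (auto simp: continuous_map_def)
  show ?thesis
  proof (rule that[of N lam])
    show "openin ?X N" by (rule N)
    show "diag E \<subseteq> N"
      using f_diag U(2) pe h(2) W(2) by (auto simp: diag_def N_def N1_def topspace_fib_square s_diag)
    show "prod.swap ` N \<subseteq> N"
    proof (intro image_subsetI)
      fix x assume x: "x \<in> N"
      have t: "1 - t \<in> {0..1}" if "t \<in> {0..1}" for t :: real using that by auto
      from x show "prod.swap x \<in> N"
        using t by (auto simp: N_def N1_def topspace_fib_square f_def s_swap)
    qed
    show "motion E p N lam"
      unfolding motion_def
    proof (intro conjI ballI)
      have "continuous_map (prod_topology (subtopology ?X N) unit_interval)
          (subtopology (prod_topology E B) {(e, b). (p e, b) \<in> U}) (\<lambda>x. (f (fst x) (snd x), p (fst (fst x))))"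
      proof (intro continuous_map_into_subtopology continuous_map_pairedI)
        show "continuous_map (prod_topology (subtopology ?X N) unit_interval) E (\<lambda>x. f (fst x) (snd x))"
          using continuous_map_prod_subtopology_mono[OF fc Nsub(1)] by (simp add: case_prod_unfold)
        show "continuous_map (prod_topology (subtopology ?X N) unit_interval) B (\<lambda>x. p (fst (fst x)))"
          by (rule continuous_map_prod_subtopology_mono[OF bc Nsub(1)])
      qed (auto simp: N_def)
      from continuous_map_comp[OF T(1) this]
      show "continuous_map (prod_topology (subtopology ?X N) unit_interval) E (\<lambda>(x, t). lam x t)"
        by (simp add: lam_def case_prod_unfold)
    next
      fix x assume "x \<in> topspace ?X \<inter> N"
      then have x: "x \<in> N" "x \<in> N1" "fst x \<in> topspace E" "snd x \<in> topspace E" "p (fst x) = p (snd x)"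
        using Nsub x_top by auto
      show "lam x 0 = fst x"
        using x(3) h r g T(3) by (simp add: lam_def f_def s_def)
      show "lam x 1 = snd x"
        using x h r g T(3) by (simp add: lam_def f_def s_def)
      show "p (lam x t) = p (fst x)" if "t \<in> {0..1}" for t
        unfolding lam_def using x fE that by (intro T(2)) (auto simp: N_def)
      show "lam (prod.swap x) t = lam x (1 - t)" for t
        using x by (simp add: lam_def f_def s_swap)
    qed
    show "lam (e, e) t = e" if "e \<in> topspace E" "t \<in> {0..1}" for e t
      using f_diag T(3) that by (simp add: lam_def)
  qed
qed

section \<open>Restricting, gluing and currying motions\<close>

lemma topspace_fib_paths:
  "topspace (fib_paths E p) =
    {\<gamma> \<in> extensional {0..1}. continuous_map unit_interval E \<gamma> \<and> (\<exists>b. \<forall>t\<in>{0..1}. p (\<gamma> t) = b)}"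
  by (auto simp: fib_paths_def topspace_compact_open)

lemma fib_pathsD:
  assumes "\<gamma> \<in> topspace (fib_paths E p)" "t \<in> {0..1}"
  shows "\<gamma> t \<in> topspace E" "p (\<gamma> t) = p (\<gamma> 0)"
  using assms by (auto simp: topspace_fib_paths continuous_map_def)

lemma motionD:
  assumes "motion E p U m" "x \<in> topspace (fib_square E p)" "x \<in> U"
  shows "m x 0 = fst x" "m x 1 = snd x" "t \<in> {0..1} \<Longrightarrow> m x t \<in> topspace E"
    "t \<in> {0..1} \<Longrightarrow> p (m x t) = p (fst x)" "t \<in> {0..1} \<Longrightarrow> m (prod.swap x) t = m x (1 - t)"
proof -
  show "m x t \<in> topspace E" if "t \<in> {0..1}"
    using continuous_map_image_subset_topspace[OF conjunct1[OF assms(1)[unfolded motion_def]]] assms(2,3) that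
    by force
qed (use assms in \<open>auto simp: motion_def\<close>)

lemma motion_continuous:
  "motion E p U m \<Longrightarrow>
    continuous_map (prod_topology (subtopology (fib_square E p) U) unit_interval) E (\<lambda>(x, t). m x t)"
  by (simp add: motion_def)

lemma motion_subset:
  assumes "motion E p U m" "V \<subseteq> U"
  shows "motion E p V m"
  using assms continuous_map_prod_subtopology_mono[OF motion_continuous[OF assms(1)] assms(2)]
  unfolding motion_def by blast

lemma motion_cong:
  assumes m: "motion E p U m" and inv: "prod.swap ` U \<subseteq> U"
    and eq: "\<And>x t. x \<in> topspace (fib_square E p) \<Longrightarrow> x \<in> U \<Longrightarrow> t \<in> {0..1} \<Longrightarrow> m' x t = m x t"
  shows "motion E p U m'"
  unfolding motion_def
proof (intro conjI ballI)
  show "continuous_map (prod_topology (subtopology (fib_square E p) U) unit_interval) E (\<lambda>(x, t). m' x t)"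
    using motion_continuous[OF m] by (rule continuous_map_eq) (auto simp: eq)
  fix x assume "x \<in> topspace (fib_square E p) \<inter> U"
  then have x: "x \<in> topspace (fib_square E p)" "x \<in> U"
    and y: "prod.swap x \<in> topspace (fib_square E p)" "prod.swap x \<in> U"
    using inv by (auto simp: topspace_fib_square)
  show "m' x 0 = fst x" "m' x 1 = snd x"
    using motionD[OF m x] eq[OF x] by auto
  fix t :: real assume "t \<in> {0..1}"
  then show "p (m' x t) = p (fst x)" "m' (prod.swap x) t = m' x (1 - t)"
    using motionD[OF m x] eq[OF x] eq[OF y] by auto
qed

lemma motion_Un:
  assumes "openin (fib_square E p) U" "openin (fib_square E p) V" "motion E p U m" "motion E p V m"
  shows "motion E p (U \<union> V) m"
  unfolding motion_def
proof (intro conjI)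
  let ?Z = "prod_topology (subtopology (fib_square E p) (U \<union> V)) unit_interval"
  have sub: "subtopology ?Z (W \<times> {0..1}) = prod_topology (subtopology (fib_square E p) W) unit_interval"
    if "W \<subseteq> U \<union> V" for W
  proof -
    have "subtopology ?Z (W \<times> {0..1}) = prod_topology (subtopology (subtopology (fib_square E p) (U \<union> V)) W) (subtopology unit_interval {0..1})"
      by (rule subtopology_Times)
    then show ?thesis
      using that by (simp add: subtopology_subtopology Int_absorb1)
  qed
  show "continuous_map ?Z E (\<lambda>(x, t). m x t)"
  proof (rule pasting_lemma[where I="{U, V}" and T="\<lambda>W. W \<times> {0..1}" and f="\<lambda>_ (x, t). m x t"])
    fix W assume W: "W \<in> {U, V}"
    then have "openin (subtopology (fib_square E p) (U \<union> V)) W"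
      using assms(1,2) by (auto simp: openin_subtopology Int_absorb2)
    then show "openin ?Z (W \<times> {0..1})"
      by (simp add: openin_prod_Times_iff)
    show "continuous_map (subtopology ?Z (W \<times> {0..1})) E (\<lambda>(x, t). m x t)"
      using W assms(3,4) by (subst sub) (auto simp: motion_continuous)
  qed auto
qed (use assms in \<open>auto simp: motion_def\<close>)

lemma motion_imp_endpoints_section:
  assumes m: "motion E p U m"
  shows "endpoints_section E p U (\<lambda>x. \<lambda>t\<in>{0..1}. m x t)"
  unfolding Z2_section_on_def Z2_map_def
proof (intro conjI ballI)
  have "continuous_map (subtopology (fib_square E p) U) (compact_open_topology unit_interval E) (\<lambda>x. \<lambda>t\<in>{0..1}. m x t)"
    using continuous_map_curry_compact_open[OF motion_continuous[OF m]] by simp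
  then show "continuous_map (subtopology (fib_square E p) U) (fib_paths E p) (\<lambda>x. \<lambda>t\<in>{0..1}. m x t)"
    unfolding fib_paths_def using motionD(4)[OF m] by (intro continuous_map_into_subtopology) auto
next
  fix x assume "x \<in> topspace (subtopology (fib_square E p) U)"
  then have "x \<in> topspace (fib_square E p)" "x \<in> U" by auto
  from motionD(5)[OF m this]
  show "(\<lambda>t\<in>{0..1}. m (prod.swap x) t) = rev_path (\<lambda>t\<in>{0..1}. m x t)"
    by (auto simp: rev_path_def)
next
  fix x assume "x \<in> topspace (fib_square E p) \<inter> U"
  then show "endpoints (\<lambda>t\<in>{0..1}. m x t) = x"
    using motionD(1,2)[OF m] by (simp add: endpoints_def)
qed

text \<open>The last third is the reversed \<open>a\<close>-path of the swapped pair. Equivariance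
  of the whole is thereby built in as soon as \<open>c\<close> is symmetric; \<open>a\<close> itself
  may be as one-sided as it likes.\<close>

definition sym_concat :: "('e \<times> 'e \<Rightarrow> real \<Rightarrow> 'e) \<Rightarrow> ('e \<times> 'e \<Rightarrow> real \<Rightarrow> 'e) \<Rightarrow> 'e \<times> 'e \<Rightarrow> real \<Rightarrow> 'e"
  where "sym_concat a c x t =
    (if t \<le> 1/3 then a x (3 * t) else if t \<le> 2/3 then c x (3 * t - 1) else a (prod.swap x) (3 - 3 * t))"

lemma motion_sym_concat:
  assumes inv: "prod.swap ` U \<subseteq> U"
    and a: "continuous_map (prod_topology (subtopology (fib_square E p) U) unit_interval) E (\<lambda>(x, t). a x t)"
    and c: "continuous_map (prod_topology (subtopology (fib_square E p) U) unit_interval) E (\<lambda>(x, t). c x t)"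
    and a0: "\<And>x. x \<in> topspace (fib_square E p) \<Longrightarrow> x \<in> U \<Longrightarrow> a x 0 = fst x"
    and a1: "\<And>x. x \<in> topspace (fib_square E p) \<Longrightarrow> x \<in> U \<Longrightarrow> a x 1 = c x 0"
    and csym: "\<And>x t. x \<in> topspace (fib_square E p) \<Longrightarrow> x \<in> U \<Longrightarrow> t \<in> {0..1} \<Longrightarrow> c (prod.swap x) t = c x (1 - t)"
    and pa: "\<And>x t. x \<in> topspace (fib_square E p) \<Longrightarrow> x \<in> U \<Longrightarrow> t \<in> {0..1} \<Longrightarrow> p (a x t) = p (fst x)"
    and pc: "\<And>x t. x \<in> topspace (fib_square E p) \<Longrightarrow> x \<in> U \<Longrightarrow> t \<in> {0..1} \<Longrightarrow> p (c x t) = p (fst x)"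
  shows "motion E p U (sym_concat a c)"
proof -
  let ?X = "fib_square E p"
  let ?Z = "prod_topology (subtopology ?X U) unit_interval"
  have swapX: "prod.swap x \<in> topspace ?X" "prod.swap x \<in> U" if "x \<in> topspace ?X" "x \<in> U" for x
    using that inv by (auto simp: topspace_fib_square)
  \<comment> \<open>The joint at time 2/3 is the mirror image of the joint at time 1/3 for the
    swapped pair.\<close>
  have c1: "c x 1 = a (prod.swap x) 1" if "x \<in> topspace ?X" "x \<in> U" for x
    using a1[OF swapX[OF that]] csym[OF that, of 0] by simp
  have sw: "continuous_map (subtopology ?X U) (subtopology ?X U) prod.swap"
    by (intro continuous_map_into_subtopology continuous_map_from_subtopology continuous_map_swap_fib_square)
      (use inv in auto)
  have snd: "continuous_map ?Z euclideanreal snd"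
    by (rule continuous_map_snd_unit_interval)
  have fst: "continuous_map ?Z (subtopology ?X U) fst"
    by (rule continuous_map_fst)
  have lin: "continuous_map (subtopology ?Z T) unit_interval (\<lambda>x. \<alpha> * snd x + \<beta>)"
    if "\<And>x. x \<in> T \<Longrightarrow> snd x \<in> {0..1} \<Longrightarrow> \<alpha> * snd x + \<beta> \<in> {0..1}" for T and \<alpha> \<beta> :: real
  proof -
    have "continuous_map (subtopology ?Z T) euclideanreal (\<lambda>x. \<alpha> * snd x + \<beta>)"
      by (intro continuous_map_add continuous_map_real_mult_left continuous_map_from_subtopology[OF snd]) auto
    then show ?thesis
      using that by (intro continuous_map_into_subtopology) auto
  qed
  have Zsub: "fst x \<in> topspace ?X \<and> fst x \<in> U \<and> 0 \<le> snd x \<and> snd x \<le> 1" if "x \<in> topspace ?Z" for x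
    using that by (auto simp: mem_Times_iff)
  let ?cc = "\<lambda>x. if snd x \<le> 2/3 then c (fst x) (3 * snd x - 1) else a (prod.swap (fst x)) (3 - 3 * snd x)"
  let ?T = "{x \<in> topspace ?Z. 1/3 \<le> snd x}"
  have "continuous_map (subtopology ?Z ?T) E ?cc"
  proof (rule continuous_map_cases_le)
    let ?A = "{x. x \<in> topspace (subtopology ?Z ?T) \<and> snd x \<le> 2/3}"
    let ?B = "{x. x \<in> topspace (subtopology ?Z ?T) \<and> 2/3 \<le> snd x}"
    show "continuous_map (subtopology ?Z ?T) euclideanreal snd"
      by (rule continuous_map_from_subtopology[OF snd])
    show "continuous_map (subtopology (subtopology ?Z ?T) ?A) E (\<lambda>x. c (fst x) (3 * snd x - 1))"
      unfolding subtopology_subtopology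
      by (rule continuous_map_apply2[OF c continuous_map_from_subtopology[OF fst]])
        (use lin[of "?T \<inter> ?A" 3 "-1"] in auto)
    show "continuous_map (subtopology (subtopology ?Z ?T) ?B) E (\<lambda>x. a (prod.swap (fst x)) (3 - 3 * snd x))"
      unfolding subtopology_subtopology
      by (rule continuous_map_apply2[OF a continuous_map_comp[OF sw continuous_map_from_subtopology[OF fst]]])
        (use lin[of "?T \<inter> ?B" "-3" 3] in auto)
    fix x assume x: "x \<in> topspace (subtopology ?Z ?T)" "snd x = 2/3"
    then have "fst x \<in> topspace ?X" "fst x \<in> U" using Zsub[of x] by auto
    then have "c (fst x) 1 = a (prod.swap (fst x)) 1" by (rule c1)
    then show "c (fst x) (3 * snd x - 1) = a (prod.swap (fst x)) (3 - 3 * snd x)"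
      by (simp add: x(2))
  qed auto
  then have "continuous_map ?Z E (\<lambda>x. if snd x \<le> 1/3 then a (fst x) (3 * snd x) else ?cc x)"
  proof (rule continuous_map_cases_le[OF snd, rotated 2])
    show "continuous_map (subtopology ?Z {x \<in> topspace ?Z. snd x \<le> 1/3}) E (\<lambda>x. a (fst x) (3 * snd x))"
      by (rule continuous_map_apply2[OF a continuous_map_from_subtopology[OF fst]])
        (use lin[of "{x \<in> topspace ?Z. snd x \<le> 1/3}" 3 0] in auto)
    fix x assume x: "x \<in> topspace ?Z" "snd x = 1/3"
    then have "fst x \<in> topspace ?X" "fst x \<in> U" using Zsub[of x] by auto
    then have "a (fst x) 1 = c (fst x) 0" by (rule a1)
    then show "a (fst x) (3 * snd x) = ?cc x"
      by (simp add: x(2))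
  qed auto
  then have cont: "continuous_map ?Z E (\<lambda>(x, t). sym_concat a c x t)"
    by (simp add: sym_concat_def case_prod_unfold)
  show ?thesis
    unfolding motion_def
  proof (intro conjI ballI cont)
    fix x assume "x \<in> topspace ?X \<inter> U"
    then have x: "x \<in> topspace ?X" "x \<in> U" by auto
    note y = swapX[OF x]
    have pswap: "p (snd x) = p (fst x)" using x by (auto simp: topspace_fib_square)
    show "sym_concat a c x 0 = fst x" "sym_concat a c x 1 = snd x"
      using a0[OF x] a0[OF y] by (auto simp: sym_concat_def)
    fix t :: real assume t: "t \<in> {0..1}"
    show "p (sym_concat a c x t) = p (fst x)"
      using pa[OF x, of "3 * t"] pc[OF x, of "3 * t - 1"] pa[OF y, of "3 - 3 * t"] pswap t
      by (auto simp: sym_concat_def)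
    \<comment> \<open>Reversal of time maps the three branches to each other except at 1/3 and 2/3,
      where both times use the branch to their left. At these times the matching at the joints is
      needed.\<close>
    consider "t < 1/3" | "t = 1/3" | "1/3 < t" "t < 2/3" | "t = 2/3" | "t > 2/3" by linarith
    then show "sym_concat a c (prod.swap x) t = sym_concat a c x (1 - t)"
    proof cases
      case 2
      show ?thesis using c1[OF x] by (simp add: sym_concat_def 2)
    next
      case 3 then show ?thesis using csym[OF x, of "3 * t - 1"] by (simp add: sym_concat_def algebra_simps)
    next
      case 4
      show ?thesis using a1[OF x] csym[OF x, of 1] by (simp add: sym_concat_def 4)
    qed (auto simp: sym_concat_def algebra_simps)
  qed
qed

text \<open>On its way to \<open>x\<close> the homotopy may pass through other fibres. Its trace in
  the base is the same for \<open>x\<close> and for the swapped pair. Transporting the whole path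
  \<open>s x\<close> along this trace gives the middle third \<open>c\<close>, in the fibre of
  \<open>x\<close> and still symmetric. The outer third \<open>a\<close> runs from
  \<open>fst x\<close> backwards along the homotopy to \<open>s x 0\<close>, each point being
  transported to the fibre of \<open>x\<close> along the remaining part of the trace.\<close>

lemma motion_of_homotopy_section:
  assumes \<Gamma>: "lifting_function E B p \<Gamma>" and p: "continuous_map E B p"
    and inv: "prod.swap ` U \<subseteq> U"
    and s: "Z2_map (subtopology (fib_square E p) U) prod.swap (fib_paths E p) rev_path s"
    and hom: "Z2_homotopic (subtopology (fib_square E p) U) prod.swap (fib_square E p) prod.swap
       (endpoints \<circ> s) id"
  obtains m where "motion E p U m"
proof -
  let ?X = "fib_square E p"
  let ?XU = "subtopology ?X U"
  have swapX: "prod.swap x \<in> topspace ?X" "prod.swap x \<in> U" if "x \<in> topspace ?X" "x \<in> U" for x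
    using that inv by (auto simp: topspace_fib_square)
  obtain H where H: "continuous_map (prod_topology unit_interval ?XU) ?X H"
      "\<And>x. H (0, x) = (endpoints \<circ> s) x" "\<And>x. H (1, x) = id x"
      and H_inv: "\<forall>t\<in>{0..1}. \<forall>x\<in>topspace ?XU. H (t, prod.swap x) = prod.swap (H (t, x))"
    using hom[unfolded Z2_homotopic_def homotopic_with_def] by (elim exE conjE) (rule that, blast+)
  have H_swap: "H (t, prod.swap x) = prod.swap (H (t, x))"
    if "t \<in> {0..1}" "x \<in> topspace ?X" "x \<in> U" for t x
    using H_inv that by simp
  define h where "h = (\<lambda>x t. fst (H (t, x)))"
  have sX: "s x \<in> topspace (fib_paths E p)" if "x \<in> topspace ?X" "x \<in> U" for x
    using s that by (auto simp: Z2_map_def continuous_map_def)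
  have s_swap: "s (prod.swap x) t = s x (1 - t)" if "x \<in> topspace ?X" "x \<in> U" "t \<in> {0..1}" for x t
  proof -
    have "s (prod.swap x) = rev_path (s x)"
      using s that(1,2) unfolding Z2_map_def by simp
    then show ?thesis using that(3) by (simp add: rev_path_def)
  qed
  have sc: "continuous_map (prod_topology ?XU unit_interval) E (\<lambda>(x, t). s x t)"
    by (rule continuous_map_uncurry_compact_open,
        rule continuous_map_into_fulltopology[OF conjunct1[OF s[unfolded Z2_map_def fib_paths_def]]])
  have hc: "continuous_map (prod_topology ?XU unit_interval) E (\<lambda>(x, t). h x t)"
  proof -
    have "continuous_map (prod_topology ?XU unit_interval) E (\<lambda>x. fst (H (snd x, fst x)))"
      by (rule continuous_map_comp[OF continuous_map_fst_fib_square],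
          rule continuous_map_comp[OF H(1)],
          intro continuous_map_pairedI continuous_map_snd continuous_map_fst)
    then show ?thesis by (simp add: h_def case_prod_unfold)
  qed
  have HX: "H (t, x) \<in> topspace ?X" if "x \<in> topspace ?X" "x \<in> U" "t \<in> {0..1}" for x t
    using continuous_map_image_subset_topspace[OF H(1)] that by force
  \<comment> \<open>Swapping exchanges the two components of \<open>H (t, x)\<close>, which lie over
    one point of the base.\<close>
  have ph: "p (h (prod.swap x) t) = p (h x t)" if "x \<in> topspace ?X" "x \<in> U" "t \<in> {0..1}" for x t
    using HX[OF that] H_swap[OF that(3,1,2)] by (auto simp: h_def topspace_fib_square)
  have h0: "h x 0 = s x 0" for x
    by (simp add: h_def H(2) endpoints_def)
  have h1: "h x 1 = fst x" for x
    by (simp add: h_def H(3))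
  let ?Z = "prod_topology ?XU unit_interval"
  have Zsub: "fst z \<in> topspace ?X \<and> fst z \<in> U \<and> 0 \<le> snd z \<and> snd z \<le> 1" if "z \<in> topspace ?Z" for z
    using that by (auto simp: mem_Times_iff)
  text \<open>Follow the first endpoint of the homotopy up to time \<open>1 - t\<close>, then lift the rest of its
    trace in the base. Shifting the path instead of cutting it off avoids the need for a regular
    lifting function.\<close>
  define rest where "rest = (\<lambda>z v. p (h (fst z) (min 1 (1 - snd z + v))))"
  define a where "a = (\<lambda>x t. \<Gamma> (h x (1 - t)) (\<lambda>v\<in>{0..1}. rest (x, t) v) t)"
  \<comment> \<open>All points of \<open>s x\<close> lie over the start \<open>p (h x 0)\<close> of
    the trace, so each can be transported along the whole trace.\<close>
  define c where "c = (\<lambda>x t. \<Gamma> (s x t) (\<lambda>v\<in>{0..1}. p (h x v)) 1)"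
  have f1: "continuous_map ?Z E (\<lambda>z. h (fst z) (1 - snd z))"
  proof (rule continuous_map_apply2[OF hc continuous_map_fst])
    have "continuous_map ?Z euclideanreal (\<lambda>z. 1 - snd z)"
      by (intro continuous_map_diff continuous_map_snd_unit_interval) auto
    then show "continuous_map ?Z unit_interval (\<lambda>z. 1 - snd z)"
      by (intro continuous_map_into_subtopology) auto
  qed
  have g1: "continuous_map (prod_topology ?Z unit_interval) B (\<lambda>(z, v). rest z v)"
  proof -
    have "continuous_map (prod_topology ?Z unit_interval) E (\<lambda>y. h (fst (fst y)) (min 1 (1 - snd (fst y) + snd y)))"
    proof (rule continuous_map_apply2[OF hc])
      show "continuous_map (prod_topology ?Z unit_interval) ?XU (\<lambda>y. fst (fst y))"
        by (rule continuous_map_comp[OF continuous_map_fst continuous_map_fst])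
      have "continuous_map (prod_topology ?Z unit_interval) euclideanreal (\<lambda>y. min 1 (1 - snd (fst y) + snd y))"
        by (intro continuous_map_real_min continuous_map_add continuous_map_diff continuous_map_snd_unit_interval
            continuous_map_comp[OF continuous_map_snd_unit_interval continuous_map_fst]) auto
      then show "continuous_map (prod_topology ?Z unit_interval) unit_interval (\<lambda>y. min 1 (1 - snd (fst y) + snd y))"
        by (intro continuous_map_into_subtopology) auto
    qed
    from continuous_map_comp[OF p this] show ?thesis
      by (simp add: rest_def case_prod_unfold)
  qed
  have r0: "rest z 0 = p (h (fst z) (1 - snd z))" if "z \<in> topspace ?Z" for z
    using Zsub[OF that] by (simp add: rest_def)
  have g2: "continuous_map (prod_topology ?Z unit_interval) B (\<lambda>(z, v). p (h (fst z) v))"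
  proof -
    have "continuous_map (prod_topology ?Z unit_interval) E (\<lambda>y. h (fst (fst y)) (snd y))"
      by (rule continuous_map_apply2[OF hc continuous_map_comp[OF continuous_map_fst continuous_map_fst] continuous_map_snd])
    from continuous_map_comp[OF p this] show ?thesis
      by (simp add: case_prod_unfold)
  qed
  have s0: "p (h (fst z) 0) = p (s (fst z) (snd z))" if "z \<in> topspace ?Z" for z
    using fib_pathsD(2)[OF sX, of "fst z" "snd z"] Zsub[OF that] by (simp add: h0)
  have sc': "continuous_map ?Z E (\<lambda>z. s (fst z) (snd z))"
    using sc by (simp add: case_prod_unfold)
  note La = lifting_function_continuous[OF \<Gamma> f1 g1 r0] lifting_function_start[OF \<Gamma> f1 g1 r0]
    lifting_function_lifts[OF \<Gamma> f1 g1 r0]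
  note Lc = lifting_function_continuous[OF \<Gamma> sc' g2 s0] lifting_function_start[OF \<Gamma> sc' g2 s0]
    lifting_function_lifts[OF \<Gamma> sc' g2 s0]
  have idZ: "continuous_map ?Z ?Z (\<lambda>z. z)"
    using continuous_map_id[of ?Z] by (simp add: id_def)
  have "motion E p U (sym_concat a c)"
  proof (rule motion_sym_concat[OF inv])
    show "continuous_map ?Z E (\<lambda>(x, t). a x t)"
      using continuous_map_apply2[OF La(1) idZ continuous_map_snd]
      by (simp add: a_def case_prod_unfold)
    have "continuous_map ?Z unit_interval (\<lambda>_. 1)"
      by auto
    from continuous_map_apply2[OF Lc(1) idZ this]
    show "continuous_map ?Z E (\<lambda>(x, t). c x t)"
      by (simp add: c_def case_prod_unfold)
    fix x assume x: "x \<in> topspace ?X" "x \<in> U"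
    have inZ: "(x, t) \<in> topspace ?Z" if "t \<in> {0..1}" for t
      using x that by auto
    show "a x 0 = fst x"
      using La(2)[OF _ inZ[of 0]] by (simp add: a_def h1)
    have "(\<lambda>v\<in>{0..1}. rest (x, 1) v) = (\<lambda>v\<in>{0..1}. p (h x v))"
      by (auto simp: rest_def)
    then show "a x 1 = c x 0"
      by (simp add: a_def c_def h0)
    fix t :: real assume t: "t \<in> {0..1}"
    have "(\<lambda>v\<in>{0..1}. p (h (prod.swap x) v)) = (\<lambda>v\<in>{0..1}. p (h x v))"
      using ph[OF x] by auto
    then show "c (prod.swap x) t = c x (1 - t)"
      using s_swap[OF x t] by (simp add: c_def)
    \<comment> \<open>The shifted trace is read at \<open>v = t\<close>, where its parameter
      \<open>1 - t + v\<close> has reached 1 and \<open>h x 1 = fst x\<close>.\<close>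
    show "p (a x t) = p (fst x)"
      using La(3)[OF _ inZ[OF t] t] by (simp add: a_def rest_def h1)
    show "p (c x t) = p (fst x)"
      using Lc(3)[OF _ inZ[OF t], of 1] by (simp add: c_def h1)
  qed
  then show ?thesis using that by blast
qed

text \<open>\<open>u x\<close> is the proportion of the path \<open>m x\<close> that is kept: follow
  it up to \<open>u x / 2\<close>, bridge the gap to its mirror point by \<open>lam\<close>, and
  continue. For \<open>u x = 1\<close> the gap is a diagonal pair at the midpoint, so the bridge
  always exists. For \<open>u x = 0\<close> only \<open>lam x\<close> is left, which makes sense
  outside \<open>U\<close> as well. In between the gap must lie in \<open>N\<close>, which is
  guaranteed on \<open>V\<close>. Only the closed set \<open>K\<close> is sure to survive, as
  \<open>U\<close> itself may lose points near its boundary.\<close>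

lemma motion_extend_to_diagonal:
  assumes N: "openin (fib_square E p) N" "diag E \<subseteq> N" "prod.swap ` N \<subseteq> N"
    and lam: "motion E p N lam" "\<And>e t. e \<in> topspace E \<Longrightarrow> t \<in> {0..1} \<Longrightarrow> lam (e, e) t = e"
    and U: "openin (fib_square E p) U" "prod.swap ` U \<subseteq> U" and m: "motion E p U m"
    and K: "closedin (fib_square E p) K" "K \<subseteq> U"
    and normal: "normal_space (fib_square E p)" and dcl: "closedin (fib_square E p) (diag E)"
  obtains U' m' where "openin (fib_square E p) U'" "prod.swap ` U' \<subseteq> U'" "K \<subseteq> U'" "diag E \<subseteq> U'"
    "motion E p U' m'" "\<And>e t. e \<in> topspace E \<Longrightarrow> t \<in> {0..1} \<Longrightarrow> m' (e, e) t = e"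
proof -
  let ?X = "fib_square E p"
  let ?XU = "subtopology ?X U"
  have swapX: "prod.swap x \<in> topspace ?X" if "x \<in> topspace ?X" for x
    using that by (auto simp: topspace_fib_square)
  have swapU: "prod.swap x \<in> U \<longleftrightarrow> x \<in> U" for x
    using U(2) by (metis image_subset_iff swap_swap)
  have half: "s / 2 \<in> {0..1}" "1 - s / 2 \<in> {0..1}" if "s \<in> {0..1}" for s :: real
    using that by auto
  \<comment> \<open>The two ends of the gap when the proportion \<open>s\<close> is kept:
    \<open>F x 0 = x\<close>, and \<open>F x 1\<close> is the midpoint doubled.\<close>
  define F where "F = (\<lambda>x s. (m x (s / 2), m x (1 - s / 2)))"
  have FX: "F x s \<in> topspace ?X" "p (fst (F x s)) = p (fst x)" if "x \<in> topspace ?X" "x \<in> U" "s \<in> {0..1}" for x s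
    using motionD(3,4)[OF m that(1,2)] half[OF that(3)] by (auto simp: F_def topspace_fib_square)
  have F_swap: "F (prod.swap x) s = prod.swap (F x s)" if "x \<in> topspace ?X" "x \<in> U" "s \<in> {0..1}" for x s
    using motionD(5)[OF m that(1,2)] half[OF that(3)] by (simp add: F_def)
  have F0: "F x 0 = x" if "x \<in> topspace ?X" "x \<in> U" for x
    using motionD(1,2)[OF m that] by (simp add: F_def)
  have F1: "F x 1 \<in> N" if "x \<in> topspace ?X" "x \<in> U" for x
  proof -
    have "m x (1/2) \<in> topspace E" by (rule motionD(3)[OF m that]) auto
    then show ?thesis using N(2) by (auto simp: F_def diag_def)
  qed
  have F_diag: "F (e, e) s \<in> N" if "e \<in> topspace E" "(e, e) \<in> U" "s \<in> {0..1}" for e s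
  proof -
    have x: "(e, e) \<in> topspace ?X" using that by (simp add: topspace_fib_square)
    have "m (e, e) (s / 2) = m (e, e) (1 - s / 2)"
      using motionD(5)[OF m x that(2) half(1)[OF that(3)]] by simp
    moreover have "m (e, e) (s / 2) \<in> topspace E"
      by (rule motionD(3)[OF m x that(2) half(1)[OF that(3)]])
    ultimately show ?thesis using N(2) by (auto simp: F_def diag_def)
  qed
  have Fc: "continuous_map Z ?X (\<lambda>z. F (f z) (g z))"
    if f: "continuous_map Z ?XU f" and g: "continuous_map Z unit_interval g" for Z :: "'z topology" and f g
  proof -
    have g': "continuous_map Z euclideanreal g" "\<And>z. z \<in> topspace Z \<Longrightarrow> g z \<in> {0..1}"
      using g by (auto simp: continuous_map_in_subtopology)
    have "continuous_map Z unit_interval (\<lambda>z. g z / 2)" "continuous_map Z unit_interval (\<lambda>z. 1 - g z / 2)"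
      using half[OF g'(2)]
      by (auto intro!: continuous_map_into_subtopology continuous_map_real_divide continuous_map_diff g'(1))
    then have "continuous_map Z (prod_topology E E) (\<lambda>z. F (f z) (g z))"
      unfolding F_def by (intro continuous_map_pairedI continuous_map_apply2[OF motion_continuous[OF m]] f)
    moreover have "F (f z) (g z) \<in> topspace ?X" if "z \<in> topspace Z" for z
      using f that by (intro FX g'(2)) (auto simp: continuous_map_def)
    ultimately show ?thesis
      unfolding fib_square_def by (intro continuous_map_into_subtopology) auto
  qed
  \<comment> \<open>The points whose path can be cut by any amount. By symmetry of
    \<open>m (e, e)\<close> every diagonal point of \<open>U\<close> belongs to it.\<close>
  define V where "V = {x \<in> topspace ?XU. \<forall>s\<in>{0..1}. (\<lambda>(x, s). F x s) (x, s) \<in> N}"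
  have "openin ?XU V"
    unfolding V_def
    by (rule openin_tube_unit_interval[OF _ N(1)])
      (use Fc[OF continuous_map_fst continuous_map_snd] in \<open>simp add: case_prod_unfold\<close>)
  then have V: "openin ?X V"
    using U(1) openin_trans_full by blast
  have V_swap: "prod.swap x \<in> V" if "x \<in> V" for x
  proof -
    have x: "x \<in> topspace ?X" "x \<in> U" using that by (auto simp: V_def)
    then show ?thesis
      using that N(3) F_swap swapX swapU by (auto simp: V_def image_subset_iff)
  qed
  have closed0: "closedin ?X (diag E \<union> (topspace ?X - U))"
    using dcl U(1) by (intro closedin_Un) auto
  have closed1: "closedin ?X (K - V)"
    using K(1) V by (rule closedin_diff)
  \<comment> \<open>Diagonal points of \<open>K\<close> lie in \<open>V\<close>, so the part of
    \<open>K\<close> where all of \<open>m\<close> must be kept avoids the diagonal.\<close>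
  have disj: "disjnt (diag E \<union> (topspace ?X - U)) (K - V)"
  proof -
    have "x \<in> V" if "x \<in> diag E" "x \<in> K" for x
      using that K(2) F_diag closedin_subset[OF K(1)] by (auto simp: diag_def V_def)
    then show ?thesis using K(2) by (auto simp: disjnt_def)
  qed
  obtain g :: "_ \<Rightarrow> real" where g: "continuous_map ?X euclideanreal g"
    "g ` (diag E \<union> (topspace ?X - U)) \<subseteq> {0}" "g ` (K - V) \<subseteq> {1}"
    using Urysohn_lemma_alt[OF normal closed0 closed1 disj, where a=0 and b=1] by blast
  \<comment> \<open>The maximum over the orbit is invariant. It vanishes on the diagonal and off
    \<open>U\<close>, since both sets are invariant, and is at least 1 on \<open>K - V\<close>. The
    slope 3 makes \<open>u\<close> equal to 0 for \<open>w \<le> 1/3\<close> and to 1 for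
    \<open>w \<ge> 2/3\<close>.\<close>
  define w where "w = (\<lambda>x. max (g x) (g (prod.swap x)))"
  define u where "u = (\<lambda>x. max 0 (min 1 (3 * w x - 1)))"
  have wc: "continuous_map ?X euclideanreal w"
    unfolding w_def
    by (intro continuous_map_real_max g(1) continuous_map_comp[OF g(1) continuous_map_swap_fib_square])
  have uc: "continuous_map ?X unit_interval u"
  proof -
    have "continuous_map ?X euclideanreal u"
      unfolding u_def
      by (intro continuous_map_real_max continuous_map_real_min continuous_map_diff
          continuous_map_real_mult_left wc) auto
    then show ?thesis by (intro continuous_map_into_subtopology) (auto simp: u_def)
  qed
  have u01: "u x \<in> {0..1}" for x
    by (auto simp: u_def)
  have w_swap: "w (prod.swap x) = w x" for x
    by (simp add: w_def max.commute)
  then have u_swap: "u (prod.swap x) = u x" for x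
    by (simp add: u_def)
  have w_U: "w x = 0" if "x \<in> topspace ?X" "x \<notin> U" for x
  proof -
    have "g x = 0" "g (prod.swap x) = 0"
      using g(2) that swapX[OF that(1)] swapU[of x] by auto
    then show ?thesis by (simp add: w_def)
  qed
  have w_diag: "w (e, e) = 0" if "e \<in> topspace E" for e
    using g(2) that by (auto simp: w_def diag_def)
  \<comment> \<open>On \<open>P\<close> the bridge exists: either \<open>u = 1\<close>, or the point
    is in \<open>V\<close>, where every value of \<open>u\<close> is allowed. On \<open>Q\<close>
    one has \<open>u = 0\<close>, and \<open>lam\<close> alone suffices. \<open>P\<close> covers
    \<open>K\<close> because \<open>w \<ge> 1\<close> on \<open>K - V\<close>, and \<open>Q\<close>
    covers the diagonal.\<close>
  define P where "P = {x \<in> topspace ?X. w x \<in> {2/3<..}} \<union> V"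
  define Q where "Q = {x \<in> topspace ?X. w x \<in> {..<1/3}} \<inter> N"
  have PQ: "openin ?X P" "openin ?X Q"
    unfolding P_def Q_def
    by (intro openin_Un openin_Int openin_continuous_map_preimage[OF wc] V N(1); simp)+
  have PU: "P \<subseteq> U"
    using w_U by (fastforce simp: P_def V_def)
  have swapP: "prod.swap ` P \<subseteq> P" and swapQ: "prod.swap ` Q \<subseteq> Q"
    using swapX w_swap V_swap N(3) by (auto simp: P_def Q_def)
  have uQ: "u x = 0" if "x \<in> Q" for x
    using that by (auto simp: Q_def u_def)
  have FN: "F x (u x) \<in> N" if x: "x \<in> topspace ?X" "x \<in> P" for x
  proof (cases "x \<in> V")
    case True
    then show ?thesis using u01 by (auto simp: V_def)
  next
    case False
    then have "u x = 1" using x by (auto simp: P_def u_def)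
    then show ?thesis using F1[OF x(1)] x(2) PU by auto
  qed
  define mP where "mP = sym_concat (\<lambda>x t. m x (t * u x / 2)) (\<lambda>x t. lam (F x (u x)) t)"
  \<comment> \<open>Not simply \<open>lam\<close>: constant outer thirds give it the timing of
    \<open>mP\<close>, so that the two agree exactly on the overlap.\<close>
  define mQ where "mQ = sym_concat (\<lambda>x t. fst x) lam"
  have mP: "motion E p P mP"
    unfolding mP_def
  proof (rule motion_sym_concat[OF swapP])
    let ?Z = "prod_topology (subtopology ?X P) unit_interval"
    have fst_in: "continuous_map ?Z ?X fst"
      by (intro continuous_map_prod_subtopology continuous_map_fst)
    have fstU: "continuous_map ?Z ?XU fst"
      using PU by (intro continuous_map_into_subtopology fst_in) auto
    have ufst: "continuous_map ?Z unit_interval (\<lambda>z. u (fst z))"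
      by (rule continuous_map_comp[OF uc fst_in])
    then have ufst': "continuous_map ?Z euclideanreal (\<lambda>z. u (fst z))"
      by (rule continuous_map_into_fulltopology)
    have "continuous_map ?Z unit_interval (\<lambda>z. snd z * u (fst z) / 2)"
    proof (rule continuous_map_into_subtopology)
      show "continuous_map ?Z euclideanreal (\<lambda>z. snd z * u (fst z) / 2)"
        by (intro continuous_map_real_divide continuous_map_real_mult continuous_map_snd_unit_interval ufst') auto
      have "t * u x / 2 \<le> 1" if "t \<in> {0..1}" for t x
        using mult_le_one[of t "u x"] that u01[of x] by auto
      then show "(\<lambda>z. snd z * u (fst z) / 2) \<in> topspace ?Z \<rightarrow> {0..1}"
        using u01 by auto
    qed
    from continuous_map_apply2[OF motion_continuous[OF m] fstU this]
    show "continuous_map ?Z E (\<lambda>(x, t). m x (t * u x / 2))"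
      by (simp add: case_prod_unfold)
    have "continuous_map ?Z (subtopology ?X N) (\<lambda>z. F (fst z) (u (fst z)))"
      using FN by (intro continuous_map_into_subtopology Fc fstU ufst) auto
    from continuous_map_apply2[OF motion_continuous[OF lam(1)] this continuous_map_snd]
    show "continuous_map ?Z E (\<lambda>(x, t). lam (F x (u x)) t)"
      by (simp add: case_prod_unfold)
    fix x assume x: "x \<in> topspace ?X" "x \<in> P"
    then have xU: "x \<in> U" using PU by auto
    note FX' = FX[OF x(1) xU u01[of x]]
    show "m x (0 * u x / 2) = fst x"
      using motionD(1)[OF m x(1) xU] by simp
    show "m x (1 * u x / 2) = lam (F x (u x)) 0"
      using motionD(1)[OF lam(1) FX'(1) FN[OF x]] by (simp add: F_def)
    fix t :: real assume t: "t \<in> {0..1}"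
    show "lam (F (prod.swap x) (u (prod.swap x))) t = lam (F x (u x)) (1 - t)"
      using motionD(5)[OF lam(1) FX'(1) FN[OF x] t] F_swap[OF x(1) xU u01[of x]] by (simp add: u_swap)
    have "t * u x / 2 \<in> {0..1}"
      using mult_le_one[of t "u x"] t u01[of x] by auto
    then show "p (m x (t * u x / 2)) = p (fst x)"
      by (rule motionD(4)[OF m x(1) xU])
    show "p (lam (F x (u x)) t) = p (fst x)"
      using motionD(4)[OF lam(1) FX'(1) FN[OF x] t] FX'(2) by simp
  qed
  have mQ: "motion E p Q mQ"
    unfolding mQ_def
  proof (rule motion_sym_concat[OF swapQ])
    have lamQ: "motion E p Q lam"
      by (rule motion_subset[OF lam(1)]) (auto simp: Q_def)
    show "continuous_map (prod_topology (subtopology ?X Q) unit_interval) E (\<lambda>(x, t). lam x t)"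
      by (rule motion_continuous[OF lamQ])
    have "continuous_map (prod_topology (subtopology ?X Q) unit_interval) E (\<lambda>z. fst (fst z))"
      by (intro continuous_map_comp[OF continuous_map_fst_fib_square[of E p]]
          continuous_map_prod_subtopology continuous_map_fst)
    then show "continuous_map (prod_topology (subtopology ?X Q) unit_interval) E (\<lambda>(x, t). fst x)"
      by (simp add: case_prod_unfold)
  qed (auto simp: Q_def motionD[OF lam(1)])
  have agree: "mP x t = mQ x t" if x: "x \<in> topspace ?X" "x \<in> P" "x \<in> Q" for x t
  proof -
    have y: "prod.swap x \<in> topspace ?X" "prod.swap x \<in> P" "prod.swap x \<in> Q"
      using x swapX swapP swapQ by auto
    have "F x 0 = x" using F0[OF x(1)] x(2) PU by auto
    moreover have "m x 0 = fst x" "m (prod.swap x) 0 = snd x"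
      using motionD(1)[OF m x(1)] motionD(1)[OF m y(1)] x(2) y(2) PU by auto
    ultimately show ?thesis
      using uQ[OF x(3)] uQ[OF y(3)] by (simp add: mP_def mQ_def sym_concat_def)
  qed
  define m' where "m' = (\<lambda>x. if x \<in> P then mP x else mQ x)"
  show ?thesis
  proof (rule that[of "P \<union> Q" m'])
    show "openin ?X (P \<union> Q)" using PQ by (rule openin_Un)
    show "prod.swap ` (P \<union> Q) \<subseteq> P \<union> Q" using swapP swapQ by blast
    show "K \<subseteq> P \<union> Q"
    proof
      fix x assume x: "x \<in> K"
      show "x \<in> P \<union> Q"
      proof (cases "x \<in> V")
        case False
        then have "w x \<ge> 1" using g(3) x by (auto simp: w_def)
        then show ?thesis using x closedin_subset[OF K(1)] by (auto simp: P_def)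
      qed (simp add: P_def)
    qed
    show "diag E \<subseteq> P \<union> Q"
      using N(2) w_diag by (auto simp: Q_def diag_def topspace_fib_square)
    show "motion E p (P \<union> Q) m'"
    proof (rule motion_Un[OF PQ])
      show "motion E p P m'"
        by (rule motion_cong[OF mP swapP]) (simp add: m'_def)
      show "motion E p Q m'"
        by (rule motion_cong[OF mQ swapQ]) (simp add: m'_def agree)
    qed
    fix e and t :: real assume e: "e \<in> topspace E" and t: "t \<in> {0..1}"
    have X: "(e, e) \<in> topspace ?X" using e by (simp add: topspace_fib_square)
    have "(e, e) \<in> Q"
      using N(2) w_diag e X by (auto simp: Q_def diag_def)
    moreover from this have "m' (e, e) t = mQ (e, e) t"
      using agree X by (simp add: m'_def)
    ultimately show "m' (e, e) t = e"
      using lam(2)[OF e] t by (simp add: mQ_def sym_concat_def)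
  qed
qed

section \<open>Fibred joins\<close>

lemma topspace_join_tuples:
  "z \<in> topspace (join_tuples X q k) \<longleftrightarrow> z \<in> {..k} \<rightarrow>\<^sub>E topspace X \<times> {0..1} \<and>
     (\<forall>i\<le>k. \<forall>j\<le>k. q (fst (z i)) = q (fst (z j))) \<and> (\<Sum>i\<le>k. snd (z i)) = 1"
  unfolding join_tuples_def topspace_subtopology topspace_product_topology topspace_prod_topology
    topspace_euclidean Int_iff mem_Collect_eq o_def Int_UNIV_left by (rule refl)

lemma join_tuplesD:
  assumes "z \<in> topspace (join_tuples X q k)"
  shows "i \<le> k \<Longrightarrow> fst (z i) \<in> topspace X" "i \<le> k \<Longrightarrow> snd (z i) \<in> {0..1}" "i \<le> k \<Longrightarrow> q (fst (z i)) = q (fst (z 0))"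
    "(\<Sum>i\<le>k. snd (z i)) = 1" "z \<in> extensional {..k}" "\<exists>i\<le>k. snd (z i) > 0"
proof -
  note z = assms[unfolded topspace_join_tuples]
  show sum: "(\<Sum>i\<le>k. snd (z i)) = 1"
    by (rule conjunct2[OF conjunct2[OF z]])
  show "z \<in> extensional {..k}"
    using conjunct1[OF z] by (simp add: PiE_def)
  have "z i \<in> topspace X \<times> {0..1}" if "i \<le> k"
    by (rule PiE_mem[OF conjunct1[OF z]]) (simp add: that)
  then show "i \<le> k \<Longrightarrow> fst (z i) \<in> topspace X" "i \<le> k \<Longrightarrow> snd (z i) \<in> {0..1}"
    unfolding mem_Times_iff by blast+
  show "q (fst (z i)) = q (fst (z 0))" if "i \<le> k"
    using conjunct1[OF conjunct2[OF z]] that by blast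
  show "\<exists>i\<le>k. snd (z i) > 0"
  proof (rule ccontr)
    assume "\<not> ?thesis"
    then have "snd (z i) \<le> 0" if "i \<in> {..k}" for i using that by (simp add: not_less)
    then have "(\<Sum>i\<le>k. snd (z i)) \<le> 0" by (rule sum_nonpos)
    with sum show False by simp
  qed
qed

lemma join_tuplesI:
  assumes "z \<in> extensional {..k}" "\<And>i. i \<le> k \<Longrightarrow> fst (z i) \<in> topspace X"
    "\<And>i. i \<le> k \<Longrightarrow> 0 \<le> snd (z i)" "\<And>i. i \<le> k \<Longrightarrow> q (fst (z i)) = y" "(\<Sum>i\<le>k. snd (z i)) = 1"
  shows "z \<in> topspace (join_tuples X q k)"
proof -
  have "snd (z i) \<le> 1" if "i \<le> k" for i
    using member_le_sum[of i "{..k}" "\<lambda>i. snd (z i)"] assms that by auto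
  then have "z \<in> {..k} \<rightarrow>\<^sub>E topspace X \<times> {0..1}"
    using assms(1-3) by (auto simp: PiE_def mem_Times_iff)
  then show ?thesis
    unfolding topspace_join_tuples using assms(4,5) by simp
qed

lemma equivclp_join_step_topspace:
  assumes "equivclp (join_step X q k) z w" "z \<in> topspace (join_tuples X q k)"
  shows "w \<in> topspace (join_tuples X q k)"
  using assms by (induction rule: equivclp_induct) (auto simp: join_step_def)

text \<open>The working form of the equivalence: only the weights and the entries of nonzero weight
  count. Conversely, the entries of \<open>z\<close> are replaced by those of \<open>w\<close> one
  at a time; an entry that really changes has weight 0 on both sides, so each replacement is a
  step.\<close>

lemma equivclp_join_step_iff:
  assumes z: "z \<in> topspace (join_tuples X q k)" and w: "w \<in> topspace (join_tuples X q k)"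
  shows "equivclp (join_step X q k) z w \<longleftrightarrow>
    (\<forall>i\<le>k. snd (z i) = snd (w i) \<and> (snd (z i) \<noteq> 0 \<longrightarrow> fst (z i) = fst (w i)))"
proof
  assume "equivclp (join_step X q k) z w"
  then show "\<forall>i\<le>k. snd (z i) = snd (w i) \<and> (snd (z i) \<noteq> 0 \<longrightarrow> fst (z i) = fst (w i))"
  proof (induction rule: equivclp_induct)
    case (step y w)
    obtain n where n: "snd (y n) = 0" "snd (w n) = 0" "\<And>j. j \<le> k \<Longrightarrow> j \<noteq> n \<Longrightarrow> y j = w j"
      using step(2) unfolding join_step_def by fastforce
    show ?case
    proof (intro allI impI)
      fix i assume "i \<le> k"
      then show "snd (z i) = snd (w i) \<and> (snd (z i) \<noteq> 0 \<longrightarrow> fst (z i) = fst (w i))"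
        using step(3) n(1,2) n(3)[of i] by (cases "i = n") auto
    qed
  qed auto
next
  assume eq: "\<forall>i\<le>k. snd (z i) = snd (w i) \<and> (snd (z i) \<noteq> 0 \<longrightarrow> fst (z i) = fst (w i))"
  note Z = join_tuplesD[OF z] and W = join_tuplesD[OF w]
  \<comment> \<open>An entry of positive weight is common to \<open>z\<close> and \<open>w\<close>,
    so both tuples lie over the same point. This is what makes the mixed tuples \<open>v n\<close>
    legal.\<close>
  obtain l where l: "l \<le> k" "snd (z l) > 0" using Z(6) by blast
  have q: "q (fst (z i)) = q (fst (z 0))" "q (fst (w i)) = q (fst (z 0))" if "i \<le> k" for i
  proof -
    have "fst (z l) = fst (w l)" using eq l by auto
    then have "q (fst (w 0)) = q (fst (z 0))"
      using Z(3)[OF l(1)] W(3)[OF l(1)] by simp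
    then show "q (fst (z i)) = q (fst (z 0))" "q (fst (w i)) = q (fst (z 0))"
      using Z(3)[OF that] W(3)[OF that] by simp_all
  qed
  define v where "v = (\<lambda>n i. if i < n then w i else z i)"
  have v: "v n \<in> topspace (join_tuples X q k)" for n
  proof (rule join_tuplesI)
    have "snd (v n i) = snd (z i)" if "i \<le> k" for i
      using eq that by (simp add: v_def)
    then show "(\<Sum>i\<le>k. snd (v n i)) = 1" "\<And>i. i \<le> k \<Longrightarrow> 0 \<le> snd (v n i)"
      using Z(2,4) by auto
    show "q (fst (v n i)) = q (fst (z 0))" if "i \<le> k" for i
      using q[OF that] by (simp add: v_def)
  qed (use Z(1,5) W(1,5) in \<open>auto simp: v_def extensional_def\<close>)
  have "equivclp (join_step X q k) z (v n)" if "n \<le> Suc k" for n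
    using that
  proof (induction n)
    case 0
    have "v 0 = z" by (simp add: v_def)
    then show ?case by (simp add: equivclp_def)
  next
    case (Suc n)
    have "join_step X q k (v n) (v (Suc n)) \<or> v n = v (Suc n)"
    proof (cases "snd (z n) = 0")
      case True
      moreover have n: "n \<le> k" using Suc.prems by simp
      ultimately have "snd (w n) = 0" using eq by metis
      with True have "snd (v n n) = 0" "snd (v (Suc n) n) = 0" by (simp_all add: v_def)
      moreover have "v n j = v (Suc n) j" if "j \<noteq> n" for j
        using that by (simp add: v_def less_Suc_eq)
      ultimately have "join_step X q k (v n) (v (Suc n))"
        using n v unfolding join_step_def by blast
      then show ?thesis by blast
    next
      case False
      moreover have "n \<le> k" using Suc.prems by simp
      ultimately have "fst (z n) = fst (w n)" "snd (z n) = snd (w n)" using eq by blast+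
      then have "z n = w n" by (rule prod_eqI)
      then have "v n i = v (Suc n) i" for i by (cases "i = n") (simp_all add: v_def)
      then have "v n = v (Suc n)" by blast
      then show ?thesis by blast
    qed
    moreover have "equivclp (join_step X q k) z (v n)" using Suc by simp
    ultimately show ?case
      using rtranclp.rtrancl_into_rtrancl[of "symclp (join_step X q k)" z "v n" "v (Suc n)"]
      by (auto simp: equivclp_def symclp_def)
  qed
  from this[of "Suc k"] have "equivclp (join_step X q k) z (v (Suc k))" by simp
  moreover have "v (Suc k) = w"
    using Z(5) W(5) by (fastforce simp: v_def extensional_def fun_eq_iff)
  ultimately show "equivclp (join_step X q k) z w" by simp
qed

lemma join_class_eq_iff:
  assumes "z \<in> topspace (join_tuples X q k)" "w \<in> topspace (join_tuples X q k)"
  shows "join_class X q k z = join_class X q k w \<longleftrightarrow>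
    (\<forall>i\<le>k. snd (z i) = snd (w i) \<and> (snd (z i) \<noteq> 0 \<longrightarrow> fst (z i) = fst (w i)))"
proof -
  have "join_class X q k z = join_class X q k w \<longleftrightarrow> equivclp (join_step X q k) z w"
  proof -
    have "equivclp (join_step X q k) z w \<longleftrightarrow> equivclp (join_step X q k) z = equivclp (join_step X q k) w"
      using equivp_evquivclp[of "join_step X q k"] unfolding equivp_def by blast
    then show ?thesis
      unfolding join_class_def by (metis Collect_inj)
  qed
  then show ?thesis
    using equivclp_join_step_iff[OF assms] by simp
qed

lemma join_class_self: "z \<in> join_class X q k z"
  by (simp add: join_class_def equivclp_def)

lemma in_join_class_iff:
  assumes z: "z \<in> topspace (join_tuples X q k)"
  shows "w \<in> join_class X q k z \<longleftrightarrow>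
    w \<in> topspace (join_tuples X q k) \<and> join_class X q k z = join_class X q k w"
proof -
  have "w \<in> join_class X q k z \<longleftrightarrow> equivclp (join_step X q k) z w"
    by (simp add: join_class_def)
  then show ?thesis
    using equivclp_join_step_topspace[of X q k z w] equivclp_join_step_iff[OF z, of w]
      join_class_eq_iff[OF z, of w] z by argo
qed

section \<open>The quotient map, the projection and the action on representatives\<close>

lemma topspace_quotient_topology: "topspace (quotient_topology X f) = f ` topspace X"
proof -
  have "{x \<in> topspace X. f x \<in> f ` topspace X} = topspace X" by blast
  then have "openin (quotient_topology X f) (f ` topspace X)"
    unfolding openin_quotient_topology by simp
  then have "f ` topspace X \<subseteq> topspace (quotient_topology X f)"
    by (rule openin_subset)
  moreover have "topspace (quotient_topology X f) \<subseteq> f ` topspace X"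
    using openin_topspace[of "quotient_topology X f"] unfolding openin_quotient_topology by (rule conjunct1)
  ultimately show ?thesis by (rule subset_antisym[rotated])
qed

lemma quotient_map_quotient_topology: "quotient_map X (quotient_topology X f) f"
  by (simp add: quotient_map_def openin_quotient_topology topspace_quotient_topology)

lemma quotient_map_join_class: "quotient_map (join_tuples X q k) (fib_join X q k) (join_class X q k)"
  by (simp add: fib_join_def quotient_map_quotient_topology)

lemma topspace_fib_join: "topspace (fib_join X q k) = join_class X q k ` topspace (join_tuples X q k)"
  by (simp add: fib_join_def topspace_quotient_topology)

text \<open>All representatives share an entry of positive weight, and one entry determines the
  point over which the tuple lies.\<close>

lemma join_proj_join_class:
  assumes z: "z \<in> topspace (join_tuples X q k)"
  shows "join_proj q (join_class X q k z) = q (fst (z 0))"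
proof -
  have "q (fst (w 0)) = q (fst (z 0))" if "w \<in> join_class X q k z" for w
  proof -
    have w: "w \<in> topspace (join_tuples X q k)" "join_class X q k z = join_class X q k w"
      using iffD1[OF in_join_class_iff[OF z] that] by (rule conjunct1, rule conjunct2)
    obtain i where i: "i \<le> k" "snd (z i) > 0" using join_tuplesD(6)[OF z] by blast
    have "fst (z i) = fst (w i)"
      using iffD1[OF join_class_eq_iff[OF z w(1)] w(2), rule_format, OF i(1)] i(2) by linarith
    then show ?thesis using join_tuplesD(3)[OF z i(1)] join_tuplesD(3)[OF w(1) i(1)] by simp
  qed
  then have "(\<lambda>w. q (fst (w 0))) ` join_class X q k z = {q (fst (z 0))}"
    using join_class_self[of z X q k] by fast
  then show ?thesis by (simp add: join_proj_def)
qed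

lemma join_act_join_class:
  assumes z: "z \<in> topspace (join_tuples X q k)"
    and a: "\<And>x. x \<in> topspace X \<Longrightarrow> a x \<in> topspace X" "\<And>x. x \<in> topspace X \<Longrightarrow> q (a x) = b (q x)"
  shows "(\<lambda>i\<in>{..k}. (a (fst (z i)), snd (z i))) \<in> topspace (join_tuples X q k)"
    and "join_act X a q k (join_class X q k z) = join_class X q k (\<lambda>i\<in>{..k}. (a (fst (z i)), snd (z i)))"
proof -
  have act: "(\<lambda>i\<in>{..k}. (a (fst (w i)), snd (w i))) \<in> topspace (join_tuples X q k)"
    if w: "w \<in> topspace (join_tuples X q k)" for w
  proof (rule join_tuplesI)
    show "q (fst ((\<lambda>i\<in>{..k}. (a (fst (w i)), snd (w i))) i)) = b (q (fst (w 0)))" if "i \<le> k" for i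
      using join_tuplesD(3)[OF w that] a(2)[OF join_tuplesD(1)[OF w that]] that by simp
    show "fst ((\<lambda>i\<in>{..k}. (a (fst (w i)), snd (w i))) i) \<in> topspace X" if "i \<le> k" for i
      using a(1)[OF join_tuplesD(1)[OF w that]] that by simp
    show "0 \<le> snd ((\<lambda>i\<in>{..k}. (a (fst (w i)), snd (w i))) i)" if "i \<le> k" for i
      using join_tuplesD(2)[OF w that] that by simp
  qed (use join_tuplesD(4)[OF w] in simp_all)
  show "(\<lambda>i\<in>{..k}. (a (fst (z i)), snd (z i))) \<in> topspace (join_tuples X q k)"
    by (rule act[OF z])
  have "join_class X q k (\<lambda>i\<in>{..k}. (a (fst (w i)), snd (w i)))
      = join_class X q k (\<lambda>i\<in>{..k}. (a (fst (z i)), snd (z i)))" if "w \<in> join_class X q k z" for w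
  proof -
    have w: "w \<in> topspace (join_tuples X q k)" "join_class X q k z = join_class X q k w"
      using iffD1[OF in_join_class_iff[OF z] that] by (rule conjunct1, rule conjunct2)
    show ?thesis
      using w(2) unfolding join_class_eq_iff[OF z w(1)] join_class_eq_iff[OF act[OF w(1)] act[OF z]]
      by simp
  qed
  then show "join_act X a q k (join_class X q k z) = join_class X q k (\<lambda>i\<in>{..k}. (a (fst (z i)), snd (z i)))"
    unfolding join_act_def using join_class_self[of z X q k] by blast
qed

section \<open>Partitions of unity\<close>

text \<open>The distance to \<open>C\<close> does it; the constant 1 takes its place when
  \<open>C\<close> is empty and the infimum has no meaning.\<close>

lemma metrizable_space_zero_set:
  assumes "metrizable_space X" "closedin X C"
  obtains f :: "'a \<Rightarrow> real" where "continuous_map X euclideanreal f" "\<And>x. 0 \<le> f x"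
    "\<And>x. x \<in> topspace X \<Longrightarrow> f x = 0 \<longleftrightarrow> x \<in> C"
proof (cases "C = {}")
  case True
  then show ?thesis using that[of "\<lambda>_. 1"] by simp
next
  case False
  obtain M d where "Metric_space M d" and X: "X = Metric_space.mtopology M d"
    using assms(1) unfolding metrizable_space_def by blast
  interpret Metric_space M d by fact
  have CM: "C \<subseteq> M" using closedin_subset[OF assms(2)] by (simp add: X)
  define f where "f = (\<lambda>x. INF y\<in>C. d x y)"
  have bdd: "bdd_below ((\<lambda>y. d x y) ` C)" for x
    by (rule bdd_belowI2[where m=0]) simp
  have f_le: "f x \<le> d x y" if "y \<in> C" for x y
    unfolding f_def by (rule cINF_lower[OF bdd that])
  have le_f: "a \<le> f x" if "\<And>y. y \<in> C \<Longrightarrow> a \<le> d x y" for a x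
    unfolding f_def by (rule cINF_greatest[OF False that])
  have lip: "f x \<le> d x z + f z" if "x \<in> M" "z \<in> M" for x z
  proof -
    have "f x - d x z \<le> d z y" if "y \<in> C" for y
      using f_le[OF that, of x] triangle[of x z y] \<open>x \<in> M\<close> \<open>z \<in> M\<close> that CM by fastforce
    from le_f[OF this] show ?thesis by simp
  qed
  show ?thesis
  proof (rule that[of f])
    show "continuous_map X euclideanreal f"
      unfolding X mtopology_is_euclidean[symmetric] Met_TC.continuous_map_to_metric
    proof (intro ballI allI impI)
      fix x and e :: real assume x: "x \<in> topspace mtopology" and e: "0 < e"
      have "dist (f x) (f y) < e" if "y \<in> mball x e" for y
        using lip[of x y] lip[of y x] that commute[of x y] by (auto simp: dist_real_def)
      then show "\<exists>U. openin mtopology U \<and> x \<in> U \<and> (\<forall>y\<in>U. f y \<in> Met_TC.mball (f x) e)"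
        using x e by (intro exI[of _ "mball x e"]) auto
    qed
    show "0 \<le> f x" for x by (rule le_f) simp
    fix x assume x: "x \<in> topspace X"
    show "f x = 0 \<longleftrightarrow> x \<in> C"
    proof
      assume "x \<in> C"
      then have "f x \<le> 0" using f_le[of x x] x by (simp add: X)
      then show "f x = 0" using le_f[of 0 x] by simp
    next
      assume f0: "f x = 0"
      show "x \<in> C"
      proof (rule ccontr)
        assume "x \<notin> C"
        then obtain r where r: "r > 0" "disjnt C (mball x r)"
          using assms(2) x unfolding X closedin_metric by auto
        have "r \<le> d x y" if "y \<in> C" for y
          using r(2) that CM x by (force simp: disjnt_iff X)
        from le_f[OF this] show False using f0 r by simp
      qed
    qed
  qed
qed

text \<open>On \<open>D\<close> all weights are forced to be equal. The diagonal is taken for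
  \<open>D\<close> to obtain the barycentric section, and the empty set when only a closed
  refinement of the cover is wanted. The closed sets \<open>C i\<close> arise by truncating the
  weights from below and normalising again, which preserves equality of the weights on
  \<open>D\<close>.\<close>

lemma invariant_partition_of_unity:
  fixes Y :: "'y topology"
  assumes Y: "metrizable_space Y" and b: "continuous_map Y Y b" "\<And>y. y \<in> topspace Y \<Longrightarrow> b (b y) = y"
    and U: "Z2_open_cover Y b k U"
    and D: "closedin Y D" "b ` D \<subseteq> D" "\<And>i. i \<le> k \<Longrightarrow> D \<subseteq> U i"
  obtains \<phi> :: "nat \<Rightarrow> 'y \<Rightarrow> real" and C where
    "\<And>i. i \<le> k \<Longrightarrow> continuous_map Y euclideanreal (\<phi> i)"
    "\<And>i. i \<le> k \<Longrightarrow> closedin Y (C i)" "\<And>i. i \<le> k \<Longrightarrow> C i \<subseteq> U i"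
    "\<And>i y. i \<le> k \<Longrightarrow> y \<in> topspace Y \<Longrightarrow> \<phi> i (b y) = \<phi> i y"
    "\<And>i y. i \<le> k \<Longrightarrow> y \<in> topspace Y \<Longrightarrow> 0 \<le> \<phi> i y"
    "\<And>i y. i \<le> k \<Longrightarrow> y \<in> topspace Y \<Longrightarrow> \<phi> i y \<noteq> 0 \<Longrightarrow> y \<in> C i"
    "\<And>y. y \<in> topspace Y \<Longrightarrow> (\<Sum>i\<le>k. \<phi> i y) = 1"
    "\<And>i y. i \<le> k \<Longrightarrow> y \<in> D \<Longrightarrow> \<phi> i y = 1 / real (k + 1)"
proof -
  have Uo: "openin Y (U i)" and Ub: "b ` U i \<subseteq> U i" if "i \<le> k" for i
    using U that unfolding Z2_open_cover_def by blast+
  have Ucov: "\<exists>i\<le>k. y \<in> U i" if "y \<in> topspace Y" for y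
    using U that unfolding Z2_open_cover_def by blast
  have bY: "b y \<in> topspace Y" if "y \<in> topspace Y" for y
    using b(1) that unfolding continuous_map_def by blast
  obtain fD where fD: "continuous_map Y euclideanreal fD" "\<And>y. 0 \<le> fD y"
      "\<And>y. y \<in> topspace Y \<Longrightarrow> fD y = 0 \<longleftrightarrow> y \<in> D"
    using metrizable_space_zero_set[OF Y D(1)] by blast
  have "\<exists>f :: 'y \<Rightarrow> real. continuous_map Y euclideanreal f \<and> (\<forall>y. 0 \<le> f y) \<and>
      (\<forall>y\<in>topspace Y. f y = 0 \<longleftrightarrow> y \<notin> U i)" if i: "i \<le> k" for i
  proof -
    have "closedin Y (topspace Y - U i)" using Uo[OF i] by blast
    from metrizable_space_zero_set[OF Y this] show ?thesis by (metis DiffD2 DiffI)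
  qed
  then obtain f where f: "\<And>i. i \<le> k \<Longrightarrow> continuous_map Y euclideanreal (f i)"
    "\<And>i y. i \<le> k \<Longrightarrow> 0 \<le> (f i y :: real)"
    "\<And>i y. i \<le> k \<Longrightarrow> y \<in> topspace Y \<Longrightarrow> f i y = 0 \<longleftrightarrow> y \<notin> U i"
    by metis
  text \<open>Normalised to be \<open>1\<close> on \<open>D\<close>, with unchanged zero sets.\<close>
  define h where "h = (\<lambda>i y. f i y / (f i y + fD y))"
  have den: "f i y + fD y > 0" if "i \<le> k" "y \<in> topspace Y" for i y
  proof -
    have "f i y \<noteq> 0 \<or> fD y \<noteq> 0"
      using f(3)[OF that] fD(3)[OF that(2)] D(3)[OF that(1)] by blast
    then show ?thesis using f(2)[OF that(1), of y] fD(2)[of y] by linarith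
  qed
  have hc: "continuous_map Y euclideanreal (h i)" if i: "i \<le> k" for i
    unfolding h_def
    by (rule continuous_map_real_divide[OF f(1)[OF i] continuous_map_add[OF f(1)[OF i] fD(1)]])
      (use den[OF i] in fastforce)
  have h0: "0 \<le> h i y" if "i \<le> k" for i y
    using f(2)[OF that, of y] fD(2)[of y] by (simp add: h_def)
  have hz: "h i y = 0 \<longleftrightarrow> y \<notin> U i" if "i \<le> k" "y \<in> topspace Y" for i y
    using f(3)[OF that] den[OF that] by (simp add: h_def)
  have DY: "D \<subseteq> topspace Y" using D(1) by (rule closedin_subset)
  have hD: "h i y = 1" if "i \<le> k" "y \<in> D" for i y
  proof -
    have "y \<in> topspace Y" using that DY by blast
    then have "fD y = 0" "f i y \<noteq> 0" using that fD(3) f(3)[of i y] D(3)[of i] by blast+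
    then show ?thesis by (simp add: h_def)
  qed
  \<comment> \<open>The sum over the orbit is invariant; invariance of \<open>U i\<close> keeps its
    zero set, and invariance of \<open>D\<close> keeps it constant on \<open>D\<close>, now with
    value 2.\<close>
  define F where "F = (\<lambda>i y. h i y + h i (b y))"
  have Fc: "continuous_map Y euclideanreal (F i)" if "i \<le> k" for i
    unfolding F_def by (intro continuous_map_add hc[OF that] continuous_map_comp[OF hc[OF that] b(1)])
  have F0: "0 \<le> F i y" if "i \<le> k" for i y
    using h0[OF that, of y] h0[OF that, of "b y"] by (simp add: F_def)
  have Fz: "y \<in> U i" if "i \<le> k" "y \<in> topspace Y" "F i y > 0" for i y
  proof (rule ccontr)
    assume y: "y \<notin> U i"
    then have "b y \<notin> U i" using Ub[OF that(1)] b(2)[OF that(2)] by (metis image_subset_iff)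
    then have "F i y = 0" using y hz[OF that(1,2)] hz[OF that(1) bY[OF that(2)]] by (simp add: F_def)
    then show False using that(3) by simp
  qed
  have Fpos: "F i y > 0" if "i \<le> k" "y \<in> topspace Y" "y \<in> U i" for i y
  proof -
    have "h i y \<noteq> 0" using hz that by simp
    then show ?thesis using h0[OF that(1), of y] h0[OF that(1), of "b y"] by (simp add: F_def)
  qed
  have Fb: "F i (b y) = F i y" if "y \<in> topspace Y" for i y
    using b(2)[OF that] by (simp add: F_def add.commute)
  have FD: "F i y = 2" if "i \<le> k" "y \<in> D" for i y
    using hD[OF that] hD[OF that(1), of "b y"] that(2) D(2) by (auto simp: F_def)
  define S where "S = (\<lambda>y. \<Sum>i\<le>k. F i y)"
  have Sc: "continuous_map Y euclideanreal S"
    unfolding S_def by (rule continuous_map_sum) (auto intro: Fc)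
  have Spos: "S y > 0" if "y \<in> topspace Y" for y
  proof -
    obtain i where "i \<le> k" "y \<in> U i" using Ucov[OF \<open>y \<in> topspace Y\<close>] by blast
    then show ?thesis
      unfolding S_def using F0 Fpos[OF _ \<open>y \<in> topspace Y\<close>] by (intro sum_pos2[of _ i]) auto
  qed
  define N where "N = real (k + 1)"
  have N: "N > 0" by (simp add: N_def)
  define G where "G = (\<lambda>i y. F i y / S y)"
  have Gc: "continuous_map Y euclideanreal (G i)" if "i \<le> k" for i
    unfolding G_def by (rule continuous_map_real_divide[OF Fc[OF that] Sc]) (use Spos in fastforce)
  have Gsum: "(\<Sum>i\<le>k. G i y) = 1" if "y \<in> topspace Y" for y
    using Spos[OF that] by (simp add: G_def S_def flip: sum_divide_distrib)
  \<comment> \<open>The \<open>N = k + 1\<close> values of \<open>G\<close> add up to 1, so one of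
    them is at least \<open>1 / N\<close> and survives the truncation at half that height.
    Conversely, \<psi> is nonzero only where \<open>G\<close> exceeds \<open>1 / (2 * N)\<close>,
    hence inside a closed subset of \<open>U i\<close>.\<close>
  define \<psi> where "\<psi> = (\<lambda>i y. max 0 (G i y - 1 / (2 * N)))"
  have \<psi>c: "continuous_map Y euclideanreal (\<psi> i)" if "i \<le> k" for i
    unfolding \<psi>_def by (intro continuous_map_real_max continuous_map_diff Gc[OF that]) auto
  define T where "T = (\<lambda>y. \<Sum>i\<le>k. \<psi> i y)"
  have Tc: "continuous_map Y euclideanreal T"
    unfolding T_def by (rule continuous_map_sum) (auto intro: \<psi>c)
  have Tpos: "T y > 0" if "y \<in> topspace Y" for y
  proof -
    have "\<exists>i\<le>k. G i y \<ge> 1 / N"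
    proof (rule ccontr)
      assume "\<not> ?thesis"
      then have "G i y < 1 / N" if "i \<in> {..k}" for i
        using that by (meson atMost_iff not_le)
      then have "(\<Sum>i\<le>k. G i y) < (\<Sum>i\<le>k. 1 / N)"
        by (intro sum_strict_mono) auto
      then show False using Gsum[OF that] by (simp add: N_def)
    qed
    then obtain i where i: "i \<le> k" "G i y \<ge> 1 / N" by blast
    have "1 / (2 * N) < 1 / N" using N by (simp add: field_simps)
    then have "\<psi> i y > 0" using i(2) by (simp add: \<psi>_def)
    then show ?thesis
      unfolding T_def using i(1) by (intro sum_pos2[of _ i]) (auto simp: \<psi>_def)
  qed
  define C where "C = (\<lambda>i. {y \<in> topspace Y. G i y \<in> {1 / (2 * N)..}})"
  show ?thesis
  proof (rule that[of "\<lambda>i y. \<psi> i y / T y" C])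
    fix i assume i: "i \<le> k"
    show "continuous_map Y euclideanreal (\<lambda>y. \<psi> i y / T y)"
      by (rule continuous_map_real_divide[OF \<psi>c[OF i] Tc]) (use Tpos in fastforce)
    show "closedin Y (C i)"
      unfolding C_def by (rule closedin_continuous_map_preimage[OF Gc[OF i]]) simp
    show "C i \<subseteq> U i"
    proof
      fix y assume "y \<in> C i"
      then have y: "y \<in> topspace Y" "G i y \<ge> 1 / (2 * N)" by (auto simp: C_def)
      moreover have "1 / (2 * N) > 0" using N by simp
      ultimately have "G i y > 0" by linarith
      then have "F i y > 0" using Spos[OF y(1)] by (simp add: G_def zero_less_divide_iff)
      then show "y \<in> U i" by (rule Fz[OF i y(1)])
    qed
    show "\<psi> i y / T y = 1 / real (k + 1)" if "y \<in> D" for y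
    proof -
      have y: "y \<in> topspace Y" using that DY by blast
      have "S y = 2 * N" using FD that by (simp add: S_def N_def)
      then have G: "G j y = 1 / N" if "j \<le> k" for j
        using FD[OF that \<open>y \<in> D\<close>] by (simp add: G_def)
      have "1 / N - 1 / (2 * N) = 1 / (2 * N)" "1 / (2 * N) > 0" using N by (auto simp: field_simps)
      then have \<psi>: "\<psi> j y = 1 / (2 * N)" if "j \<le> k" for j
        using G[OF that] by (simp add: \<psi>_def)
      then have "T y = N * (1 / (2 * N))" by (simp add: T_def N_def)
      then have "T y = 1 / 2" using N by simp
      then have "\<psi> i y / T y = (1 / (2 * N)) / (1 / 2)" using \<psi>[OF i] by (simp only:)
      also have "\<dots> = 1 / N" by simp
      finally show ?thesis by (simp only: N_def)
    qed
    fix y assume y: "y \<in> topspace Y"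
    have "G j (b y) = G j y" for j
      using Fb[OF y] by (simp add: G_def S_def)
    then show "\<psi> i (b y) / T (b y) = \<psi> i y / T y"
      by (simp add: \<psi>_def T_def)
    show "0 \<le> \<psi> i y / T y" using Tpos[OF y] by (simp add: \<psi>_def)
    show "y \<in> C i" if "\<psi> i y / T y \<noteq> 0"
    proof -
      have "\<psi> i y \<noteq> 0" using that by auto
      then have "G i y - 1 / (2 * N) > 0" unfolding \<psi>_def by linarith
      then show ?thesis using y by (simp add: C_def)
    qed
  next
    fix y assume y: "y \<in> topspace Y"
    show "(\<Sum>i\<le>k. \<psi> i y / T y) = 1"
      using Tpos[OF y] by (simp add: T_def flip: sum_divide_distrib)
  qed
qed

section \<open>Sections of the fibred join\<close>

lemma Z2_section_onD:
  assumes "Z2_section_on X a Y b q U s"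
  shows "continuous_map (subtopology Y U) X s"
    and "y \<in> topspace Y \<Longrightarrow> y \<in> U \<Longrightarrow> s y \<in> topspace X"
    and "y \<in> topspace Y \<Longrightarrow> y \<in> U \<Longrightarrow> s (b y) = a (s y)"
    and "y \<in> topspace Y \<Longrightarrow> y \<in> U \<Longrightarrow> q (s y) = y"
proof -
  show c: "continuous_map (subtopology Y U) X s"
    using assms unfolding Z2_section_on_def Z2_map_def by blast
  show "y \<in> topspace Y \<Longrightarrow> y \<in> U \<Longrightarrow> s y \<in> topspace X"
    using c unfolding continuous_map_def by auto
  show "y \<in> topspace Y \<Longrightarrow> y \<in> U \<Longrightarrow> s (b y) = a (s y)"
    using assms unfolding Z2_section_on_def Z2_map_def topspace_subtopology by blast
  show "y \<in> topspace Y \<Longrightarrow> y \<in> U \<Longrightarrow> q (s y) = y"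
    using assms unfolding Z2_section_on_def by blast
qed

text \<open>No continuous global tuple is at hand, because \<open>s i\<close> is defined only on
  \<open>U i\<close>. The local tuples differ only in entries of weight 0, which the join forgets,
  so their classes glue. Where all weights are nonzero there are no filler entries, and the class
  has the explicit form of the second conclusion.\<close>

lemma join_section_of_cover:
  fixes X :: "'x topology" and Y :: "'y topology" and \<phi> :: "nat \<Rightarrow> 'y \<Rightarrow> real"
  assumes b: "continuous_map Y Y b" and U: "Z2_open_cover Y b k U"
    and s: "\<And>i. i \<le> k \<Longrightarrow> Z2_section_on X a Y b q (U i) (s i)"
    and a: "\<And>x. x \<in> topspace X \<Longrightarrow> a x \<in> topspace X" "\<And>x. x \<in> topspace X \<Longrightarrow> q (a x) = b (q x)"
    and \<phi>c: "\<And>i. i \<le> k \<Longrightarrow> continuous_map Y euclideanreal (\<phi> i)"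
    and C: "\<And>i. i \<le> k \<Longrightarrow> closedin Y (C i)" "\<And>i. i \<le> k \<Longrightarrow> C i \<subseteq> U i"
    and \<phi>b: "\<And>i y. i \<le> k \<Longrightarrow> y \<in> topspace Y \<Longrightarrow> \<phi> i (b y) = \<phi> i y"
    and \<phi>0: "\<And>i y. i \<le> k \<Longrightarrow> y \<in> topspace Y \<Longrightarrow> 0 \<le> \<phi> i y"
    and \<phi>C: "\<And>i y. i \<le> k \<Longrightarrow> y \<in> topspace Y \<Longrightarrow> \<phi> i y \<noteq> 0 \<Longrightarrow> y \<in> C i"
    and \<phi>1: "\<And>y. y \<in> topspace Y \<Longrightarrow> (\<Sum>i\<le>k. \<phi> i y) = 1"
  obtains \<sigma> where
    "Z2_section_on (fib_join X q k) (join_act X a q k) Y b (join_proj q) (topspace Y) \<sigma>"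
    "\<And>y. y \<in> topspace Y \<Longrightarrow> \<forall>i\<le>k. \<phi> i y \<noteq> 0 \<Longrightarrow>
       \<sigma> y = join_class X q k (\<lambda>i\<in>{..k}. (s i y, \<phi> i y))"
proof -
  have Uo: "openin Y (U i)" if "i \<le> k" for i
    using U that unfolding Z2_open_cover_def by blast
  have bY: "b y \<in> topspace Y" if "y \<in> topspace Y" for y
    using b that unfolding continuous_map_def by blast
  have "\<exists>i\<le>k. y \<in> C i" if y: "y \<in> topspace Y" for y
  proof (rule ccontr)
    assume "\<not> ?thesis"
    then have "\<phi> i y = 0" if "i \<le> k" for i using \<phi>C[OF that y] that by blast
    then have "(\<Sum>i\<le>k. \<phi> i y) = 0" by simp
    then show False using \<phi>1[OF y] by simp
  qed
  then obtain j where j: "\<And>y. y \<in> topspace Y \<Longrightarrow> j y \<le> k" "\<And>y. y \<in> topspace Y \<Longrightarrow> y \<in> C (j y)"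
    by metis
  text \<open>Near \<open>x\<close> only the sections \<open>s i\<close> with \<open>x \<in> C i\<close> are defined and matter. The other entries
    have weight \<open>0\<close> there and are filled with a section that is defined near \<open>x\<close>.\<close>
  define l where "l = (\<lambda>x i. if x \<in> C i then i else j x)"
  define z where "z = (\<lambda>x y. \<lambda>i\<in>{..k}. (s (l x i) y, \<phi> i y))"
  define N where "N = (\<lambda>x. \<Inter>i\<in>{..k}. if x \<in> C i then U i else topspace Y - C i)"
  have lk: "l x i \<le> k" "x \<in> C (l x i)" if "x \<in> topspace Y" "i \<le> k" for x i
    using j[OF that(1)] that(2) by (auto simp: l_def)
  have N: "openin Y (N x)" for x
    unfolding N_def using Uo C(1) by (intro openin_INT2) auto
  have Nx: "x \<in> N x" if "x \<in> topspace Y" for x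
    using C(2) that by (auto simp: N_def)
  have NU: "y \<in> U (l x i)" if "x \<in> topspace Y" "i \<le> k" "y \<in> N x" for x i y
  proof -
    have "y \<in> (if x \<in> C (l x i) then U (l x i) else topspace Y - C (l x i))"
      using that(3) lk(1)[OF that(1,2)] unfolding N_def by blast
    then show ?thesis using lk(2)[OF that(1,2)] by simp
  qed
  have Nl: "l x i = i" if "i \<le> k" "y \<in> N x" "y \<in> topspace Y" "\<phi> i y \<noteq> 0" for x i y
  proof -
    have "y \<in> (if x \<in> C i then U i else topspace Y - C i)"
      using that(1,2) unfolding N_def by blast
    then have "x \<in> C i" using \<phi>C[OF that(1,3,4)] by (auto split: if_splits)
    then show ?thesis by (simp add: l_def)
  qed
  have NY: "y \<in> topspace Y" if "y \<in> N x" for x y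
    using openin_subset[OF N] that by blast
  have ztop: "z x y \<in> topspace (join_tuples X q k)" if x: "x \<in> topspace Y" and y: "y \<in> N x" for x y
  proof (rule join_tuplesI)
    fix i assume i: "i \<le> k"
    note S = Z2_section_onD[OF s[OF lk(1)[OF x i]]]
    show "fst (z x y i) \<in> topspace X"
      using S(2)[OF NY[OF y] NU[OF x i y]] i by (simp add: z_def)
    show "q (fst (z x y i)) = y"
      using S(4)[OF NY[OF y] NU[OF x i y]] i by (simp add: z_def)
    show "0 \<le> snd (z x y i)"
      using \<phi>0[OF i NY[OF y]] i by (simp add: z_def)
  qed (use \<phi>1[OF NY[OF y]] in \<open>simp_all add: z_def\<close>)
  \<comment> \<open>A nonzero weight at \<open>y\<close> forces the index to be the true one in both
    tuples; fillers occur only at weight 0.\<close>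
  have zclass: "join_class X q k (z x y) = join_class X q k (z x' y)"
    if "x \<in> topspace Y" "x' \<in> topspace Y" "y \<in> N x" "y \<in> N x'" for x x' y
    unfolding join_class_eq_iff[OF ztop[OF that(1,3)] ztop[OF that(2,4)]]
  proof (intro allI impI conjI)
    fix i assume i: "i \<le> k"
    show "snd (z x y i) = snd (z x' y i)" using i by (simp add: z_def)
    assume "snd (z x y i) \<noteq> 0"
    then have "\<phi> i y \<noteq> 0" using i by (simp add: z_def)
    then have "l x i = i" "l x' i = i" using Nl[OF i] that(3,4) NY by blast+
    then show "fst (z x y i) = fst (z x' y i)" using i by (simp add: z_def)
  qed
  have zc: "continuous_map (subtopology Y (N x)) (join_tuples X q k) (z x)" if x: "x \<in> topspace Y" for x
    unfolding join_tuples_def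
  proof (rule continuous_map_into_subtopology)
    show "continuous_map (subtopology Y (N x)) (product_topology (\<lambda>i. prod_topology X unit_interval) {..k}) (z x)"
      unfolding continuous_map_componentwise
    proof (intro conjI ballI)
      show "z x ` topspace (subtopology Y (N x)) \<subseteq> extensional {..k}"
        by (auto simp: z_def)
      fix i assume "i \<in> {..k}"
      then have i: "i \<le> k" by simp
      have 1: "continuous_map (subtopology Y (N x)) X (s (l x i))"
        using NU[OF x i]
        by (intro continuous_map_from_subtopology_mono[OF Z2_section_onD(1)[OF s[OF lk(1)[OF x i]]]]) blast
      have "snd (z x y i) \<in> {0..1}" if "y \<in> N x" for y
        by (rule join_tuplesD(2)[OF ztop[OF x that] i])
      then have "continuous_map (subtopology Y (N x)) unit_interval (\<phi> i)"
        using i by (intro continuous_map_into_subtopology continuous_map_from_subtopology[OF \<phi>c[OF i]])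
          (auto simp: z_def)
      from continuous_map_pairedI[OF 1 this]
      show "continuous_map (subtopology Y (N x)) (prod_topology X unit_interval) (\<lambda>y. z x y i)"
        using i by (simp add: z_def)
    qed
    show "z x \<in> topspace (subtopology Y (N x)) \<rightarrow>
        {z. (\<forall>i\<le>k. \<forall>j\<le>k. q (fst (z i)) = q (fst (z j))) \<and> (\<Sum>i\<le>k. snd (z i)) = 1}"
    proof (rule funcsetI, rule CollectI)
      fix y assume "y \<in> topspace (subtopology Y (N x))"
      then have "y \<in> N x" by simp
      from ztop[OF x this]
      show "(\<forall>i\<le>k. \<forall>j\<le>k. q (fst (z x y i)) = q (fst (z x y j))) \<and> (\<Sum>i\<le>k. snd (z x y i)) = 1"
        unfolding topspace_join_tuples by (rule conjunct2)
    qed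
  qed
  define \<sigma> where "\<sigma> = (\<lambda>y. join_class X q k (z y y))"
  have \<sigma>c: "continuous_map Y (fib_join X q k) \<sigma>"
  proof (rule pasting_lemma[where I="topspace Y" and T=N and f="\<lambda>x y. join_class X q k (z x y)"])
    fix x assume x: "x \<in> topspace Y"
    show "openin Y (N x)" by (rule N)
    show "continuous_map (subtopology Y (N x)) (fib_join X q k) (\<lambda>y. join_class X q k (z x y))"
      by (rule continuous_map_comp[OF quotient_imp_continuous_map[OF quotient_map_join_class] zc[OF x]])
  next
    fix x x' y assume "x \<in> topspace Y" "x' \<in> topspace Y" "y \<in> topspace Y \<inter> N x \<inter> N x'"
    then show "join_class X q k (z x y) = join_class X q k (z x' y)"
      by (intro zclass) auto
  next
    fix y assume "y \<in> topspace Y"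
    then show "\<exists>x. x \<in> topspace Y \<and> y \<in> N x \<and> \<sigma> y = join_class X q k (z x y)"
      using Nx unfolding \<sigma>_def by blast
  qed
  show ?thesis
  proof (rule that[of \<sigma>])
    show "Z2_section_on (fib_join X q k) (join_act X a q k) Y b (join_proj q) (topspace Y) \<sigma>"
      unfolding Z2_section_on_def Z2_map_def subtopology_topspace Int_absorb
    proof (intro conjI ballI \<sigma>c)
      fix y assume y: "y \<in> topspace Y"
      note zy = ztop[OF y Nx[OF y]] and zb = ztop[OF bY[OF y] Nx[OF bY[OF y]]]
      have J: "(\<lambda>i\<in>{..k}. (a (fst (z y y i)), snd (z y y i))) \<in> topspace (join_tuples X q k)"
        "join_act X a q k (join_class X q k (z y y)) =
          join_class X q k (\<lambda>i\<in>{..k}. (a (fst (z y y i)), snd (z y y i)))"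
        using join_act_join_class[where a=a and b=b and q=q, OF zy] a by blast+
      show "\<sigma> (b y) = join_act X a q k (\<sigma> y)"
        unfolding \<sigma>_def J(2) join_class_eq_iff[OF zb J(1)]
      proof (intro allI impI conjI)
        fix i assume i: "i \<le> k"
        show "snd (z (b y) (b y) i) = snd ((\<lambda>i\<in>{..k}. (a (fst (z y y i)), snd (z y y i))) i)"
          using i \<phi>b[OF i y] by (simp add: z_def)
        assume "snd (z (b y) (b y) i) \<noteq> 0"
        then have nz: "\<phi> i (b y) \<noteq> 0" "\<phi> i y \<noteq> 0" using i \<phi>b[OF i y] by (simp_all add: z_def)
        have "l (b y) i = i" "l y i = i"
          by (rule Nl[OF i Nx[OF bY[OF y]] bY[OF y] nz(1)], rule Nl[OF i Nx[OF y] y nz(2)])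
        moreover have "y \<in> U i" using \<phi>C[OF i y nz(2)] C(2)[OF i] by blast
        ultimately show "fst (z (b y) (b y) i) = fst ((\<lambda>i\<in>{..k}. (a (fst (z y y i)), snd (z y y i))) i)"
          using i Z2_section_onD(3)[OF s[OF i] y] by (simp add: z_def)
      qed
      have "q (fst (z y y 0)) = y"
        using Z2_section_onD(4)[OF s[OF lk(1)[OF y le0]] y NU[OF y le0 Nx[OF y]]] by (simp add: z_def)
      then show "join_proj q (\<sigma> y) = y"
        unfolding \<sigma>_def join_proj_join_class[OF zy] .
    qed
    fix y assume y: "y \<in> topspace Y" and nz: "\<forall>i\<le>k. \<phi> i y \<noteq> 0"
    have "l y i = i" if "i \<le> k" for i
      by (rule Nl[OF that Nx[OF y] y nz[rule_format, OF that]])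
    then have "z y y = (\<lambda>i\<in>{..k}. (s i y, \<phi> i y))"
      unfolding z_def by (intro restrict_ext) simp
    then show "\<sigma> y = join_class X q k (\<lambda>i\<in>{..k}. (s i y, \<phi> i y))"
      by (simp add: \<sigma>_def)
  qed
qed

text \<open>The weights are functions on the join, and the \<open>i\<close>-th entry is one where
  its weight is positive. Pulling these open sets and entries back along \<sigma> gives the cover
  and its sections. They cover since the weights add up to 1, and they are equivariant since the
  action leaves the weights alone.\<close>

lemma cover_of_join_section:
  fixes X :: "'x topology" and Y :: "'y topology"
  assumes b: "continuous_map Y Y b"
    and a: "\<And>x. x \<in> topspace X \<Longrightarrow> a x \<in> topspace X" "\<And>x. x \<in> topspace X \<Longrightarrow> q (a x) = b (q x)"
    and \<sigma>: "Z2_section_on (fib_join X q k) (join_act X a q k) Y b (join_proj q) (topspace Y) \<sigma>"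
  obtains U s where "Z2_open_cover Y b k U" "\<And>i. i \<le> k \<Longrightarrow> Z2_section_on X a Y b q (U i) (s i)"
proof -
  let ?T = "join_tuples X q k" and ?J = "fib_join X q k" and ?c = "join_class X q k"
  have bY: "b y \<in> topspace Y" if "y \<in> topspace Y" for y
    using b that unfolding continuous_map_def by blast
  have \<sigma>c: "continuous_map Y ?J \<sigma>"
    using Z2_section_onD(1)[OF \<sigma>] by simp
  have \<sigma>J: "\<sigma> y \<in> ?c ` topspace ?T" if "y \<in> topspace Y" for y
    using Z2_section_onD(2)[OF \<sigma> that that] by (simp add: topspace_fib_join)
  \<comment> \<open>An arbitrary, in general discontinuous choice of representatives. Only weights
    and entries of nonzero weight are read off, and these do not depend on the choice.\<close>
  define r where "r = (\<lambda>c. SOME z. z \<in> topspace ?T \<and> c = ?c z)"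
  have r: "r c \<in> topspace ?T \<and> c = ?c (r c)" if "c \<in> ?c ` topspace ?T" for c
  proof -
    have "\<exists>z. z \<in> topspace ?T \<and> c = ?c z" using that by blast
    then show ?thesis unfolding r_def by (rule someI_ex)
  qed
  have rz: "snd (r (?c z) i) = snd (z i)" "snd (z i) \<noteq> 0 \<Longrightarrow> fst (r (?c z) i) = fst (z i)"
    if "z \<in> topspace ?T" "i \<le> k" for z i
  proof -
    have "?c z \<in> ?c ` topspace ?T" using that by blast
    from r[OF this] have R: "r (?c z) \<in> topspace ?T" "?c z = ?c (r (?c z))" by blast+
    note E = iffD1[OF join_class_eq_iff[OF that(1) R(1)] R(2), rule_format, OF that(2)]
    show "snd (r (?c z) i) = snd (z i)" using E by argo
    show "fst (r (?c z) i) = fst (z i)" if "snd (z i) \<noteq> 0" using E that by argo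
  qed
  have coord: "continuous_map ?T (prod_topology X unit_interval) (\<lambda>z. z i)" if "i \<le> k" for i
    unfolding join_tuples_def
    by (rule continuous_map_from_subtopology[OF continuous_map_product_coordinates]) (use that in simp)
  have tc: "continuous_map ?J euclideanreal (\<lambda>c. snd (r c i))" if i: "i \<le> k" for i
  proof (rule continuous_compose_quotient_map[OF quotient_map_join_class])
    have "continuous_map ?T euclideanreal (\<lambda>z. snd (z i))"
      by (rule continuous_map_comp[OF continuous_map_snd_unit_interval coord[OF i]])
    then show "continuous_map ?T euclideanreal ((\<lambda>c. snd (r c i)) \<circ> ?c)"
      by (rule continuous_map_eq) (use rz(1)[OF _ i] in simp)
  qed
  define W where "W = (\<lambda>i. {c \<in> topspace ?J. snd (r c i) \<in> {0<..}})"
  have W: "openin ?J (W i)" if "i \<le> k" for i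
    unfolding W_def by (rule openin_continuous_map_preimage[OF tc[OF that]]) simp
  have xc: "continuous_map (subtopology ?J (W i)) X (\<lambda>c. fst (r c i))" if i: "i \<le> k" for i
  proof (rule continuous_compose_quotient_map)
    \<comment> \<open>A quotient map restricts to a quotient map over an open set; so continuity of
      the entry can be tested on tuples, where it is a coordinate.\<close>
    show "quotient_map (subtopology ?T {z \<in> topspace ?T. ?c z \<in> W i}) (subtopology ?J (W i)) ?c"
      by (rule quotient_map_restriction[OF quotient_map_join_class refl]) (use W[OF i] in blast)
    have "continuous_map (subtopology ?T {z \<in> topspace ?T. ?c z \<in> W i}) X (\<lambda>z. fst (z i))"
      by (rule continuous_map_from_subtopology[OF continuous_map_comp[OF continuous_map_fst coord[OF i]]])
    then show "continuous_map (subtopology ?T {z \<in> topspace ?T. ?c z \<in> W i}) X ((\<lambda>c. fst (r c i)) \<circ> ?c)"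
    proof (rule continuous_map_eq)
      fix z assume "z \<in> topspace (subtopology ?T {z \<in> topspace ?T. ?c z \<in> W i})"
      then have z: "z \<in> topspace ?T" and "snd (r (?c z) i) > 0" by (auto simp: W_def)
      then have "snd (z i) \<noteq> 0" using rz(1)[OF z i] by simp
      from rz(2)[OF z i this] show "fst (z i) = ((\<lambda>c. fst (r c i)) \<circ> ?c) z" by simp
    qed
  qed
  define U where "U = (\<lambda>i. {y \<in> topspace Y. \<sigma> y \<in> W i})"
  have U_iff: "y \<in> U i \<longleftrightarrow> y \<in> topspace Y \<and> snd (r (\<sigma> y) i) > 0" for y i
    using \<sigma>J by (auto simp: U_def W_def topspace_fib_join)
  have R: "r (\<sigma> y) \<in> topspace ?T" "?c (r (\<sigma> y)) = \<sigma> y" if "y \<in> topspace Y" for y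
    using r[OF \<sigma>J[OF that]] by (blast, metis)
  have act: "snd (r (\<sigma> (b y)) i) = snd (r (\<sigma> y) i)"
      "snd (r (\<sigma> y) i) \<noteq> 0 \<Longrightarrow> fst (r (\<sigma> (b y)) i) = a (fst (r (\<sigma> y) i))"
    if y: "y \<in> topspace Y" and i: "i \<le> k" for y i
  proof -
    have J: "(\<lambda>i\<in>{..k}. (a (fst (r (\<sigma> y) i)), snd (r (\<sigma> y) i))) \<in> topspace ?T"
      "join_act X a q k (?c (r (\<sigma> y))) = ?c (\<lambda>i\<in>{..k}. (a (fst (r (\<sigma> y) i)), snd (r (\<sigma> y) i)))"
      using join_act_join_class[where a=a and b=b and q=q, OF R(1)[OF y]] a by blast+
    have e: "\<sigma> (b y) = ?c (\<lambda>i\<in>{..k}. (a (fst (r (\<sigma> y) i)), snd (r (\<sigma> y) i)))"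
      using Z2_section_onD(3)[OF \<sigma> y y] J(2) R(2)[OF y] by simp
    show "snd (r (\<sigma> (b y)) i) = snd (r (\<sigma> y) i)"
      unfolding e rz(1)[OF J(1) i] using i by simp
    show "fst (r (\<sigma> (b y)) i) = a (fst (r (\<sigma> y) i))" if "snd (r (\<sigma> y) i) \<noteq> 0"
    proof -
      have "snd ((\<lambda>i\<in>{..k}. (a (fst (r (\<sigma> y) i)), snd (r (\<sigma> y) i))) i) \<noteq> 0"
        using that i by simp
      then have "fst (r (\<sigma> (b y)) i) = fst ((\<lambda>i\<in>{..k}. (a (fst (r (\<sigma> y) i)), snd (r (\<sigma> y) i))) i)"
        unfolding e by (rule rz(2)[OF J(1) i])
      then show ?thesis using i by simp
    qed
  qed
  show ?thesis
  proof (rule that[of U "\<lambda>i y. fst (r (\<sigma> y) i)"])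
    show "Z2_open_cover Y b k U"
      unfolding Z2_open_cover_def
    proof (intro conjI allI impI subsetI)
      fix i assume i: "i \<le> k"
      show "openin Y (U i)"
        unfolding U_def by (rule openin_continuous_map_preimage[OF \<sigma>c W[OF i]])
      fix y assume "y \<in> b ` U i"
      then show "y \<in> U i" using act(1)[OF _ i] bY by (auto simp: U_iff)
    next
      fix y assume y: "y \<in> topspace Y"
      then show "y \<in> (\<Union>i\<le>k. U i)"
        using join_tuplesD(6)[OF R(1)[OF y]] by (auto simp: U_iff)
    qed
    fix i assume i: "i \<le> k"
    show "Z2_section_on X a Y b q (U i) (\<lambda>y. fst (r (\<sigma> y) i))"
      unfolding Z2_section_on_def Z2_map_def
    proof (intro conjI ballI)
      have "continuous_map (subtopology Y (U i)) (subtopology ?J (W i)) \<sigma>"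
        by (intro continuous_map_into_subtopology continuous_map_from_subtopology \<sigma>c) (auto simp: U_def)
      from continuous_map_comp[OF xc[OF i] this]
      show "continuous_map (subtopology Y (U i)) X (\<lambda>y. fst (r (\<sigma> y) i))" .
    next
      fix y assume "y \<in> topspace (subtopology Y (U i))"
      then have "y \<in> topspace Y" "snd (r (\<sigma> y) i) \<noteq> 0" by (auto simp: U_iff)
      then show "fst (r (\<sigma> (b y)) i) = a (fst (r (\<sigma> y) i))" by (rule act(2)[OF _ i])
    next
      fix y assume "y \<in> topspace Y \<inter> U i"
      then have y: "y \<in> topspace Y" by simp
      have "q (fst (r (\<sigma> y) i)) = join_proj q (?c (r (\<sigma> y)))"
        unfolding join_proj_join_class[OF R(1)[OF y]] by (rule join_tuplesD(3)[OF R(1)[OF y] i])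
      also have "\<dots> = y"
        unfolding R(2)[OF y] by (rule Z2_section_onD(4)[OF \<sigma> y y])
      finally show "q (fst (r (\<sigma> y) i)) = y" .
    qed
  qed
qed

section \<open>The equivalences\<close>

lemma Inf_enat_le_iff: "Inf {enat k | k. P k} \<le> enat n \<longleftrightarrow> (\<exists>k\<le>n. P k)"
proof
  assume le: "Inf {enat k | k. P k} \<le> enat n"
  show "\<exists>k\<le>n. P k"
  proof (rule ccontr)
    assume none: "\<not> (\<exists>k\<le>n. P k)"
    have "enat (Suc n) \<le> Inf {enat k | k. P k}"
    proof (rule Inf_greatest)
      fix x assume "x \<in> {enat k | k. P k}"
      then obtain j where "x = enat j" "P j" by blast
      then show "enat (Suc n) \<le> x" using none by (simp add: Suc_le_eq) (meson not_le)
    qed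
    from order_trans[OF this le] show False by simp
  qed
next
  assume "\<exists>k\<le>n. P k"
  then show "Inf {enat k | k. P k} \<le> enat n"
    by (auto intro!: Inf_lower2)
qed

lemma Z2_section_on_subset:
  assumes "Z2_section_on X a Y b q U s" "V \<subseteq> U"
  shows "Z2_section_on X a Y b q V s"
proof -
  have "continuous_map (subtopology Y V) X s"
    by (rule continuous_map_from_subtopology_mono[OF Z2_section_onD(1)[OF assms(1)] assms(2)])
  then show ?thesis
    using assms unfolding Z2_section_on_def Z2_map_def topspace_subtopology by blast
qed

lemma Z2_homotopic_of_section:
  assumes s: "Z2_section_on X a Y b q U s" and b: "\<And>y. y \<in> topspace Y \<Longrightarrow> b y \<in> topspace Y" "b ` U \<subseteq> U"
  shows "Z2_map (subtopology Y U) b X a s" "Z2_homotopic (subtopology Y U) b Y b (q \<circ> s) id"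
proof -
  show "Z2_map (subtopology Y U) b X a s"
    using s unfolding Z2_section_on_def by blast
  have qs: "(q \<circ> s) y = id y" if "y \<in> topspace (subtopology Y U)" for y
    using Z2_section_onD(4)[OF s, of y] that by simp
  have bU: "b y \<in> topspace (subtopology Y U)" if "y \<in> topspace (subtopology Y U)" for y
    using b that by auto
  show "Z2_homotopic (subtopology Y U) b Y b (q \<circ> s) id"
    unfolding Z2_homotopic_def
  proof (rule homotopic_with_equal)
    show "\<forall>y\<in>topspace (subtopology Y U). (q \<circ> s) (b y) = b ((q \<circ> s) y)"
      using qs bU by (metis id_apply)
    show "continuous_map (subtopology Y U) Y (q \<circ> s)"
      using continuous_map_from_subtopology[OF continuous_map_id] by (rule continuous_map_eq) (use qs in metis)
  qed (use qs in auto)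
qed

lemma rev_path_fib_paths:
  assumes "\<gamma> \<in> topspace (fib_paths E p)"
  shows "rev_path \<gamma> \<in> topspace (fib_paths E p)" "endpoints (rev_path \<gamma>) = prod.swap (endpoints \<gamma>)"
proof -
  have \<gamma>: "continuous_map unit_interval E \<gamma>" "\<exists>b. \<forall>t\<in>{0..1}. p (\<gamma> t) = b"
    using assms unfolding topspace_fib_paths by blast+
  have "continuous_map unit_interval unit_interval (\<lambda>t. 1 - t)"
    by (auto simp: continuous_map_in_subtopology intro!: continuous_intros)
  from continuous_map_comp[OF \<gamma>(1) this] have "continuous_map unit_interval E (rev_path \<gamma>)"
    by (rule continuous_map_eq) (simp add: rev_path_def)
  moreover have "\<exists>b. \<forall>t\<in>{0..1}. p (rev_path \<gamma> t) = b"
    using \<gamma>(2) by (force simp: rev_path_def)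
  moreover have "rev_path \<gamma> \<in> extensional {0..1}"
    by (simp add: rev_path_def)
  ultimately show "rev_path \<gamma> \<in> topspace (fib_paths E p)"
    unfolding topspace_fib_paths by blast
  show "endpoints (rev_path \<gamma>) = prod.swap (endpoints \<gamma>)"
    by (simp add: endpoints_def rev_path_def)
qed

lemma closedin_diag:
  assumes "Hausdorff_space E"
  shows "closedin (fib_square E p) (diag E)"
proof -
  have "closedin (prod_topology E E) (diag E)"
    using assms unfolding diag_def by (simp add: Hausdorff_space_closedin_diagonal)
  moreover have "diag E \<subseteq> topspace (fib_square E p)"
    by (auto simp: diag_def topspace_fib_square)
  ultimately show ?thesis
    unfolding fib_square_def by (intro closedin_subset_topspace) auto
qed

text \<open>The first four conditions are proved equivalent for each fixed number of sets, in the
  cycle \<open>M\<close>, \<open>FH\<close>, \<open>DM\<close>, \<open>Sig\<close>,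
  \<open>M\<close>, whose last arrow carries the weight. The join conditions are attached by going
  from \<open>M n\<close> with \<open>n \<le> k\<close> to the section with prescribed values, hence
  to any section, and from there to \<open>Sig k\<close>.\<close>

theorem theorem5p5:
  fixes E :: "'e topology" and B :: "'b topology" and p :: "'e \<Rightarrow> 'b"
    and S :: "'n::euclidean_space set" and k :: nat
  assumes fibration: "Hurewicz_fibration E B p" "locally_trivial E B p"
    and E_ENR: "ENR S" "E homeomorphic_space top_of_set S"
    and B_ANR: "ANR_metrizable B" "separable_space B"
  shows "(TC_M_Sigma E p \<le> enat k \<longleftrightarrow> TC_FH_Sigma E p \<le> enat k) \<and>
    (TC_FH_Sigma E p \<le> enat k \<longleftrightarrow> TC_DM_Sigma E p \<le> enat k) \<and>
    (TC_DM_Sigma E p \<le> enat k \<longleftrightarrow> TC_Sigma E p \<le> enat k) \<and>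
    (TC_Sigma E p \<le> enat k \<longleftrightarrow> (\<exists>\<sigma>. endpoints_join_section E p k \<sigma>)) \<and>
    ((\<exists>\<sigma>. endpoints_join_section E p k \<sigma>) \<longleftrightarrow>
     (\<exists>\<sigma>. endpoints_join_section E p k \<sigma> \<and>
        (\<forall>e\<in>topspace E. \<sigma> (e, e) = barycentric_section E p k e)))"
proof -
  let ?X = "fib_square E p"
  have E: "metrizable_space E"
    using homeomorphic_metrizable_space[OF E_ENR(2)] metrizable_space_subtopology[OF metrizable_space_euclidean]
    by blast
  then have X: "metrizable_space ?X"
    unfolding fib_square_def by (intro metrizable_space_subtopology) (simp add: metrizable_space_prod_topology)
  have dcl: "closedin ?X (diag E)"
    by (rule closedin_diag[OF metrizable_imp_Hausdorff_space[OF E]])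
  have dswap: "prod.swap ` diag E \<subseteq> diag E"
    by (auto simp: diag_def)
  have swap_diag: "x \<in> diag E" if "prod.swap x \<in> diag E" for x
    using that by (cases x) (auto simp: diag_def)
  have swapX: "prod.swap x \<in> topspace ?X" if "x \<in> topspace ?X" for x
    using that by (auto simp: topspace_fib_square)
  have p: "continuous_map E B p"
    using fibration(1) by (simp add: Hurewicz_fibration_def)
  obtain \<Gamma> where \<Gamma>: "lifting_function E B p \<Gamma>"
    using Hurewicz_fibration_lifting_function[OF fibration(1)] .
  obtain N lam where N: "openin ?X N" "diag E \<subseteq> N" "prod.swap ` N \<subseteq> N" "motion E p N lam"
      "\<And>e t. e \<in> topspace E \<Longrightarrow> t \<in> {0..1} \<Longrightarrow> lam (e, e) t = e"
    by (rule symmetric_equiconnection_fib_square[OF fibration(1) B_ANR(1) E_ENR], rule that)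
  define M where "M = (\<lambda>k. \<exists>U. Z2_open_cover ?X prod.swap k U \<and>
    (\<forall>i\<le>k. diag E \<subseteq> U i \<and>
       (\<exists>\<sigma>. endpoints_section E p (U i) \<sigma> \<and> (\<forall>e\<in>topspace E. \<sigma> (e, e) = const_path e))))"
  define FH where "FH = (\<lambda>k. \<exists>U \<sigma>. Z2_open_cover ?X prod.swap k U \<and>
    (\<forall>i\<le>k. endpoints_section E p (U i) (\<sigma> i)) \<and>
    diag E \<subseteq> U 0 \<and> (\<forall>e\<in>topspace E. \<sigma> 0 (e, e) = const_path e) \<and>
    (\<forall>i. 1 \<le> i \<and> i \<le> k \<longrightarrow> diag E \<inter> U i = {}))"
  define DM where "DM = (\<lambda>k. \<exists>U. Z2_open_cover ?X prod.swap k U \<and>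
    (\<forall>i\<le>k. \<exists>\<sigma>. endpoints_section E p (U i) \<sigma> \<and>
       (\<forall>e\<in>topspace E. (e, e) \<in> U i \<longrightarrow> \<sigma> (e, e) = const_path e)))"
  define Sig where "Sig = (\<lambda>k. \<exists>U. Z2_open_cover ?X prod.swap k U \<and>
    (\<forall>i\<le>k. \<exists>s. Z2_map (subtopology ?X (U i)) prod.swap (fib_paths E p) rev_path s \<and>
       Z2_homotopic (subtopology ?X (U i)) prod.swap ?X prod.swap (endpoints \<circ> s) id))"
  have TC: "TC_M_Sigma E p \<le> enat k \<longleftrightarrow> (\<exists>n\<le>k. M n)" "TC_FH_Sigma E p \<le> enat k \<longleftrightarrow> (\<exists>n\<le>k. FH n)"
      "TC_DM_Sigma E p \<le> enat k \<longleftrightarrow> (\<exists>n\<le>k. DM n)" "TC_Sigma E p \<le> enat k \<longleftrightarrow> (\<exists>n\<le>k. Sig n)"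
    unfolding TC_M_Sigma_def TC_FH_Sigma_def TC_DM_Sigma_def TC_Sigma_def secat_Z2_def
      M_def FH_def DM_def Sig_def Inf_enat_le_iff by (rule refl)+
  have M_FH: "FH n" if "M n" for n
  proof -
    obtain U where U: "Z2_open_cover ?X prod.swap n U" and Ud: "\<And>i. i \<le> n \<Longrightarrow> diag E \<subseteq> U i"
      and ex: "\<And>i. i \<le> n \<Longrightarrow> \<exists>\<sigma>. endpoints_section E p (U i) \<sigma> \<and> (\<forall>e\<in>topspace E. \<sigma> (e, e) = const_path e)"
      using \<open>M n\<close> unfolding M_def by blast
    obtain \<sigma> where \<sigma>: "\<And>i. i \<le> n \<Longrightarrow> endpoints_section E p (U i) (\<sigma> i)"
      "\<And>i e. i \<le> n \<Longrightarrow> e \<in> topspace E \<Longrightarrow> \<sigma> i (e, e) = const_path e"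
      using ex by metis
    \<comment> \<open>\<open>U 0\<close> contains the whole diagonal, so removing the diagonal from
      the other sets uncovers nothing.\<close>
    define V where "V = (\<lambda>i. if i = 0 then U 0 else U i - diag E)"
    have VU: "V i \<subseteq> U i" for i by (auto simp: V_def)
    have "Z2_open_cover ?X prod.swap n V"
      unfolding Z2_open_cover_def
    proof (intro conjI allI impI)
      fix i assume i: "i \<le> n"
      have Ui: "openin ?X (U i)" "prod.swap ` U i \<subseteq> U i"
        using U i unfolding Z2_open_cover_def by blast+
      then show "openin ?X (V i)" using dcl by (auto simp: V_def)
      show "prod.swap ` V i \<subseteq> V i"
        using Ui(2) swap_diag unfolding V_def by (cases "i = 0") auto
    next
      have "topspace ?X \<subseteq> (\<Union>i\<le>n. U i)" using U unfolding Z2_open_cover_def by blast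
      moreover have "U i \<subseteq> V i \<union> V 0" for i using Ud[of 0] by (auto simp: V_def)
      ultimately show "topspace ?X \<subseteq> (\<Union>i\<le>n. V i)" by blast
    qed
    then show ?thesis
      unfolding FH_def
      by (intro exI[of _ V] exI[of _ \<sigma>])
        (use \<sigma> Ud[of 0] Z2_section_on_subset[OF \<sigma>(1) VU] in \<open>auto simp: V_def\<close>)
  qed
  have FH_DM: "DM n" if FH: "FH n" for n
  proof -
    obtain U \<sigma> where U: "Z2_open_cover ?X prod.swap n U" "\<And>i. i \<le> n \<Longrightarrow> endpoints_section E p (U i) (\<sigma> i)"
      "\<And>e. e \<in> topspace E \<Longrightarrow> \<sigma> 0 (e, e) = const_path e" "\<And>i. 1 \<le> i \<Longrightarrow> i \<le> n \<Longrightarrow> diag E \<inter> U i = {}"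
      using FH unfolding FH_def by blast
    have "\<sigma> i (e, e) = const_path e" if "i \<le> n" "e \<in> topspace E" "(e, e) \<in> U i" for i e
    proof (cases "i = 0")
      case False
      then have "diag E \<inter> U i = {}" using U(4) that(1) by simp
      then show ?thesis using that(2,3) by (auto simp: diag_def)
    qed (use U(3) that(2) in simp)
    then show ?thesis unfolding DM_def using U(1,2) by blast
  qed
  have DM_Sig: "Sig n" if DM: "DM n" for n
  proof -
    obtain U where U: "Z2_open_cover ?X prod.swap n U" and ex: "\<And>i. i \<le> n \<Longrightarrow> \<exists>\<sigma>. endpoints_section E p (U i) \<sigma>"
      using DM unfolding DM_def by blast
    have "\<exists>s. Z2_map (subtopology ?X (U i)) prod.swap (fib_paths E p) rev_path s \<and>
       Z2_homotopic (subtopology ?X (U i)) prod.swap ?X prod.swap (endpoints \<circ> s) id" if i: "i \<le> n" for i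
    proof -
      have inv: "prod.swap ` U i \<subseteq> U i" using U i unfolding Z2_open_cover_def by blast
      obtain s where "endpoints_section E p (U i) s" using ex[OF i] by blast
      from Z2_homotopic_of_section[OF this swapX inv] show ?thesis by blast
    qed
    then show ?thesis unfolding Sig_def using U by blast
  qed
  have Sig_M: "M n" if Sig: "Sig n" for n
  proof -
    obtain U where U: "Z2_open_cover ?X prod.swap n U"
      and ex: "\<And>i. i \<le> n \<Longrightarrow> \<exists>s. Z2_map (subtopology ?X (U i)) prod.swap (fib_paths E p) rev_path s \<and>
       Z2_homotopic (subtopology ?X (U i)) prod.swap ?X prod.swap (endpoints \<circ> s) id"
      using Sig unfolding Sig_def by blast
    have Ui: "openin ?X (U i)" "prod.swap ` U i \<subseteq> U i" if "i \<le> n" for i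
      using U that unfolding Z2_open_cover_def by blast+
    \<comment> \<open>Used with the empty set for \<open>D\<close>. What matters is the closed
      refinement \<open>C\<close> of the cover; the weights only show that it covers.\<close>
    obtain \<phi> :: "nat \<Rightarrow> 'e \<times> 'e \<Rightarrow> real" and C where
      C: "\<And>i. i \<le> n \<Longrightarrow> closedin ?X (C i)" "\<And>i. i \<le> n \<Longrightarrow> C i \<subseteq> U i"
      and \<phi>C: "\<And>i y. i \<le> n \<Longrightarrow> y \<in> topspace ?X \<Longrightarrow> \<phi> i y \<noteq> 0 \<Longrightarrow> y \<in> C i"
      and \<phi>1: "\<And>y. y \<in> topspace ?X \<Longrightarrow> (\<Sum>i\<le>n. \<phi> i y) = 1"
      by (rule invariant_partition_of_unity[OF X continuous_map_swap_fib_square swap_swap U closedin_empty]) auto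
    have Ccov: "\<exists>i\<le>n. y \<in> C i" if y: "y \<in> topspace ?X" for y
    proof (rule ccontr)
      assume "\<not> ?thesis"
      then have "\<phi> i y = 0" if "i \<le> n" for i using \<phi>C[OF that y] that by blast
      then have "(\<Sum>i\<le>n. \<phi> i y) = 0" by simp
      then show False using \<phi>1[OF y] by simp
    qed
    \<comment> \<open>A single predicate, so that a domain and a motion can be chosen together for
      every index.\<close>
    define good where "good = (\<lambda>i V m. openin ?X V \<and> prod.swap ` V \<subseteq> V \<and> C i \<subseteq> V \<and> diag E \<subseteq> V \<and>
      motion E p V m \<and> (\<forall>e\<in>topspace E. \<forall>t\<in>{0..1}. m (e, e) t = e))"
    have "\<exists>V m. good i V m" if i: "i \<le> n" for i
    proof -
      obtain s where s: "Z2_map (subtopology ?X (U i)) prod.swap (fib_paths E p) rev_path s"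
        "Z2_homotopic (subtopology ?X (U i)) prod.swap ?X prod.swap (endpoints \<circ> s) id"
        using ex[OF i] by blast
      obtain m where m: "motion E p (U i) m"
        by (rule motion_of_homotopy_section[OF \<Gamma> p Ui(2)[OF i] s])
      obtain V m' where "openin ?X V" "prod.swap ` V \<subseteq> V" "C i \<subseteq> V" "diag E \<subseteq> V"
          "motion E p V m'" "\<And>e t. e \<in> topspace E \<Longrightarrow> t \<in> {0..1} \<Longrightarrow> m' (e, e) t = e"
        by (rule motion_extend_to_diagonal[OF N(1-4) _ Ui[OF i] m C(1)[OF i] C(2)[OF i]
              metrizable_imp_normal_space[OF X] dcl], erule (1) N(5), rule that)
      then have "good i V m'" unfolding good_def by blast
      then show ?thesis by blast
    qed
    then obtain V m where "\<And>i. i \<le> n \<Longrightarrow> good i (V i) (m i)"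
      by metis
    then have V: "\<And>i. i \<le> n \<Longrightarrow> openin ?X (V i)" "\<And>i. i \<le> n \<Longrightarrow> prod.swap ` V i \<subseteq> V i"
      "\<And>i. i \<le> n \<Longrightarrow> C i \<subseteq> V i" "\<And>i. i \<le> n \<Longrightarrow> diag E \<subseteq> V i" and m: "\<And>i. i \<le> n \<Longrightarrow> motion E p (V i) (m i)"
      "\<And>i e t. i \<le> n \<Longrightarrow> e \<in> topspace E \<Longrightarrow> t \<in> {0..1} \<Longrightarrow> m i (e, e) t = e"
      unfolding good_def by blast+
    have "Z2_open_cover ?X prod.swap n V"
      unfolding Z2_open_cover_def
    proof (intro conjI allI impI subsetI)
      fix y assume "y \<in> topspace ?X"
      then obtain i where "i \<le> n" "y \<in> C i" using Ccov by blast
      then show "y \<in> (\<Union>i\<le>n. V i)" using V(3)[of i] by blast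
    qed (use V(1,2) in \<open>blast+\<close>)
    moreover have "\<exists>\<sigma>. endpoints_section E p (V i) \<sigma> \<and> (\<forall>e\<in>topspace E. \<sigma> (e, e) = const_path e)"
      if i: "i \<le> n" for i
    proof (intro exI conjI ballI)
      show "endpoints_section E p (V i) (\<lambda>x. \<lambda>t\<in>{0..1}. m i x t)"
        by (rule motion_imp_endpoints_section[OF m(1)[OF i]])
      show "(\<lambda>t\<in>{0..1}. m i (e, e) t) = const_path e" if "e \<in> topspace E" for e
        unfolding const_path_def by (rule restrict_ext) (rule m(2)[OF i that])
    qed
    ultimately show ?thesis
      unfolding M_def using V(4) by blast
  qed
  have M_join: "\<exists>\<sigma>. endpoints_join_section E p k \<sigma> \<and> (\<forall>e\<in>topspace E. \<sigma> (e, e) = barycentric_section E p k e)"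
    if Mn: "M n" and n: "n \<le> k" for n
  proof -
    obtain U where U: "Z2_open_cover ?X prod.swap n U" and Ud: "\<And>i. i \<le> n \<Longrightarrow> diag E \<subseteq> U i"
      and ex: "\<And>i. i \<le> n \<Longrightarrow> \<exists>\<sigma>. endpoints_section E p (U i) \<sigma> \<and> (\<forall>e\<in>topspace E. \<sigma> (e, e) = const_path e)"
      using Mn unfolding M_def by blast
    obtain s where s: "\<And>i. i \<le> n \<Longrightarrow> endpoints_section E p (U i) (s i)"
      "\<And>i e. i \<le> n \<Longrightarrow> e \<in> topspace E \<Longrightarrow> s i (e, e) = const_path e"
      using ex by metis
    \<comment> \<open>A bound by \<open>k\<close> may come from fewer than \<open>k + 1\<close>
      sets, whereas the join has exactly \<open>k + 1\<close> entries; the last set and its section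
      are repeated.\<close>
    define U' where "U' = (\<lambda>i. U (min i n))"
    define s' where "s' = (\<lambda>i. s (min i n))"
    have U': "Z2_open_cover ?X prod.swap k U'"
    proof -
      have "(\<Union>i\<le>n. U i) \<subseteq> (\<Union>i\<le>k. U' i)"
      proof (rule UN_least)
        fix i assume "i \<in> {..n}"
        then have "i \<in> {..k}" "U i = U' i" using n by (auto simp: U'_def)
        then show "U i \<subseteq> (\<Union>i\<le>k. U' i)" by blast
      qed
      moreover have "topspace ?X \<subseteq> (\<Union>i\<le>n. U i)"
        using U unfolding Z2_open_cover_def by (rule conjunct2)
      moreover have "openin ?X (U' i) \<and> prod.swap ` U' i \<subseteq> U' i" for i
        using conjunct1[OF U[unfolded Z2_open_cover_def], rule_format, of "min i n"] by (simp add: U'_def)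
      ultimately show ?thesis
        unfolding Z2_open_cover_def by (intro conjI allI impI) (blast, blast, rule order_trans)
    qed
    have s': "endpoints_section E p (U' i) (s' i)" for i
      using s(1)[of "min i n"] by (simp add: U'_def s'_def)
    have dU': "diag E \<subseteq> U' i" for i
      using Ud[of "min i n"] by (simp add: U'_def)
    obtain \<phi> :: "nat \<Rightarrow> 'e \<times> 'e \<Rightarrow> real" and C where
      \<phi>: "\<And>i. i \<le> k \<Longrightarrow> continuous_map ?X euclideanreal (\<phi> i)"
        "\<And>i. i \<le> k \<Longrightarrow> closedin ?X (C i)" "\<And>i. i \<le> k \<Longrightarrow> C i \<subseteq> U' i"
        "\<And>i y. i \<le> k \<Longrightarrow> y \<in> topspace ?X \<Longrightarrow> \<phi> i (prod.swap y) = \<phi> i y"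
        "\<And>i y. i \<le> k \<Longrightarrow> y \<in> topspace ?X \<Longrightarrow> 0 \<le> \<phi> i y"
        "\<And>i y. i \<le> k \<Longrightarrow> y \<in> topspace ?X \<Longrightarrow> \<phi> i y \<noteq> 0 \<Longrightarrow> y \<in> C i"
        "\<And>y. y \<in> topspace ?X \<Longrightarrow> (\<Sum>i\<le>k. \<phi> i y) = 1"
      and \<phi>d: "\<And>i y. i \<le> k \<Longrightarrow> y \<in> diag E \<Longrightarrow> \<phi> i y = 1 / real (k + 1)"
      by (rule invariant_partition_of_unity[OF X continuous_map_swap_fib_square swap_swap U' dcl dswap dU'], rule that)
    obtain \<sigma> where \<sigma>: "endpoints_join_section E p k \<sigma>"
      "\<And>y. y \<in> topspace ?X \<Longrightarrow> \<forall>i\<le>k. \<phi> i y \<noteq> 0 \<Longrightarrow>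
         \<sigma> y = join_class (fib_paths E p) endpoints k (\<lambda>i\<in>{..k}. (s' i y, \<phi> i y))"
      by (rule join_section_of_cover[where X="fib_paths E p" and Y="?X" and a=rev_path and b=prod.swap
            and q=endpoints and k=k and U=U' and s=s' and \<phi>=\<phi> and C=C],
          (rule continuous_map_swap_fib_square U' s' rev_path_fib_paths \<phi>; assumption)+, rule that)
    have "\<sigma> (e, e) = barycentric_section E p k e" if e: "e \<in> topspace E" for e
    proof -
      have ee: "(e, e) \<in> diag E" "(e, e) \<in> topspace ?X"
        using e by (auto simp: diag_def topspace_fib_square)
      \<comment> \<open>On the diagonal all weights are \<open>1 / (k + 1)\<close>, in particular
        nonzero, so the explicit form of \<sigma> applies.\<close>
      have "\<sigma> (e, e) = join_class (fib_paths E p) endpoints k (\<lambda>i\<in>{..k}. (s' i (e, e), \<phi> i (e, e)))"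
        by (rule \<sigma>(2)[OF ee(2)]) (simp add: \<phi>d[OF _ ee(1)])
      also have "(\<lambda>i\<in>{..k}. (s' i (e, e), \<phi> i (e, e))) = (\<lambda>i\<in>{..k}. (const_path e, 1 / real (k + 1)))"
      proof (rule restrict_ext)
        fix i assume "i \<in> {..k}"
        then have "\<phi> i (e, e) = 1 / real (k + 1)" by (intro \<phi>d ee) simp
        moreover have "s' i (e, e) = const_path e"
          unfolding s'_def by (rule s(2)[OF _ e]) simp
        ultimately show "(s' i (e, e), \<phi> i (e, e)) = (const_path e, 1 / real (k + 1))" by (simp only:)
      qed
      finally show ?thesis by (simp only: barycentric_section_def)
    qed
    with \<sigma>(1) show ?thesis by blast
  qed
  have join_Sig: "Sig k" if \<sigma>: "endpoints_join_section E p k \<sigma>" for \<sigma>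
  proof -
    obtain U s where U: "Z2_open_cover ?X prod.swap k U" and s: "\<And>i. i \<le> k \<Longrightarrow> endpoints_section E p (U i) (s i)"
      by (rule cover_of_join_section[OF continuous_map_swap_fib_square _ _ \<sigma>],
          (rule rev_path_fib_paths; assumption)+, rule that)
    have "Z2_map (subtopology ?X (U i)) prod.swap (fib_paths E p) rev_path (s i) \<and>
       Z2_homotopic (subtopology ?X (U i)) prod.swap ?X prod.swap (endpoints \<circ> s i) id" if i: "i \<le> k" for i
    proof -
      have inv: "prod.swap ` U i \<subseteq> U i" using U i unfolding Z2_open_cover_def by blast
      from Z2_homotopic_of_section[OF s[OF i] swapX inv] show ?thesis by blast
    qed
    then show ?thesis unfolding Sig_def using U by blast
  qed
  show ?thesis
    unfolding TC using M_FH FH_DM DM_Sig Sig_M M_join join_Sig order_refl[of k] by meson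
qed

end
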